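(* Let $L$ be a countable scattered linear order and let $\mathbb P(L)=\{A\subseteq L : (A,<\restriction A)\cong (L,<)\}$. Then the partial order $\langle \mathbb P(L),\subseteq\rangle$ is homogeneous, atomless, of size $\mathfrak c$, and its separative quotient is $\sigma$-closed.
   Context: A linear order is scattered if the rational line $\mathbb Q$ does not embed into it. For a pre-order $\mathbb P=\langle P,\le\rangle$: $p\in P$ is an atom if any two $q,r\le p$ are compatible (have a common lower bound); $\mathbb P$ is atomless if it has no atoms; $\mathbb P$ is homogeneous if it has a largest element and $\mathbb P\cong\{q\in P: q\le p\}$ for every $p\in P$; $\mathbb P$ is $\sigma$-closed if every sequence $p_0\ge p_1\ge p_2\ge\cdots$ in $P$ has a lower bound in $P$. The separative modification of a partial order $\langle P,\le\rangle$ is the pre-order $\langle P,\le^*\rangle$ where $p\le^* q$ iff for every $r\le p$ there is $s\le r$ with $s\le q$; the separative quotient is the partial order obtained from $\langle P,\le^*\rangle$ by identifying $p,q$ whenever $p\le^*q$ and $q\le^*p$, ordered by $[p]\trianglelefteq[q]$ iff $p\le^* q$. $\mathfrak c=2^{\aleph_0}$. *)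

theory Defs
  imports "HOL-Library.Countable_Set" "HOL-Library.Equipollence"
begin

text \<open>
  An order is a carrier set together with a reflexive relation, as in
  \<^theory>\<open>HOL.Order_Relation\<close>. The definitions below only consult the relation on the
  given carrier, so a suborder is obtained by shrinking the carrier and keeping the relation.
\<close>

definition order_embeds :: "'a set \<Rightarrow> 'a rel \<Rightarrow> 'b set \<Rightarrow> 'b rel \<Rightarrow> bool" where
  "order_embeds A r B s \<longleftrightarrow>
    (\<exists>f. inj_on f A \<and> f ` A \<subseteq> B \<and> (\<forall>x\<in>A. \<forall>y\<in>A. (x, y) \<in> r \<longleftrightarrow> (f x, f y) \<in> s))"

definition order_isomorphic :: "'a set \<Rightarrow> 'a rel \<Rightarrow> 'b set \<Rightarrow> 'b rel \<Rightarrow> bool" where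
  "order_isomorphic A r B s \<longleftrightarrow>
    (\<exists>f. bij_betw f A B \<and> (\<forall>x\<in>A. \<forall>y\<in>A. (x, y) \<in> r \<longleftrightarrow> (f x, f y) \<in> s))"

definition scattered :: "'a set \<Rightarrow> 'a rel \<Rightarrow> bool" where
  "scattered L r \<longleftrightarrow> \<not> order_embeds (UNIV :: rat set) (relation_of (\<le>) UNIV) L r"

definition copies :: "'a set \<Rightarrow> 'a rel \<Rightarrow> 'a set set" where
  "copies L r = {A. A \<subseteq> L \<and> order_isomorphic A r L r}"

definition compatible :: "'a set \<Rightarrow> 'a rel \<Rightarrow> 'a \<Rightarrow> 'a \<Rightarrow> bool" where
  "compatible P r p q \<longleftrightarrow> (\<exists>s\<in>P. (s, p) \<in> r \<and> (s, q) \<in> r)"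

definition is_atom :: "'a set \<Rightarrow> 'a rel \<Rightarrow> 'a \<Rightarrow> bool" where
  "is_atom P r p \<longleftrightarrow>
    p \<in> P \<and> (\<forall>q\<in>P. \<forall>s\<in>P. (q, p) \<in> r \<longrightarrow> (s, p) \<in> r \<longrightarrow> compatible P r q s)"

definition atomless :: "'a set \<Rightarrow> 'a rel \<Rightarrow> bool" where
  "atomless P r \<longleftrightarrow> \<not> (\<exists>p. is_atom P r p)"

definition homogeneous :: "'a set \<Rightarrow> 'a rel \<Rightarrow> bool" where
  "homogeneous P r \<longleftrightarrow>
    (\<exists>m\<in>P. \<forall>q\<in>P. (q, m) \<in> r) \<and>
    (\<forall>p\<in>P. order_isomorphic P r {q \<in> P. (q, p) \<in> r} r)"

definition sigma_closed :: "'a set \<Rightarrow> 'a rel \<Rightarrow> bool" where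
  "sigma_closed P r \<longleftrightarrow>
    (\<forall>f :: nat \<Rightarrow> 'a. (\<forall>n. f n \<in> P) \<longrightarrow> (\<forall>n. (f (Suc n), f n) \<in> r) \<longrightarrow>
      (\<exists>p\<in>P. \<forall>n. (p, f n) \<in> r))"

definition sep_mod :: "'a set \<Rightarrow> 'a rel \<Rightarrow> 'a rel" where
  "sep_mod P r =
    {(p, q). p \<in> P \<and> q \<in> P \<and> (\<forall>t\<in>P. (t, p) \<in> r \<longrightarrow> (\<exists>s\<in>P. (s, t) \<in> r \<and> (s, q) \<in> r))}"

definition sep_equiv :: "'a set \<Rightarrow> 'a rel \<Rightarrow> 'a rel" where
  "sep_equiv P r = {(p, q). (p, q) \<in> sep_mod P r \<and> (q, p) \<in> sep_mod P r}"

definition sep_quotient :: "'a set \<Rightarrow> 'a rel \<Rightarrow> 'a set set" where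
  "sep_quotient P r = P // sep_equiv P r"

definition sep_quotient_order :: "'a set \<Rightarrow> 'a rel \<Rightarrow> 'a set rel" where
  "sep_quotient_order P r =
    {(sep_equiv P r `` {p}, sep_equiv P r `` {q}) | p q. (p, q) \<in> sep_mod P r}"

lemma preorder_on_sep_mod:
  assumes "preorder_on P r"
  shows "preorder_on P (sep_mod P r)"
proof -
  have refl: "\<And>x. x \<in> P \<Longrightarrow> (x, x) \<in> r"
    and tr: "\<And>x y z. (x, y) \<in> r \<Longrightarrow> (y, z) \<in> r \<Longrightarrow> (x, z) \<in> r"
    using assms by (auto simp: preorder_on_def refl_on_def dest: transD)
  have "trans (sep_mod P r)"
  proof (rule transI)
    fix x y z assume xy: "(x, y) \<in> sep_mod P r" and yz: "(y, z) \<in> sep_mod P r"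
    have "\<exists>s\<in>P. (s, t) \<in> r \<and> (s, z) \<in> r" if t: "t \<in> P" "(t, x) \<in> r" for t
    proof -
      obtain u where u: "u \<in> P" "(u, t) \<in> r" "(u, y) \<in> r"
        using xy t by (auto simp: sep_mod_def)
      obtain v where "v \<in> P" "(v, u) \<in> r" "(v, z) \<in> r"
        using yz u by (auto simp: sep_mod_def)
      then show ?thesis using u tr by blast
    qed
    then show "(x, z) \<in> sep_mod P r" using xy yz by (auto simp: sep_mod_def)
  qed
  moreover have "refl_on P (sep_mod P r)"
    using refl by (auto simp: refl_on_def sep_mod_def)
  ultimately show ?thesis by (auto simp: preorder_on_def sep_mod_def)
qed

lemma equiv_sep_equiv:
  assumes "preorder_on P r"
  shows "equiv P (sep_equiv P r)"
proof -
  have "sep_mod P r \<subseteq> P \<times> P" "refl_on P (sep_mod P r)" and tr: "trans (sep_mod P r)"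
    using preorder_on_sep_mod[OF assms] by (auto simp: preorder_on_def)
  moreover have "trans (sep_equiv P r)"
    unfolding sep_equiv_def by (rule transI) (auto intro: transD[OF tr])
  ultimately show ?thesis
    by (intro equivI) (auto simp: sep_equiv_def refl_on_def intro: symI)
qed

lemma sep_quotient_order_iff:
  assumes "preorder_on P r" "p \<in> P" "q \<in> P"
  shows "(sep_equiv P r `` {p}, sep_equiv P r `` {q}) \<in> sep_quotient_order P r
    \<longleftrightarrow> (p, q) \<in> sep_mod P r"
proof
  assume "(sep_equiv P r `` {p}, sep_equiv P r `` {q}) \<in> sep_quotient_order P r"
  then obtain p' q' where pq: "(p', q') \<in> sep_mod P r"
    and eqs: "sep_equiv P r `` {p} = sep_equiv P r `` {p'}" "sep_equiv P r `` {q} = sep_equiv P r `` {q'}"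
    by (auto simp: sep_quotient_order_def)
  have "p' \<in> P" "q' \<in> P" using pq by (auto simp: sep_mod_def)
  then have "(p, p') \<in> sep_equiv P r" "(q, q') \<in> sep_equiv P r"
    using eqs equiv_sep_equiv[OF assms(1)] assms(2,3) by (simp_all add: eq_equiv_class_iff)
  then have pp: "(p, p') \<in> sep_mod P r" and qq: "(q', q) \<in> sep_mod P r"
    by (simp_all add: sep_equiv_def)
  have tr: "trans (sep_mod P r)"
    using preorder_on_sep_mod[OF assms(1)] by (simp add: preorder_on_def)
  show "(p, q) \<in> sep_mod P r"
    by (rule transD[OF tr pp transD[OF tr pq qq]])
qed (auto simp: sep_quotient_order_def)

end

theory Submission
  imports Defs
begin

text \<open>
  The combinatorial core is Laver's structure theorem: a countable scattered order is a finite sum of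
  orders that are single points or sums over \<open>\<omega>\<close> or over its reverse of such orders in which every summand
  embeds in infinitely many summands. It follows from Hausdorff's analysis of scattered orders once
  these hereditarily indecomposable orders are known to be well-quasi-ordered, which is a
  Nash-Williams minimal bad array argument: of two incomparable sums in the same direction the first
  has a summand that embeds in no summand of the second, so that a minimal bad array, after making
  the direction constant by Ramsey's theorem, could be lowered further.

  Fix a copy of \<open>L\<close> inside \<open>L\<close> with a decomposition into the least number of indecomposable summands.
  By minimality, a subset contains a copy iff its trace on every summand contains a copy of this
  summand. A subset of a summand \<open>X = X\<^sub>0 + X\<^sub>1 + \<dots>\<close> contains a copy of \<open>X\<close> iff every \<open>X\<^sub>i\<close> embeds in it
  beyond every \<open>X\<^sub>m\<close>; here scatteredness excludes an embedding of \<open>X + X\<close> in \<open>X\<close>. Hence decreasing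
  sequences of copies have pseudo-intersections, assembled from bounded pieces, and the separative
  quotient is \<open>\<sigma>\<close>-closed. Distributing the summands \<open>X\<^sub>i\<close> over disjoint sets of indices yields
  incompatible copies and continuum many copies.
\<close>

section \<open>A Ramsey theorem for locally constant properties\<close>

text \<open>Minimal bad sequences do not suffice for the well-quasi-ordering. If a sum s does not
  embed in a sum u of the same direction, some summand of s embeds in no summand of u, but which one
  depends on u as well; the lowered object is indexed by pairs, the next one by triples, and so on.
  Functions of an infinite set X that read only a finite part of X absorb all these index sets, and
  comparing X with X minus its least element replaces comparing two terms.

  The trees of summands take their points from a linearly ordered type, so \<open>L\<close> is first
  represented in the rationals and then pushed into a set \<open>B\<close> with a minimal
  decomposition. \<open>B\<close> and the image of \<open>L\<close> embed in each other but may fail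
  to be isomorphic. This is enough: a subset of the image contains a copy of \<open>L\<close> iff
  \<open>B\<close> embeds in it. The separative order becomes tractable in these terms, since p is
  below q in it iff every copy inside p meets q in a set that contains a copy.

  That \<open>L\<close> is infinite matters: the only copy of a finite order is the order itself, so
  its poset of copies is a single atom.\<close>

lemma infinite_Int_atLeast:
  fixes A :: "nat set"
  shows "infinite A \<Longrightarrow> infinite (A \<inter> {k..})"
  using finite_subset[of A "(A \<inter> {k..}) \<union> {..<k}"] by force

lemma infinite_above_finite:
  fixes A s :: "nat set"
  assumes "finite s" "infinite A"
  shows "infinite {x \<in> A. \<forall>y\<in>s. y < x}"
proof -
  have "A \<inter> {Suc (Max (insert 0 s))..} \<subseteq> {x \<in> A. \<forall>y\<in>s. y < x}"
    using assms(1) by (auto simp: Suc_le_eq)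
  then show ?thesis using infinite_Int_atLeast[OF assms(2)] infinite_super by blast
qed

text \<open>Fusion. Below any bound there are only finitely many sets s, so each stage can shrink
  its infinite set once for all of them, and \<open>mono\<close> preserves what was achieved. The
  chosen elements beyond s all lie in a stage that has already dealt with s.\<close>

lemma diagonal_set:
  fixes R :: "nat set \<Rightarrow> nat set \<Rightarrow> bool"
  assumes mono: "\<And>s B C. R s B \<Longrightarrow> C \<subseteq> B \<Longrightarrow> infinite C \<Longrightarrow> R s C"
    and ex: "\<And>s B. finite s \<Longrightarrow> infinite B \<Longrightarrow> B \<subseteq> A \<Longrightarrow> \<exists>C\<subseteq>B. infinite C \<and> R s C"
    and A: "infinite A"
  shows "\<exists>C\<subseteq>A. infinite C \<and> (\<forall>s\<subseteq>C. finite s \<longrightarrow> R s {x \<in> C. \<forall>y\<in>s. y < x})"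
proof -
  have all: "\<exists>C\<subseteq>B. infinite C \<and> (\<forall>s\<in>F. R s C)"
    if "finite F" "\<forall>s\<in>F. finite s" "infinite B" "B \<subseteq> A" for F B
    using that
  proof (induction F)
    case (insert s F)
    then obtain C where C: "C \<subseteq> B" "infinite C" "\<forall>s\<in>F. R s C" by auto
    obtain D where D: "D \<subseteq> C" "infinite D" "R s D"
      using ex[of s C] insert.prems C by auto
    then show ?case using C mono by (intro exI[of _ D]) auto
  qed auto
  \<comment> \<open>A state is an infinite reservoir together with a threshold: the reservoir starts
    at or above the threshold and satisfies \<open>R s\<close> for every s below it. The next
    threshold is one past a chosen element of the reservoir.\<close>
  define P where "P n p \<longleftrightarrow> infinite (fst p) \<and> fst p \<subseteq> A \<and> fst p \<subseteq> {snd p..} \<and>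
    (\<forall>s\<subseteq>{..<snd p}. R s (fst p))" for n :: nat and p :: "nat set \<times> nat"
  define Q where "Q n p q \<longleftrightarrow> fst q \<subseteq> fst p \<and> (\<exists>a\<in>fst p. snd q = Suc a)"
    for n :: nat and p q :: "nat set \<times> nat"
  have "\<exists>h. \<forall>n. P n (h n) \<and> Q n (h n) (h (Suc n))"
  proof (rule dependent_nat_choice)
    obtain C where "C \<subseteq> A" "infinite C" "\<forall>s\<in>{{}}. R s C" using all[of "{{}}" A] A by auto
    then show "\<exists>p. P 0 p" by (intro exI[of _ "(C, 0)"]) (auto simp: P_def)
  next
    fix p n assume p: "P n p"
    obtain a where a: "a \<in> fst p" using p unfolding P_def by (metis ex_in_conv infinite_imp_nonempty)
    have "infinite (fst p \<inter> {Suc a..})"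
      using p infinite_Int_atLeast by (simp add: P_def)
    then obtain C where C: "C \<subseteq> fst p \<inter> {Suc a..}" "infinite C" "\<forall>s\<in>Pow {..<Suc a}. R s C"
      using all[of "Pow {..<Suc a}" "fst p \<inter> {Suc a..}"] p
      by (auto simp: P_def dest: finite_subset)
    then show "\<exists>q. P (Suc n) q \<and> Q n p q"
      using a p by (intro exI[of _ "(C, Suc a)"]) (auto simp: P_def Q_def)
  qed
  then obtain h where P: "\<And>n. P n (h n)" and Q: "\<And>n. Q n (h n) (h (Suc n))" by auto
  define B where "B n = fst (h n)" for n
  define t where "t n = snd (h n)" for n
  obtain a where a: "\<And>n. a n \<in> B n" "\<And>n. t (Suc n) = Suc (a n)"
    using Q unfolding Q_def B_def t_def by metis
  have B: "B m \<subseteq> B n" if "n \<le> m" for n m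
    by (rule lift_Suc_antimono_le[OF _ that]) (use Q in \<open>simp add: Q_def B_def\<close>)
  have ge: "t n \<le> a m" if "n \<le> m" for n m
    using B[OF that] a(1)[of m] P[of n] by (auto simp: P_def B_def t_def)
  have mo: "strict_mono a"
    unfolding strict_mono_Suc_iff using ge a(2) by (metis Suc_le_lessD order.refl)
  have t0: "\<exists>n. s \<subseteq> {..<t n} \<and> {x \<in> range a. \<forall>y\<in>s. y < x} \<subseteq> B n" if s: "s \<subseteq> range a" "finite s" for s
  proof (cases "s = {}")
    case True
    have "range a \<subseteq> B 0" using a(1) B by blast
    then show ?thesis using True by auto
  next
    case False
    then obtain n where n: "Max s = a n" using s by (meson Max_in imageE subsetD)
    have "s \<subseteq> {..<t (Suc n)}" using s n a(2) by (auto simp: less_Suc_eq_le[symmetric]) (metis Max_ge less_Suc_eq_le)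
    moreover have "{x \<in> range a. \<forall>y\<in>s. y < x} \<subseteq> B (Suc n)"
    proof clarify
      fix m assume "\<forall>y\<in>s. y < a m"
      then have "a n < a m" using n False s by (metis Max_in)
      then have "Suc n \<le> m" using mo by (simp add: strict_mono_less)
      then show "a m \<in> B (Suc n)" using a(1) B by blast
    qed
    ultimately show ?thesis by blast
  qed
  show ?thesis
  proof (intro exI[of _ "range a"] conjI allI impI)
    show "range a \<subseteq> A" using a(1) P unfolding P_def B_def by blast
    show "infinite (range a)" using mo strict_mono_imp_inj_on finite_imageD by blast
    fix s assume s: "s \<subseteq> range a" "finite s"
    obtain n where n: "s \<subseteq> {..<t n}" "{x \<in> range a. \<forall>y\<in>s. y < x} \<subseteq> B n" using t0[OF s] by auto
    have "infinite (range a)" using mo strict_mono_imp_inj_on finite_imageD by blast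
    then have "infinite {x \<in> range a. \<forall>y\<in>s. y < x}"
      using infinite_above_finite s(2) by blast
    then show "R s {x \<in> range a. \<forall>y\<in>s. y < x}"
      using P[of n] n mono[OF _ n(2)] by (auto simp: P_def B_def t_def)
  qed
qed

text \<open>The clopen case of the Galvin-Prikry theorem, by combinatorial forcing: a finite set s
  is accepted by B if all its infinite end-extensions from B satisfy \<open>S\<close>, and rejected
  if no infinite subset of B accepts it.\<close>

lemma clopen_Ramsey:
  fixes S :: "nat set \<Rightarrow> bool"
  assumes A: "infinite A"
    and S: "\<And>X. infinite X \<Longrightarrow> X \<subseteq> A \<Longrightarrow>
      \<exists>k. \<forall>Y\<subseteq>A. infinite Y \<longrightarrow> Y \<inter> {..<k} = X \<inter> {..<k} \<longrightarrow> S Y = S X"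
  shows "\<exists>B\<subseteq>A. infinite B \<and> ((\<forall>X\<subseteq>B. infinite X \<longrightarrow> S X) \<or> (\<forall>X\<subseteq>B. infinite X \<longrightarrow> \<not> S X))"
proof -
  define acc where "acc s B \<longleftrightarrow> (\<forall>X\<subseteq>B. infinite X \<longrightarrow> (\<forall>x\<in>X. \<forall>y\<in>s. y < x) \<longrightarrow> S (s \<union> X))" for s B
  define rej where "rej s B \<longleftrightarrow> (\<forall>C\<subseteq>B. infinite C \<longrightarrow> \<not> acc s C)" for s B
  define up where "up s B = {x \<in> B. \<forall>y\<in>s. y < x}" for s B :: "nat set"
  have acc_up: "acc s (up s B) \<Longrightarrow> acc s B" for s B
    by (simp add: acc_def up_def subset_iff)
  have acc_mono: "acc s B \<Longrightarrow> C \<subseteq> B \<Longrightarrow> acc s C" for s B C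
    by (simp add: acc_def subset_iff)
  have inf_up: "infinite (up s B)" if "finite s" "infinite B" for s B
    unfolding up_def using that by (rule infinite_above_finite)
  have "\<exists>C\<subseteq>A. infinite C \<and> (\<forall>s\<subseteq>C. finite s \<longrightarrow> acc s (up s C) \<or> rej s (up s C))"
    unfolding up_def
  proof (rule diagonal_set)
    fix s B C assume "acc s B \<or> rej s B" "C \<subseteq> B" "infinite C"
    then show "acc s C \<or> rej s C" unfolding rej_def using acc_mono by (meson order_trans)
  next
    fix s B assume "finite (s :: nat set)" "infinite (B :: nat set)"
    then show "\<exists>C\<subseteq>B. infinite C \<and> (acc s C \<or> rej s C)"
      unfolding rej_def by (metis order_refl)
  qed (rule A)
  then obtain B where B: "B \<subseteq> A" "infinite B"
    "\<And>s. s \<subseteq> B \<Longrightarrow> finite s \<Longrightarrow> acc s (up s B) \<or> rej s (up s B)"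
    by blast
  have acc_rej: "acc s B \<or> rej s B" if "s \<subseteq> B" "finite s" for s
  proof -
    have "rej s B" if r: "rej s (up s B)"
      unfolding rej_def
    proof (intro allI impI notI)
      fix C assume C: "C \<subseteq> B" "infinite C" "acc s C"
      have "acc s (up s C)" using acc_mono[OF C(3)] by (auto simp: up_def)
      moreover have "up s C \<subseteq> up s B" using C by (auto simp: up_def)
      ultimately show False using r inf_up[OF \<open>finite s\<close> C(2)] unfolding rej_def by blast
    qed
    then show ?thesis using B(3)[OF that] acc_up by blast
  qed
  show ?thesis
  proof (cases "acc {} B")
    case True
    then show ?thesis using B by (intro exI[of _ B]) (auto simp: acc_def)
  next
    case False
    \<comment> \<open>The empty set is now rejected. A second fusion makes rejection hereditary: it
      passes from s to s with any later element of the new set added.\<close>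
    have "\<exists>C\<subseteq>B. infinite C \<and> (\<forall>s\<subseteq>C. finite s \<longrightarrow>
      (s \<subseteq> B \<longrightarrow> rej s B \<longrightarrow> (\<forall>b\<in>up s C. rej (insert b s) B)))"
      unfolding up_def
    proof (rule diagonal_set)
      fix s C :: "nat set" assume s: "finite s" and C: "infinite C" "C \<subseteq> B"
      define D where "D = {b \<in> up s C. \<not> rej (insert b s) B}"
      show "\<exists>D\<subseteq>C. infinite D \<and> (s \<subseteq> B \<longrightarrow> rej s B \<longrightarrow> (\<forall>b\<in>D. rej (insert b s) B))"
      proof (cases "s \<subseteq> B \<and> rej s B")
        case True
        \<comment> \<open>Were \<open>D\<close> infinite, it would accept s: an infinite subset X of
          \<open>D\<close> starts with some b, and s with b added is accepted.\<close>
        have "finite D"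
        proof (rule ccontr)
          assume inf: "infinite D"
          have "acc s D"
            unfolding acc_def
          proof (intro allI impI)
            fix X assume X: "X \<subseteq> D" "infinite X" "\<forall>x\<in>X. \<forall>y\<in>s. y < x"
            define b where "b = (LEAST x. x \<in> X)"
            have b: "b \<in> X" "\<And>x. x \<in> X \<Longrightarrow> b \<le> x"
              unfolding b_def using X(2) by (auto intro: LeastI Least_le dest!: infinite_imp_nonempty)
            have "insert b s \<subseteq> B" "\<not> rej (insert b s) B" using b X C True by (auto simp: D_def up_def)
            then have "acc (insert b s) B" using acc_rej s by blast
            moreover have "X - {b} \<subseteq> B" "infinite (X - {b})" using X C by (auto simp: D_def up_def)
            moreover have "\<forall>x\<in>X - {b}. \<forall>y\<in>insert b s. y < x"
              using b X(3) by (auto simp: order_le_neq_trans)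
            ultimately have "S (insert b s \<union> (X - {b}))" unfolding acc_def by blast
            also have "insert b s \<union> (X - {b}) = s \<union> X" using b by auto
            finally show "S (s \<union> X)" .
          qed
          moreover have "D \<subseteq> B" using C by (auto simp: D_def up_def)
          ultimately show False using True inf unfolding rej_def by blast
        qed
        then have "infinite (up s C - D)" using inf_up[OF s C(1)] by simp
        then show ?thesis by (intro exI[of _ "up s C - D"]) (auto simp: D_def up_def)
      qed (use C in auto)
    qed (use B in auto)
    then obtain C where C: "C \<subseteq> B" "infinite C"
      "\<And>s b. s \<subseteq> C \<Longrightarrow> finite s \<Longrightarrow> rej s B \<Longrightarrow> b \<in> up s C \<Longrightarrow> rej (insert b s) B"
      by (meson order_trans)
    have rejC: "rej s B" if "finite s" "s \<subseteq> C" for s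
      using that
    proof (induction s rule: finite_linorder_max_induct)
      case empty
      then show ?case using False acc_rej[of "{}"] by auto
    next
      case (insert b s)
      then show ?case using C(3)[of s b] by (auto simp: up_def)
    qed
    \<comment> \<open>Local constancy enters here: from \<open>S X\<close>, an initial segment of X
      would be accepted by a tail of \<open>B\<close>, although all finite subsets of
      \<open>C\<close> are rejected.\<close>
    have "\<not> S X" if X: "X \<subseteq> C" "infinite X" for X
    proof
      assume "S X"
      then obtain k where k: "\<And>Y. Y \<subseteq> A \<Longrightarrow> infinite Y \<Longrightarrow> Y \<inter> {..<k} = X \<inter> {..<k} \<Longrightarrow> S Y"
        using S[OF X(2)] X(1) C(1) B(1) by (meson order_trans)
      define s where "s = X \<inter> {..<k}"
      have "acc s (B \<inter> {k..})"
        unfolding acc_def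
      proof (intro allI impI)
        fix Y assume Y: "Y \<subseteq> B \<inter> {k..}" "infinite Y"
        have "s \<union> Y \<subseteq> A" "infinite (s \<union> Y)" using Y B C X by (auto simp: s_def)
        moreover have "(s \<union> Y) \<inter> {..<k} = X \<inter> {..<k}" using Y by (auto simp: s_def)
        ultimately show "S (s \<union> Y)" by (rule k)
      qed
      moreover have "infinite (B \<inter> {k..})"
        using B(2) by (rule infinite_Int_atLeast)
      ultimately have "\<not> rej s B" unfolding rej_def by blast
      then show False using rejC[of s] X by (auto simp: s_def)
    qed
    then show ?thesis using C B by (intro exI[of _ C]) auto
  qed
qed

section \<open>Minimal bad arrays\<close>

definition rest :: "nat set \<Rightarrow> nat set" where
  "rest X = X - {LEAST x. x \<in> X}"

text \<open>
  An array is a locally constant function on the infinite subsets of \<open>A\<close>: its value at \<open>X\<close> depends only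
  on the part of \<open>X\<close> below the modulus \<open>m X\<close>. Only values at infinite subsets of \<open>A\<close> matter.
\<close>

definition array :: "nat set \<Rightarrow> (nat set \<Rightarrow> 'q) \<Rightarrow> (nat set \<Rightarrow> nat) \<Rightarrow> bool" where
  "array A f m \<longleftrightarrow> infinite A \<and> (\<forall>X Y. X \<subseteq> A \<longrightarrow> infinite X \<longrightarrow> Y \<subseteq> A \<longrightarrow> infinite Y \<longrightarrow>
    Y \<inter> {..<m X} = X \<inter> {..<m X} \<longrightarrow> m Y = m X \<and> f Y = f X)"

text \<open>For an array that reads only the least element of its argument this is badness of a
  sequence, since the least elements of X and \<open>rest X\<close> form an arbitrary increasing
  pair.\<close>

definition bad :: "('q \<Rightarrow> 'q \<Rightarrow> bool) \<Rightarrow> nat set \<Rightarrow> (nat set \<Rightarrow> 'q) \<Rightarrow> bool" where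
  "bad le A f \<longleftrightarrow> (\<forall>X\<subseteq>A. infinite X \<longrightarrow> \<not> le (f X) (f (rest X)))"

lemma infinite_rest: "infinite X \<Longrightarrow> infinite (rest X)"
  by (simp add: rest_def)

lemma rest_subset: "rest X \<subseteq> X"
  by (auto simp: rest_def)

lemma Int_lessThan_mono:
  fixes j k :: nat
  assumes "Y \<inter> {..<k} = X \<inter> {..<k}" "j \<le> k"
  shows "Y \<inter> {..<j} = X \<inter> {..<j}"
proof -
  have "Z \<inter> {..<j} = (Z \<inter> {..<k}) \<inter> {..<j}" for Z using assms(2) by auto
  then show ?thesis using assms(1) by metis
qed

lemma array_cong:
  assumes "array A f m" "X \<subseteq> A" "infinite X" "Y \<subseteq> A" "infinite Y" "Y \<inter> {..<m X} = X \<inter> {..<m X}"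
  shows "m Y = m X" "f Y = f X"
  using assms unfolding array_def by blast+

text \<open>
  A value may be lowered only if the modulus passes a further element of the set; this is what keeps
  the limit of a sequence of refinements locally constant.
\<close>

definition refines :: "('q \<times> 'q) set \<Rightarrow> nat set \<Rightarrow> (nat set \<Rightarrow> 'q) \<Rightarrow> (nat set \<Rightarrow> nat) \<Rightarrow>
    nat set \<Rightarrow> (nat set \<Rightarrow> 'q) \<Rightarrow> (nat set \<Rightarrow> nat) \<Rightarrow> bool" where
  "refines sub B g k A f m \<longleftrightarrow> B \<subseteq> A \<and> (\<forall>X\<subseteq>B. infinite X \<longrightarrow>
    g X = f X \<and> k X = m X \<or> (g X, f X) \<in> sub \<and> (\<exists>x\<in>X. m X \<le> x \<and> x < k X))"

lemma refinesD:
  assumes "refines sub B g k A f m" "X \<subseteq> B" "infinite X"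
  shows "g X = f X \<and> k X = m X \<or> (g X, f X) \<in> sub \<and> (\<exists>x\<in>X. m X \<le> x \<and> x < k X)"
  using assms by (simp add: refines_def)

text \<open>A segment counts as decided when the modulus of X reads no element of X from t on. There
  are finitely many segments below t, so the number of decided ones can be minimised; refining can
  only remove some.\<close>

definition traces :: "nat set \<Rightarrow> (nat set \<Rightarrow> nat) \<Rightarrow> nat \<Rightarrow> nat set set" where
  "traces A m t = {X \<inter> {..<t} | X. X \<subseteq> A \<and> infinite X \<and> X \<inter> {..<m X} \<subseteq> {..<t}}"

lemma finite_traces: "finite (traces A m t)"
  by (rule finite_subset[of _ "Pow {..<t}"]) (auto simp: traces_def)

lemma refines_trans:
  assumes "trans sub" "refines sub C h l B g k" "refines sub B g k A f m"
  shows "refines sub C h l A f m"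
  unfolding refines_def
proof (intro conjI allI impI)
  show "C \<subseteq> A" using assms by (auto simp: refines_def)
  fix X assume X: "X \<subseteq> C" "infinite X"
  then have "X \<subseteq> B" using assms by (auto simp: refines_def)
  then have "h X = g X \<and> l X = k X \<or> (h X, g X) \<in> sub \<and> (\<exists>x\<in>X. k X \<le> x \<and> x < l X)"
    "g X = f X \<and> k X = m X \<or> (g X, f X) \<in> sub \<and> (\<exists>x\<in>X. m X \<le> x \<and> x < k X)"
    using assms X unfolding refines_def by blast+
  then show "h X = f X \<and> l X = m X \<or> (h X, f X) \<in> sub \<and> (\<exists>x\<in>X. m X \<le> x \<and> x < l X)"
    using \<open>trans sub\<close> by (smt (verit) le_trans less_imp_le less_le_trans transD)
qed

lemma refines_traces:
  assumes "refines sub B g k A f m"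
  shows "traces B k t \<subseteq> traces A m t"
proof
  fix s assume "s \<in> traces B k t"
  then obtain X where X: "s = X \<inter> {..<t}" "X \<subseteq> B" "infinite X" "X \<inter> {..<k X} \<subseteq> {..<t}"
    by (auto simp: traces_def)
  have "k X = m X \<or> (\<exists>x\<in>X. m X \<le> x \<and> x < k X)" "B \<subseteq> A"
    using assms X(2,3) unfolding refines_def by blast+
  then have "m X \<le> k X" by auto
  then have "X \<inter> {..<m X} \<subseteq> {..<t}" using X(4) by auto
  then show "s \<in> traces A m t"
    unfolding traces_def using X(1-3) \<open>B \<subseteq> A\<close> by blast
qed

text \<open>The two functions are mixed only at X outside \<open>C\<close> with
  \<open>rest X\<close> inside \<open>C\<close>. There a comparison of \<open>f X\<close> with
  \<open>g (rest X)\<close> would give one with the larger \<open>f (rest X)\<close>, by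
  transitivity.\<close>

lemma bad_override:
  assumes f: "bad le A f" and g: "bad le C g" and E: "E \<subseteq> A"
    and le: "\<And>X. X \<subseteq> C \<Longrightarrow> infinite X \<Longrightarrow> le (g X) (f X)"
    and trans: "\<And>x y z. le x y \<Longrightarrow> le y z \<Longrightarrow> le x z"
  shows "bad le E (\<lambda>X. if X \<subseteq> C then g X else f X)"
  unfolding bad_def
proof (intro allI impI notI)
  fix X assume X: "X \<subseteq> E" "infinite X"
    and *: "le (if X \<subseteq> C then g X else f X) (if rest X \<subseteq> C then g (rest X) else f (rest X))"
  have r: "rest X \<subseteq> X" "infinite (rest X)" using X by (simp_all add: rest_subset infinite_rest)
  have nf: "\<not> le (f X) (f (rest X))" using f X E unfolding bad_def by (meson order_trans)
  show False
  proof (cases "X \<subseteq> C")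
    case True
    then show False using g X r * unfolding bad_def by (auto dest: order_trans)
  next
    case False
    then show False using * nf le[of "rest X"] trans r by (auto split: if_splits)
  qed
qed

text \<open>
  Fusion: the \<open>n\<close>-th refinement keeps the elements of the domain below a threshold \<open>t n\<close> and, among all
  such refinements, leaves undecided as many initial segments below \<open>t n\<close> as possible. A bad array
  strictly below the limit, combined with the limit on the sets that are not contained in its
  domain, would leave one more initial segment undecided at the stage of its least modulus.
\<close>

lemma minimal_bad_array:
  assumes wf: "wf sub" and tr: "trans sub"
    and sub_le: "\<And>x y. (x, y) \<in> sub \<Longrightarrow> le x y"
    and le_trans: "\<And>x y z. le x y \<Longrightarrow> le y z \<Longrightarrow> le x z"
    and arr: "array A f m" and bad: "bad le A f"
  shows "\<exists>B\<subseteq>A. \<exists>g k. array B g k \<and> bad le B g \<and>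
    (\<forall>X\<subseteq>B. infinite X \<longrightarrow> g X = f X \<or> (g X, f X) \<in> sub) \<and>
    (\<forall>C h l. C \<subseteq> B \<longrightarrow> array C h l \<longrightarrow> bad le C h \<longrightarrow> (\<exists>X\<subseteq>C. infinite X \<and> (h X, g X) \<notin> sub))"
proof -
  define ok where "ok n p \<longleftrightarrow> (case p of (A, f, m, t) \<Rightarrow> array A f m \<and> bad le A f \<and> (n = 0 \<longrightarrow> t = 0))"
    for n :: nat and p :: "nat set \<times> (nat set \<Rightarrow> 'a) \<times> (nat set \<Rightarrow> nat) \<times> nat"
  define cand where "cand B g k A f m t \<longleftrightarrow> array B g k \<and> bad le B g \<and> refines sub B g k A f m \<and>
    B \<inter> {..<t} = A \<inter> {..<t}" for A f m B g k and t :: nat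
  \<comment> \<open>The new threshold is just past the least element a of the new domain from the
    old threshold on. Later stages keep everything below it, so the intersection of the domains
    contains all these a and is infinite.\<close>
  define step where "step n p q \<longleftrightarrow> (case p of (A, f, m, t) \<Rightarrow> case q of (A', f', m', t') \<Rightarrow>
    cand A' f' m' A f m t \<and> (\<exists>a\<in>A'. t \<le> a \<and> t' = Suc a \<and> A' \<inter> {t..<a} = {}) \<and>
    (\<forall>B g k. cand B g k A f m t \<longrightarrow> card (traces A' m' t) \<le> card (traces B k t)))"
    for n :: nat and p q
  have "\<exists>h. h 0 = (A, f, m, 0) \<and> (\<forall>n. ok n (h n)) \<and> (\<forall>n. step n (h n) (h (Suc n)))"
  proof -
    have "\<exists>h. \<forall>n. (ok n (h n) \<and> (n = 0 \<longrightarrow> h n = (A, f, m, 0))) \<and> step n (h n) (h (Suc n))"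
    proof (rule dependent_nat_choice)
      show "\<exists>p. ok 0 p \<and> (0 = 0 \<longrightarrow> p = (A, f, m, 0))" using arr bad by (auto simp: ok_def)
    next
      fix p and n :: nat assume p: "ok n p \<and> (n = 0 \<longrightarrow> p = (A, f, m, 0))"
      obtain A' f' m' t where p': "p = (A', f', m', t)" using prod_cases4 by blast
      have "cand A' f' m' A' f' m' t" using p p' by (auto simp: cand_def ok_def refines_def)
      then have ex: "case (A', f', m') of (B, g, k) \<Rightarrow> cand B g k A' f' m' t" by simp
      obtain z where z: "case z of (B, g, k) \<Rightarrow> cand B g k A' f' m' t"
        "\<And>y. (case y of (B, g, k) \<Rightarrow> cand B g k A' f' m' t) \<Longrightarrow>
          (case z of (B, g, k) \<Rightarrow> card (traces B k t)) \<le> (case y of (B, g, k) \<Rightarrow> card (traces B k t))"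
        using ex_has_least_nat[of "\<lambda>z. case z of (B, g, k) \<Rightarrow> cand B g k A' f' m' t",
            OF ex, of "\<lambda>z. case z of (B, g, k) \<Rightarrow> card (traces B k t)"] by blast
      obtain B g k where z': "z = (B, g, k)" using prod_cases3 by blast
      have c: "cand B g k A' f' m' t" using z z' by simp
      have mn: "card (traces B k t) \<le> card (traces C l t)" if "cand C h l A' f' m' t" for C h l
        using z(2)[of "(C, h, l)"] z' that by simp
      have "infinite (B \<inter> {t..})" by (rule infinite_Int_atLeast) (use c in \<open>simp add: cand_def array_def\<close>)
      then have ex: "\<exists>x. x \<in> B \<and> t \<le> x" by (metis Int_iff atLeast_iff ex_in_conv infinite_imp_nonempty)
      define a where "a = (LEAST x. x \<in> B \<and> t \<le> x)"
      have a: "a \<in> B" "t \<le> a" using LeastI_ex[OF ex] by (simp_all add: a_def)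
      have "B \<inter> {t..<a} = {}" using not_less_Least[of _ "\<lambda>x. x \<in> B \<and> t \<le> x"] by (auto simp: a_def)
      then have "step n p (B, g, k, Suc a)" using c mn a by (auto simp: step_def p')
      moreover have "ok (Suc n) (B, g, k, Suc a)" using c by (simp add: ok_def cand_def)
      ultimately show "\<exists>q. (ok (Suc n) q \<and> (Suc n = 0 \<longrightarrow> q = (A, f, m, 0))) \<and> step n p q"
        by blast
    qed
    then show ?thesis by auto
  qed
  then obtain h where h0: "h 0 = (A, f, m, 0)" and ok: "\<And>n. ok n (h n)"
    and step: "\<And>n. step n (h n) (h (Suc n))" by auto
  define As where "As n = fst (h n)" for n
  define F where "F n = fst (snd (h n))" for n
  define M where "M n = fst (snd (snd (h n)))" for n
  define t where "t n = snd (snd (snd (h n)))" for n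
  have h: "h n = (As n, F n, M n, t n)" for n by (simp add: As_def F_def M_def t_def)
  have t0: "t 0 = 0" using h0 by (simp add: t_def)
  have arr': "array (As n) (F n) (M n)" and bad': "bad le (As n) (F n)" for n
    using ok[of n] by (simp_all add: ok_def h)
  have cnd: "cand (As (Suc n)) (F (Suc n)) (M (Suc n)) (As n) (F n) (M n) (t n)"
    and mn: "\<And>B g k. cand B g k (As n) (F n) (M n) (t n) \<Longrightarrow>
      card (traces (As (Suc n)) (M (Suc n)) (t n)) \<le> card (traces B k (t n))"
    and ex_a: "\<exists>a\<in>As (Suc n). t n \<le> a \<and> t (Suc n) = Suc a \<and> As (Suc n) \<inter> {t n..<a} = {}" for n
    using step[of n] unfolding step_def h by auto
  obtain a where a: "\<And>n. a n \<in> As (Suc n)" "\<And>n. t n \<le> a n" "\<And>n. t (Suc n) = Suc (a n)"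
    "\<And>n. As (Suc n) \<inter> {t n..<a n} = {}"
    using ex_a by metis
  have t_mono: "t n \<le> t k" if "n \<le> k" for n k
    by (rule lift_Suc_mono_le[OF _ that]) (use a in \<open>simp add: le_Suc_eq\<close>)
  have ref: "refines sub (As k) (F k) (M k) (As n) (F n) (M n)" if "n \<le> k" for n k
    using that
  proof (induction k rule: dec_induct)
    case base
    show ?case by (auto simp: refines_def)
  next
    case (step k)
    then show ?case using refines_trans[OF tr] cnd[of k] by (auto simp: cand_def)
  qed
  have As_dec: "As k \<subseteq> As n" if "n \<le> k" for n k using ref[OF that] by (simp add: refines_def)
  have As_fix: "As k \<inter> {..<t n} = As n \<inter> {..<t n}" if "n \<le> k" for n k
    using that
  proof (induction k rule: dec_induct)
    case (step k)
    have "As (Suc k) \<inter> {..<t k} = As k \<inter> {..<t k}" using cnd[of k] by (simp add: cand_def)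
    then have "As (Suc k) \<inter> {..<t n} = As k \<inter> {..<t n}" using t_mono[OF step(1)] by fastforce
    then show ?case using step by simp
  qed simp
  define W where "W = (\<Inter>n. As n)"
  have W_sub: "W \<subseteq> As n" for n by (auto simp: W_def)
  have W_fix: "W \<inter> {..<t n} = As n \<inter> {..<t n}" for n
  proof
    show "As n \<inter> {..<t n} \<subseteq> W \<inter> {..<t n}"
    proof
      fix x assume x: "x \<in> As n \<inter> {..<t n}"
      have "x \<in> As k" for k
        using As_dec[of k n] As_fix[of n k] x by (cases "k \<le> n") auto
      then show "x \<in> W \<inter> {..<t n}" using x by (simp add: W_def)
    qed
  qed (use W_sub in auto)
  have "a n \<in> W" for n using W_fix[of "Suc n"] a(1)[of n] a(3)[of n] by auto
  moreover have "strict_mono a"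
    unfolding strict_mono_Suc_iff using a(2,3) by (metis Suc_le_eq)
  ultimately have W_inf: "infinite W"
    by (metis finite_imageD finite_subset image_subsetI infinite_UNIV_nat strict_mono_imp_inj_on)
  \<comment> \<open>By well-foundedness the value at X is lowered only finitely often, and the
    modulus changes only together with the value, so both are eventually constant.\<close>
  have "\<exists>N. \<forall>n\<ge>N. F n X = F N X \<and> M n X = M N X" if X: "X \<subseteq> W" "infinite X" for X
  proof -
    obtain N where N: "\<And>n. (F n X, F N X) \<notin> sub"
      using wfE_min[OF wf, of "F 0 X" "range (\<lambda>n. F n X)"] by (metis rangeE rangeI)
    have "F n X = F N X \<and> M n X = M N X" if "N \<le> n" for n
      using ref[OF that] N[of n] X W_sub[of n] unfolding refines_def by (meson order_trans)
    then show ?thesis by blast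
  qed
  then obtain st where st: "\<And>X n. X \<subseteq> W \<Longrightarrow> infinite X \<Longrightarrow> st X \<le> n \<Longrightarrow>
      F n X = F (st X) X \<and> M n X = M (st X) X" by metis
  define G where "G X = F (st X) X" for X
  define K where "K X = M (st X) X" for X
  have GK: "F n X = G X" "M n X = K X" if "X \<subseteq> W" "infinite X" "st X \<le> n" for X n
    using st[OF that] by (simp_all add: G_def K_def)
  have refW: "refines sub W G K (As n) (F n) (M n)" for n
    unfolding refines_def
  proof (intro conjI allI impI)
    fix X assume X: "X \<subseteq> W" "infinite X"
    have "X \<subseteq> As (max n (st X))" using X W_sub by blast
    then show "G X = F n X \<and> K X = M n X \<or> (G X, F n X) \<in> sub \<and> (\<exists>x\<in>X. M n X \<le> x \<and> x < K X)"
      using refinesD[OF ref[of n "max n (st X)"], of X] GK[OF X, of "max n (st X)"] X(2) by simp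
  qed (rule W_sub)
  have arrW: "array W G K"
    unfolding array_def
  proof (intro conjI allI impI W_inf)
    fix X Y assume X: "X \<subseteq> W" "infinite X" and Y: "Y \<subseteq> W" "infinite Y"
      and XY: "Y \<inter> {..<K X} = X \<inter> {..<K X}"
    define n where "n = max (st X) (st Y)"
    have "F n X = G X" "M n X = K X" "F n Y = G Y" "M n Y = K Y"
      using GK X Y by (simp_all add: n_def)
    moreover have "X \<subseteq> As n" "Y \<subseteq> As n" using X Y W_sub by blast+
    ultimately show "K Y = K X" "G Y = G X"
      using array_cong[OF arr'[of n], of X Y] X Y XY by simp_all
  qed
  have badW: "bad le W G"
    unfolding bad_def
  proof (intro allI impI)
    fix X assume X: "X \<subseteq> W" "infinite X"
    have r: "rest X \<subseteq> W" "infinite (rest X)" using X rest_subset infinite_rest by blast+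
    define n where "n = max (st X) (st (rest X))"
    have "F n X = G X" "F n (rest X) = G (rest X)"
      using GK(1)[OF X, of n] GK(1)[OF r, of n] by (simp_all add: n_def)
    moreover have "X \<subseteq> As n" using X W_sub by blast
    ultimately show "\<not> le (G X) (G (rest X))"
      using bad'[of n] X unfolding bad_def by metis
  qed
  have minimal: "\<exists>X\<subseteq>C. infinite X \<and> (g X, G X) \<notin> sub"
    if C: "C \<subseteq> W" and ag: "array C g l" and bg: "bad le C g" for C g l
  proof (rule ccontr)
    assume "\<not> ?thesis"
    then have drop: "\<And>X. X \<subseteq> C \<Longrightarrow> infinite X \<Longrightarrow> (g X, G X) \<in> sub" by blast
    have C_inf: "infinite C" using ag by (simp add: array_def)
    define nx where "nx X = (LEAST x. x \<in> X \<and> K X \<le> x)" for X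
    have nx: "nx X \<in> X" "K X \<le> nx X" "\<And>y. y \<in> X \<Longrightarrow> K X \<le> y \<Longrightarrow> nx X \<le> y" if "infinite X" for X
    proof -
      have "\<exists>x. x \<in> X \<and> K X \<le> x"
        using infinite_Int_atLeast[OF that] by (metis Int_iff atLeast_iff ex_in_conv infinite_imp_nonempty)
      from LeastI_ex[OF this] show "nx X \<in> X" "K X \<le> nx X" by (simp_all add: nx_def)
      show "\<And>y. y \<in> X \<Longrightarrow> K X \<le> y \<Longrightarrow> nx X \<le> y" by (simp add: nx_def Least_le)
    qed
    \<comment> \<open>Reading one further element of X, the first one from the modulus
      \<open>K X\<close> on, makes the drop from \<open>G\<close> to \<open>g\<close> a
      refinement.\<close>
    define k where "k X = max (l X) (Suc (nx X))" for X
    have ag': "array C g k"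
      unfolding array_def
    proof (intro conjI allI impI C_inf)
      fix X Y assume X: "X \<subseteq> C" "infinite X" and Y: "Y \<subseteq> C" "infinite Y"
        and XY: "Y \<inter> {..<k X} = X \<inter> {..<k X}"
      have agree: "y \<in> Y \<longleftrightarrow> y \<in> X" if "y < k X" for y using XY that by blast
      have k: "l X \<le> k X" "nx X < k X" "K X < k X" using nx(2)[OF X(2)] by (simp_all add: k_def)
      have "Y \<inter> {..<l X} = X \<inter> {..<l X}" "Y \<inter> {..<K X} = X \<inter> {..<K X}"
        using Int_lessThan_mono[OF XY] k by simp_all
      then have gl: "l Y = l X" "g Y = g X" and K: "K Y = K X"
        using array_cong[OF ag X Y] array_cong(1)[OF arrW _ X(2) _ Y(2)] X(1) Y(1) C by auto
      have "nx Y = nx X"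
        using nx[OF X(2)] nx[OF Y(2)] agree k K by (metis le_antisym le_less_trans)
      then show "k Y = k X" "g Y = g X" using gl by (simp_all add: k_def)
    qed
    define N where "N = (LEAST n. \<exists>X\<subseteq>C. infinite X \<and> K X = n)"
    have "\<exists>n. \<exists>X\<subseteq>C. infinite X \<and> K X = n" using C_inf by blast
    from LeastI_ex[OF this] obtain X0 where X0: "X0 \<subseteq> C" "infinite X0" "K X0 = N"
      unfolding N_def by blast
    have N_le: "N \<le> K X" if "X \<subseteq> C" "infinite X" for X
      unfolding N_def using that by (intro Least_le) blast
    \<comment> \<open>\<open>W\<close> has no elements from \<open>t n\<close> up to just before
      \<open>a n\<close>. As the least modulus \<open>N\<close> lies in this gap, the elements of
      \<open>W\<close> below \<open>N\<close> are exactly those below \<open>t n\<close>.\<close>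
    obtain n where n: "t n \<le> N" "N \<le> a n"
    proof -
      have "N < t (Suc N)" using \<open>strict_mono a\<close> a(3) by (simp add: less_Suc_eq_le strict_mono_imp_increasing)
      then have ex: "\<exists>n. N < t n" by blast
      define j where "j = (LEAST n. N < t n)"
      have j: "N < t j" using LeastI_ex[OF ex] by (simp add: j_def)
      then obtain i where i: "j = Suc i" using t0 by (cases j) auto
      have "\<not> N < t i" using not_less_Least[of i "\<lambda>n. N < t n"] i by (simp add: j_def)
      then show thesis using that[of i] j a(3)[of i] i by simp
    qed
    have gap: "x < t n" if "x \<in> W" "x < N" for x
    proof (rule ccontr)
      assume "\<not> x < t n"
      then have "x \<in> As (Suc n) \<inter> {t n..<a n}" using that W_sub[of "Suc n"] n(2) by auto
      then show False using a(4) by simp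
    qed
    define E where "E = (W \<inter> {..<t n}) \<union> (C \<inter> {t n..})"
    have E: "E \<subseteq> W" "infinite E" using C infinite_Int_atLeast[OF C_inf] by (auto simp: E_def)
    \<comment> \<open>The part of X read by \<open>K\<close> determines \<open>K X\<close> and can
      be continued inside \<open>C\<close>, so \<open>K X\<close> is at least \<open>N\<close>.
      Hence the part of X below \<open>t n\<close> lies in \<open>C\<close>, and so does the rest by
      the choice of \<open>E\<close>.\<close>
    have inC: "X \<subseteq> C" if X: "X \<subseteq> E" "infinite X" "X \<inter> {..<K X} \<subseteq> C" for X
    proof -
      define Z where "Z = (X \<inter> {..<K X}) \<union> (C \<inter> {K X..})"
      have Z: "Z \<subseteq> C" "infinite Z" using X(3) infinite_Int_atLeast[OF C_inf] by (auto simp: Z_def)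
      have "Z \<inter> {..<K X} = X \<inter> {..<K X}" by (auto simp: Z_def)
      then have "K Z = K X" using array_cong(1)[OF arrW, of X Z] X E Z C by auto
      then have "t n \<le> K X" using N_le[OF Z] n by simp
      then show ?thesis using X by (force simp: E_def)
    qed
    define h where "h X = (if X \<subseteq> C then g X else G X)" for X
    define d where "d X = (if X \<subseteq> C then k X else K X)" for X
    have "array E h d"
      unfolding array_def
    proof (intro conjI allI impI E)
      fix X Y assume X: "X \<subseteq> E" "infinite X" and Y: "Y \<subseteq> E" "infinite Y"
        and XY: "Y \<inter> {..<d X} = X \<inter> {..<d X}"
      have XW: "X \<subseteq> W" and YW: "Y \<subseteq> W" using X Y E by auto
      have Kd: "K X \<le> d X" using nx(2)[OF X(2)] by (auto simp: d_def k_def)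
      have XYK: "Y \<inter> {..<K X} = X \<inter> {..<K X}" by (rule Int_lessThan_mono[OF XY Kd])
      then have K: "K Y = K X" "G Y = G X" using array_cong[OF arrW XW X(2) YW Y(2)] by auto
      have "Y \<subseteq> C \<longleftrightarrow> X \<subseteq> C"
        using inC[OF X] inC[OF Y] K XYK by (metis inf.coboundedI1)
      then show "d Y = d X" "h Y = h X"
        using K XY array_cong[OF ag' _ X(2) _ Y(2)] by (auto simp: d_def h_def)
    qed
    moreover have "bad le E h"
      unfolding h_def using badW bg E(1) by (rule bad_override) (use drop sub_le le_trans in blast)+
    moreover have refE: "refines sub E h d W G K"
      unfolding refines_def
    proof (intro conjI allI impI E)
      fix X assume X: "X \<subseteq> E" "infinite X"
      have "nx X \<in> X \<and> K X \<le> nx X \<and> nx X < k X" using nx[OF X(2)] by (simp add: k_def)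
      then show "h X = G X \<and> d X = K X \<or> (h X, G X) \<in> sub \<and> (\<exists>x\<in>X. K X \<le> x \<and> x < d X)"
        using drop[OF _ X(2)] by (auto simp: h_def d_def)
    qed
    moreover have "E \<inter> {..<t n} = W \<inter> {..<t n}" by (auto simp: E_def)
    then have "E \<inter> {..<t n} = As n \<inter> {..<t n}" using W_fix[of n] by simp
    ultimately have "cand E h d (As n) (F n) (M n) (t n)"
      using refines_trans[OF tr refE refW[of n]] by (simp add: cand_def)
    from mn[OF this] have "card (traces W K (t n)) \<le> card (traces E d (t n))"
      using card_mono[OF finite_traces refines_traces[OF refW[of "Suc n"]]] by (rule order_trans[rotated])
    \<comment> \<open>The segment of \<open>X0\<close> is decided for \<open>W\<close>, where its
      modulus is only \<open>N\<close>. It is undecided for \<open>E\<close>: there the modulus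
      reads a further element, which is at least \<open>N\<close> and so at least
      \<open>t n\<close>.\<close>
    moreover have "traces E d (t n) \<subset> traces W K (t n)"
    proof
      show "traces E d (t n) \<subseteq> traces W K (t n)" using refines_traces[OF refE] .
      have "X0 \<inter> {..<t n} \<in> traces W K (t n)"
        unfolding traces_def using X0 C gap by auto
      moreover have "X0 \<inter> {..<t n} \<notin> traces E d (t n)"
      proof
        assume "X0 \<inter> {..<t n} \<in> traces E d (t n)"
        then obtain X where X: "X0 \<inter> {..<t n} = X \<inter> {..<t n}" "X \<subseteq> E" "infinite X"
          "X \<inter> {..<d X} \<subseteq> {..<t n}" unfolding traces_def by blast
        have "x \<in> X \<longleftrightarrow> x \<in> X0" if "x < N" for x
          using X(1,2) X0(1) gap[OF _ that] C E(1) by blast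
        then have XX0: "X \<inter> {..<N} = X0 \<inter> {..<N}" by blast
        then have K: "K X = N" using array_cong(1)[OF arrW, of X0 X] X0 X C E by auto
        have "X \<subseteq> C" using inC[OF X(2,3)] K XX0 X0(1) by blast
        then have "nx X < t n" using X(4) nx(1)[OF X(3)] by (auto simp: d_def k_def)
        then show False using nx(2)[OF X(3)] K n(1) by simp
      qed
      ultimately show "traces E d (t n) \<noteq> traces W K (t n)" by blast
    qed
    ultimately show False using psubset_card_mono[OF finite_traces] by (metis not_le)
  qed
  have W0: "W \<subseteq> A" using W_sub[of 0] h[of 0] h0 by simp
  have "G X = f X \<or> (G X, f X) \<in> sub" if "X \<subseteq> W" "infinite X" for X
    using refinesD[OF refW[of 0] that] h[of 0] h0 by auto
  then show ?thesis
    using W0 arrW badW minimal by blast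
qed

section \<open>Hereditarily indecomposable sums\<close>

definition embeds :: "'a::linorder set \<Rightarrow> 'b::linorder set \<Rightarrow> bool" where
  "embeds A B \<longleftrightarrow> (\<exists>f. strict_mono_on A f \<and> f ` A \<subseteq> B)"

definition before :: "bool \<Rightarrow> 'a::linorder set \<Rightarrow> 'a set \<Rightarrow> bool" where
  "before d A B \<longleftrightarrow> (\<forall>x\<in>A. \<forall>y\<in>B. if d then x < y else y < x)"

lemma embeds_subset: "A \<subseteq> B \<Longrightarrow> embeds A B"
  unfolding embeds_def by (intro exI[of _ id]) (auto simp: strict_mono_on_def)

lemma embeds_trans [trans]:
  assumes "embeds A B" "embeds B C"
  shows "embeds A C"
proof -
  obtain f g where "strict_mono_on A f" "f ` A \<subseteq> B" "strict_mono_on B g" "g ` B \<subseteq> C"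
    using assms unfolding embeds_def by blast
  then show ?thesis
    unfolding embeds_def by (intro exI[of _ "g \<circ> f"]) (auto simp: strict_mono_on_def image_subset_iff)
qed

lemma embeds_mono: "embeds A B \<Longrightarrow> A' \<subseteq> A \<Longrightarrow> B \<subseteq> B' \<Longrightarrow> embeds A' B'"
  by (meson embeds_subset embeds_trans)

lemma before_mono: "before d A B \<Longrightarrow> A' \<subseteq> A \<Longrightarrow> B' \<subseteq> B \<Longrightarrow> before d A' B'"
  unfolding before_def by blast

lemma before_disjoint: "before d A B \<Longrightarrow> A \<inter> B = {}"
  unfolding before_def by (auto split: if_splits)

text \<open>The conclusion keeps the information which block goes where; the binary family of
  embeddings is later told apart by it.\<close>

lemma embeds_Union:
  fixes X :: "'i::linorder \<Rightarrow> 'a::linorder set" and Y :: "'i \<Rightarrow> 'b::linorder set"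
  assumes emb: "\<And>i. i \<in> I \<Longrightarrow> embeds (X i) (Y i)"
    and X: "\<And>i j. i \<in> I \<Longrightarrow> j \<in> I \<Longrightarrow> i < j \<Longrightarrow> before d (X i) (X j)"
    and Y: "\<And>i j. i \<in> I \<Longrightarrow> j \<in> I \<Longrightarrow> i < j \<Longrightarrow> before d (Y i) (Y j)"
  shows "\<exists>f. strict_mono_on (\<Union>i\<in>I. X i) f \<and> (\<forall>i\<in>I. f ` X i \<subseteq> Y i)"
proof -
  obtain f where f: "\<And>i. i \<in> I \<Longrightarrow> strict_mono_on (X i) (f i)" "\<And>i. i \<in> I \<Longrightarrow> f i ` X i \<subseteq> Y i"
    using emb unfolding embeds_def by metis
  define ix where "ix x = (SOME i. i \<in> I \<and> x \<in> X i)" for x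
  have ix: "ix x = i" if "i \<in> I" "x \<in> X i" for x i
  proof -
    have "ix x \<in> I \<and> x \<in> X (ix x)" unfolding ix_def by (rule someI) (use that in simp)
    then show ?thesis using X[of i "ix x"] X[of "ix x" i] that before_disjoint
      by (metis IntI empty_iff linorder_neqE)
  qed
  define g where "g x = f (ix x) x" for x
  have g: "g x \<in> Y i" if "i \<in> I" "x \<in> X i" for x i
    using f(2) ix that by (auto simp: g_def)
  have "g x < g y" if i: "i \<in> I" "x \<in> X i" and j: "j \<in> I" "y \<in> X j" and "x < y" for x y i j
  proof -
    consider "i = j" | "i < j" | "j < i" by fastforce
    then show ?thesis
    proof cases
      case 1
      then show ?thesis using f(1)[of i] ix i j \<open>x < y\<close> by (auto simp: g_def strict_mono_on_def)
    next
      case 2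
      then have "d" using X[of i j] i j \<open>x < y\<close> unfolding before_def by (metis order.asym)
      then show ?thesis using Y[of i j] 2 i j g unfolding before_def by metis
    next
      case 3
      then have "\<not> d" using X[of j i] i j \<open>x < y\<close> unfolding before_def by (metis order.asym)
      then show ?thesis using Y[of j i] 3 i j g unfolding before_def by metis
    qed
  qed
  then show ?thesis using g by (intro exI[of _ g]) (auto simp: strict_mono_on_def)
qed

lemma embeds_UnionI:
  fixes X :: "'i::linorder \<Rightarrow> 'a::linorder set" and Y :: "'i \<Rightarrow> 'b::linorder set"
  assumes "\<And>i. i \<in> I \<Longrightarrow> embeds (X i) (Y i)"
    and "\<And>i j. i \<in> I \<Longrightarrow> j \<in> I \<Longrightarrow> i < j \<Longrightarrow> before d (X i) (X j)"
    and "\<And>i j. i \<in> I \<Longrightarrow> j \<in> I \<Longrightarrow> i < j \<Longrightarrow> before d (Y i) (Y j)"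
  shows "embeds (\<Union>i\<in>I. X i) (\<Union>i\<in>I. Y i)"
  using embeds_Union[of I X Y d, OF assms] unfolding embeds_def by blast

lemma strict_mono_selection:
  fixes S :: "nat \<Rightarrow> nat set"
  assumes "\<And>k. infinite (S k)"
  obtains m where "strict_mono m" "\<And>k. m k \<in> S k"
proof -
  have "\<exists>m. \<forall>k. m k \<in> S k \<and> m k < m (Suc k)"
  proof (rule dependent_nat_choice)
    show "\<exists>x. x \<in> S 0" using assms by (metis ex_in_conv infinite_imp_nonempty)
    show "\<exists>y. y \<in> S (Suc n) \<and> x < y" for x n
      using assms[of "Suc n"] by (auto simp: infinite_nat_iff_unbounded)
  qed
  then show thesis using that by (auto simp: strict_mono_Suc_iff)
qed

text \<open>Since every summand has infinitely many possible targets, the targets can be chosen with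
  strictly increasing indices.\<close>

lemma embeds_sum:
  assumes X: "\<And>i j. i < j \<Longrightarrow> before d (X i) (X j)"
    and Y: "\<And>i j. i < j \<Longrightarrow> before d (Y i) (Y j)"
    and emb: "\<And>i :: nat. infinite {j :: nat. embeds (X i) (Y j)}"
  shows "embeds (\<Union>i. X i) (\<Union>j. Y j)"
proof -
  obtain m where m: "strict_mono m" "\<And>i. m i \<in> {j. embeds (X i) (Y j)}"
    using strict_mono_selection[of "\<lambda>i. {j. embeds (X i) (Y j)}"] emb by blast
  have "embeds (\<Union>i. X i) (\<Union>i. Y (m i))"
    using m X Y by (intro embeds_UnionI) (auto simp: strict_mono_less)
  then show ?thesis by (rule embeds_mono) auto
qed

text \<open>
  The flag of a sum is the direction of its summands: \<open>True\<close> for a sum over \<open>\<omega>\<close>, \<open>False\<close> for a sum over the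
  reverse of \<open>\<omega>\<close>.
\<close>

datatype 'a decomp = Point 'a | Sum bool "nat \<Rightarrow> 'a decomp"

primrec supp :: "'a decomp \<Rightarrow> 'a set" where
  "supp (Point x) = {x}"
| "supp (Sum d c) = (\<Union>i. supp (c i))"

text \<open>A tree presents a hereditarily indecomposable order. Trees rather than sets are used
  because passing to a summand is then well-founded, as minimal bad arrays require. Recurrence of
  every summand is what makes the sum indecomposable.\<close>

primrec indec :: "'a::linorder decomp \<Rightarrow> bool" where
  "indec (Point x) \<longleftrightarrow> True"
| "indec (Sum d c) \<longleftrightarrow> (\<forall>i. indec (c i)) \<and> (\<forall>i j. i < j \<longrightarrow> before d (supp (c i)) (supp (c j))) \<and>
    (\<forall>i. infinite {j. embeds (supp (c i)) (supp (c j))})"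

lemma supp_nonempty: "supp t \<noteq> {}"
  by (induction t) auto

lemma embeds_point: "B \<noteq> {} \<Longrightarrow> embeds {x} B"
  unfolding embeds_def by (auto simp: strict_mono_on_def)

section \<open>Well-quasi-ordering of indecomposable sums\<close>

lemma wf_component: "wf {(c i, Sum d c) | (c :: nat \<Rightarrow> 'a decomp) i d. True}"
proof (rule wfUNIVI)
  fix P and t :: "'a decomp"
  assume *: "\<forall>x. (\<forall>y. (y, x) \<in> {(c i, Sum d c) | (c :: nat \<Rightarrow> 'a decomp) i d. True} \<longrightarrow> P y) \<longrightarrow> P x"
  show "P t"
  proof (induction t)
    case (Point x)
    show ?case using * by blast
  next
    case (Sum d c)
    then show ?case using *[rule_format, of "Sum d c"] by auto
  qed
qed

lemma indec_wqo:
  fixes t :: "nat \<Rightarrow> 'a::linorder decomp"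
  assumes t: "\<And>i. indec (t i)"
  shows "\<exists>i j. i < j \<and> embeds (supp (t i)) (supp (t j))"
proof (rule ccontr)
  assume no: "\<not> ?thesis"
  define le :: "'a decomp \<Rightarrow> 'a decomp \<Rightarrow> bool" where "le s t = embeds (supp s) (supp t)" for s t
  define sub where "sub = {(c i, Sum d c) | (c :: nat \<Rightarrow> 'a decomp) i d. True}\<^sup>+"
  have sub_le: "le x y" if "(x, y) \<in> sub" for x y
    using that unfolding sub_def
  proof (induction rule: trancl_induct)
    case (base y)
    then show ?case by (auto simp: le_def intro!: embeds_subset)
  next
    case (step y z)
    then have "le y z" by (auto simp: le_def intro!: embeds_subset)
    then show ?case using step.IH embeds_trans unfolding le_def by blast
  qed
  have sub_indec: "indec y \<longrightarrow> indec x" if "(x, y) \<in> sub" for x y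
    using that unfolding sub_def by (induction rule: trancl_induct) auto
  define least where "least X = (LEAST x. x \<in> X)" for X :: "nat set"
  have least: "least X \<in> X" "x \<in> X \<Longrightarrow> least X \<le> x" if "infinite X" for X x
    unfolding least_def using that
    by (auto intro: LeastI_ex Least_le simp: ex_in_conv dest: infinite_imp_nonempty)
  have least_cong: "least Y = least X"
    if "infinite X" "infinite Y" "Y \<inter> {..<Suc (least X)} = X \<inter> {..<Suc (least X)}" for X Y
  proof -
    have "y \<in> Y \<longleftrightarrow> y \<in> X" if "y \<le> least X" for y
      using that \<open>Y \<inter> _ = X \<inter> _\<close> by (metis IntD1 IntI le_imp_less_Suc lessThan_iff)
    then show ?thesis using least that by (metis le_antisym nat_le_linear)
  qed
  \<comment> \<open>A bad sequence is a bad array that reads only the least element of its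
    argument.\<close>
  have arr: "array UNIV (\<lambda>X. t (least X)) (\<lambda>X. Suc (least X))"
    unfolding array_def by (metis infinite_UNIV_nat least_cong)
  have bad: "bad le UNIV (\<lambda>X. t (least X))"
    unfolding bad_def
  proof (intro allI impI)
    fix X :: "nat set" assume X: "infinite X"
    have "least (rest X) \<in> rest X" by (rule least(1)) (rule infinite_rest[OF X])
    then have "least X < least (rest X)"
      using least(2)[OF X] unfolding rest_def least_def[symmetric] by (simp add: order_le_neq_trans)
    then show "\<not> le (t (least X)) (t (least (rest X)))" using no by (auto simp: le_def)
  qed
  have wf: "wf sub" and tr: "trans sub"
    unfolding sub_def by (rule wf_trancl[OF wf_component], rule trans_trancl)
  have le_trans: "le x z" if "le x y" "le y z" for x y z
    using that embeds_trans unfolding le_def by blast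
  have "\<exists>B\<subseteq>UNIV. \<exists>g k. array B g k \<and> bad le B g \<and>
      (\<forall>X\<subseteq>B. infinite X \<longrightarrow> g X = t (least X) \<or> (g X, t (least X)) \<in> sub) \<and>
      (\<forall>C h l. C \<subseteq> B \<longrightarrow> array C h l \<longrightarrow> bad le C h \<longrightarrow> (\<exists>X\<subseteq>C. infinite X \<and> (h X, g X) \<notin> sub))"
    using wf tr sub_le le_trans arr bad by (rule minimal_bad_array)
  then obtain B g k where *: "array B g k \<and> bad le B g \<and>
      (\<forall>X\<subseteq>B. infinite X \<longrightarrow> g X = t (least X) \<or> (g X, t (least X)) \<in> sub) \<and>
      (\<forall>C h l. C \<subseteq> B \<longrightarrow> array C h l \<longrightarrow> bad le C h \<longrightarrow> (\<exists>X\<subseteq>C. infinite X \<and> (h X, g X) \<notin> sub))"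
    by (elim exE conjE) (rule that; simp)
  have B: "array B g k" "bad le B g" using * by simp_all
  have g: "g X = t (least X) \<or> (g X, t (least X)) \<in> sub" if "X \<subseteq> B" "infinite X" for X
    using * that by simp
  have min: "\<exists>X\<subseteq>C. infinite X \<and> (h X, g X) \<notin> sub" if "C \<subseteq> B" "array C h l" "bad le C h" for C h l
    using *[THEN conjunct2, THEN conjunct2, THEN conjunct2] that by blast
  have g_indec: "indec (g X)" if "X \<subseteq> B" "infinite X" for X
    using g[OF that] sub_indec t by metis
  have "\<exists>C\<subseteq>B. infinite C \<and> ((\<forall>X\<subseteq>C. infinite X \<longrightarrow> (\<exists>c. g X = Sum True c)) \<or>
    (\<forall>X\<subseteq>C. infinite X \<longrightarrow> \<not> (\<exists>c. g X = Sum True c)))"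
  proof (rule clopen_Ramsey)
    show "infinite B" using B by (simp add: array_def)
    fix X assume X: "infinite X" "X \<subseteq> B"
    have "g Y = g X" if "Y \<subseteq> B" "infinite Y" "Y \<inter> {..<k X} = X \<inter> {..<k X}" for Y
      by (rule array_cong(2)[OF B(1) X(2,1) that])
    then show "\<exists>k. \<forall>Y\<subseteq>B. infinite Y \<longrightarrow> Y \<inter> {..<k} = X \<inter> {..<k} \<longrightarrow>
        (\<exists>c. g Y = Sum True c) = (\<exists>c. g X = Sum True c)"
      by (intro exI[of _ "k X"]) simp
  qed
  then obtain C where C: "C \<subseteq> B" "infinite C" and hom:
    "(\<forall>X\<subseteq>C. infinite X \<longrightarrow> (\<exists>c. g X = Sum True c)) \<or> (\<forall>X\<subseteq>C. infinite X \<longrightarrow> \<not> (\<exists>c. g X = Sum True c))"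
    by blast
  have no_point: "g X \<noteq> Point x" if "X \<subseteq> B" "infinite X" for X x
  proof
    assume "g X = Point x"
    then have "le (g X) (g (rest X))" by (simp add: le_def embeds_point supp_nonempty)
    then show False using B(2) that by (simp add: bad_def)
  qed
  obtain d where d: "\<And>X. X \<subseteq> C \<Longrightarrow> infinite X \<Longrightarrow> \<exists>c. g X = Sum d c"
  proof (cases "\<forall>X\<subseteq>C. infinite X \<longrightarrow> (\<exists>c. g X = Sum True c)")
    case True
    then show thesis using that by blast
  next
    case False
    then have "\<forall>X\<subseteq>C. infinite X \<longrightarrow> \<not> (\<exists>c. g X = Sum True c)" using hom by argo
    then have nT: "g X \<noteq> Sum True c" if "X \<subseteq> C" "infinite X" for X c using that by simp
    have "\<exists>c. g X = Sum False c" if X: "X \<subseteq> C" "infinite X" for X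
    proof (cases "g X")
      case (Point x)
      then show ?thesis using no_point[OF order_trans[OF X(1) C(1)] X(2)] by simp
    next
      case (Sum d c)
      then show ?thesis using nT[OF X, of c] by (cases d) simp_all
    qed
    then show thesis by (rule that)
  qed
  \<comment> \<open>The choice depends on the two trees only, not on the set X from which they come;
    this keeps \<open>h\<close> locally constant.\<close>
  define pick where "pick s u = (SOME v. \<exists>c c' i. s = Sum d c \<and> u = Sum d c' \<and> v = c i \<and> (\<forall>j. \<not> le v (c' j)))"
    for s u
  have pick: "\<exists>c c' i. s = Sum d c \<and> u = Sum d c' \<and> pick s u = c i \<and> (\<forall>j. \<not> le (pick s u) (c' j))"
    if su: "indec s" "indec u" "s = Sum d c" "u = Sum d c'" "\<not> le s u" for s u c c'
  proof -
    have "\<exists>i. \<forall>j. \<not> le (c i) (c' j)"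
    proof (rule ccontr)
      assume "\<not> ?thesis"
      then have ex: "\<exists>j. embeds (supp (c i)) (supp (c' j))" for i by (auto simp: le_def)
      have "infinite {j. embeds (supp (c i)) (supp (c' j))}" for i
      proof -
        obtain j where j: "embeds (supp (c i)) (supp (c' j))" using ex by blast
        have "infinite {l. embeds (supp (c' j)) (supp (c' l))}" using su by simp
        moreover have "{l. embeds (supp (c' j)) (supp (c' l))} \<subseteq> {l. embeds (supp (c i)) (supp (c' l))}"
          using embeds_trans[OF j] by blast
        ultimately show ?thesis by (rule infinite_super[rotated])
      qed
      then have "embeds (\<Union>i. supp (c i)) (\<Union>i. supp (c' i))"
        using su by (intro embeds_sum[where d = d]) simp_all
      then show False using su by (simp add: le_def)
    qed
    then obtain i where i: "\<forall>j. \<not> le (c i) (c' j)" by blast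
    have "\<exists>v c c' i. s = Sum d c \<and> u = Sum d c' \<and> v = c i \<and> (\<forall>j. \<not> le v (c' j))"
      by (rule exI[of _ "c i"], rule exI[of _ c], rule exI[of _ c'], rule exI[of _ i]) (use su i in simp)
    from someI_ex[OF this] show ?thesis unfolding pick_def .
  qed
  define h where "h X = pick (g X) (g (rest X))" for X
  have h: "\<exists>c c' i. g X = Sum d c \<and> g (rest X) = Sum d c' \<and> h X = c i \<and> (\<forall>j. \<not> le (h X) (c' j))"
    if X: "X \<subseteq> C" "infinite X" for X
  proof -
    have r: "rest X \<subseteq> C" "infinite (rest X)" using X rest_subset[of X] infinite_rest by auto
    obtain c c' where "g X = Sum d c" "g (rest X) = Sum d c'" using d[OF X] d[OF r] by blast
    moreover have "\<not> le (g X) (g (rest X))" using B(2) X C(1) by (simp add: bad_def)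
    moreover have "indec (g X)" "indec (g (rest X))"
      using g_indec[OF order_trans[OF X(1) C(1)] X(2)] g_indec[OF order_trans[OF r(1) C(1)] r(2)] by auto
    ultimately show ?thesis using pick unfolding h_def by blast
  qed
  \<comment> \<open>The modulus must fix the values of \<open>g\<close> at X and at
    \<open>rest X\<close>; it also reads the least element, which determines what
    \<open>rest X\<close> drops.\<close>
  define l where "l X = max (Suc (least X)) (max (k X) (k (rest X)))" for X
  have "array C h l"
    unfolding array_def
  proof (intro conjI allI impI C)
    fix X Y assume X: "X \<subseteq> C" "infinite X" and Y: "Y \<subseteq> C" "infinite Y"
      and XY: "Y \<inter> {..<l X} = X \<inter> {..<l X}"
    have ls: "least Y = least X"
      by (rule least_cong[OF X(2) Y(2)], rule Int_lessThan_mono[OF XY]) (simp add: l_def)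
    have "rest Y \<inter> {..<l X} = rest X \<inter> {..<l X}"
      using XY ls unfolding rest_def least_def[symmetric] by (simp add: Diff_Int_distrib2)
    then have XYr: "rest Y \<inter> {..<k (rest X)} = rest X \<inter> {..<k (rest X)}"
      by (rule Int_lessThan_mono) (simp add: l_def)
    have XYk: "Y \<inter> {..<k X} = X \<inter> {..<k X}"
      using XY by (rule Int_lessThan_mono) (simp add: l_def)
    have sub: "X \<subseteq> B" "Y \<subseteq> B" "rest X \<subseteq> B" "rest Y \<subseteq> B"
      using X Y C(1) rest_subset by blast+
    have "k Y = k X" "g Y = g X" "k (rest Y) = k (rest X)" "g (rest Y) = g (rest X)"
      using array_cong[OF B(1) sub(1) X(2) sub(2) Y(2) XYk]
        array_cong[OF B(1) sub(3) infinite_rest[OF X(2)] sub(4) infinite_rest[OF Y(2)] XYr] by simp_all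
    then show "l Y = l X" "h Y = h X" using ls by (simp_all add: l_def h_def)
  qed
  \<comment> \<open>\<open>h X\<close> embeds in no summand of \<open>g (rest X)\<close>, and
    \<open>h (rest X)\<close> is one of these summands.\<close>
  moreover have "bad le C h"
    unfolding bad_def
  proof (intro allI impI)
    fix X assume X: "X \<subseteq> C" "infinite X"
    have r: "rest X \<subseteq> C" "infinite (rest X)" using X rest_subset infinite_rest by blast+
    show "\<not> le (h X) (h (rest X))" using h[OF X] h[OF r] by auto
  qed
  moreover have "(h X, g X) \<in> sub" if X: "X \<subseteq> C" "infinite X" for X
  proof -
    obtain c i where "g X = Sum d c" "h X = c i" using h[OF X] by blast
    then show ?thesis unfolding sub_def by (intro r_into_trancl) auto
  qed
  ultimately show False using min[OF C(1)] by blast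
qed

text \<open>Infinitely many non-recurrent terms could be thinned out to a subsequence in which no
  term embeds in a later one, against \<open>indec_wqo\<close>.\<close>

lemma indec_recurrent:
  fixes t :: "nat \<Rightarrow> 'a::linorder decomp"
  assumes t: "\<And>i. indec (t i)"
  shows "\<exists>N. \<forall>i\<ge>N. infinite {j. embeds (supp (t i)) (supp (t j))}"
proof (rule ccontr)
  define bd where "bd = {i. finite {j. embeds (supp (t i)) (supp (t j))}}"
  assume "\<not> ?thesis"
  then have "\<exists>i\<ge>N. i \<in> bd" for N by (auto simp: bd_def)
  then have inf: "infinite bd" by (simp add: infinite_nat_iff_unbounded_le)
  have "\<exists>m. \<forall>k :: nat. m k \<in> bd \<and> (m k < m (Suc k) \<and> (\<forall>j\<ge>m (Suc k). \<not> embeds (supp (t (m k))) (supp (t j))))"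
  proof (rule dependent_nat_choice)
    show "\<exists>x. x \<in> bd" using inf by (metis ex_in_conv infinite_imp_nonempty)
    fix x and n :: nat assume "x \<in> bd"
    then have "finite (insert x {j. embeds (supp (t x)) (supp (t j))})" by (simp add: bd_def)
    then obtain b where b: "\<forall>j\<in>insert x {j. embeds (supp (t x)) (supp (t j))}. j < b"
      using finite_nat_set_iff_bounded by blast
    obtain y where "y \<in> bd" "b \<le> y" using inf by (auto simp: infinite_nat_iff_unbounded_le)
    moreover have "\<not> embeds (supp (t x)) (supp (t j))" if "y \<le> j" for j
    proof
      assume "embeds (supp (t x)) (supp (t j))"
      then have "j < b" using b by simp
      then show False using that \<open>b \<le> y\<close> by simp
    qed
    moreover have "x < y" using b \<open>b \<le> y\<close> by auto
    ultimately show "\<exists>y. y \<in> bd \<and> (x < y \<and> (\<forall>j\<ge>y. \<not> embeds (supp (t x)) (supp (t j))))" by blast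
  qed
  then obtain m where m: "\<And>k. m k < m (Suc k)"
    "\<And>k j. m (Suc k) \<le> j \<Longrightarrow> \<not> embeds (supp (t (m k))) (supp (t j))" by blast
  have "strict_mono m" using m(1) by (simp add: strict_mono_Suc_iff)
  then have "\<not> embeds (supp (t (m i))) (supp (t (m j)))" if "i < j" for i j
    using m(2)[of i "m j"] that by (simp add: strict_mono_less_eq Suc_le_eq)
  then show False using indec_wqo[of "\<lambda>i. t (m i)"] t by blast
qed

section \<open>Decomposition of scattered orders\<close>

text \<open>
  The elements of \<open>A\<close> are inserted in the order of an enumeration as in a binary search tree; \<open>iv n x\<close> is
  the interval to which the search for \<open>x\<close> has been narrowed down after \<open>n\<close> insertions.
\<close>

lemma countable_linear_order_embeds_dense:
  fixes A :: "'a set" and r :: "'a rel" and D :: "'b::linorder \<Rightarrow> 'b \<Rightarrow> bool"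
  assumes r: "linear_order_on A r" and A: "countable A"
    and less: "\<And>a b. D a b \<Longrightarrow> a < b"
    and dense: "\<And>a b. D a b \<Longrightarrow> \<exists>c. D a c \<and> D c b"
    and D0: "D a0 b0"
  shows "\<exists>f. (\<forall>x\<in>A. \<forall>y\<in>A. (x, y) \<in> r \<longleftrightarrow> f x \<le> f y) \<and> (\<forall>x\<in>A. \<exists>a. D a (f x))"
proof (cases "A = {}")
  case False
  define e where "e = from_nat_into A"
  have e: "range e = A" unfolding e_def by (rule range_from_nat_into[OF False A])
  obtain mid where mid: "\<And>a b. D a b \<Longrightarrow> D a (mid (a, b)) \<and> D (mid (a, b)) b"
    using dense by (metis case_prod_conv)
  define lt where "lt x y \<longleftrightarrow> (x, y) \<in> r \<and> x \<noteq> y" for x y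
  have lt_total: "lt x y \<or> x = y \<or> lt y x" if "x \<in> A" "y \<in> A" for x y
    using r that unfolding linear_order_on_def total_on_def lt_def by blast
  have lt_trans: "lt x y \<Longrightarrow> lt y z \<Longrightarrow> lt x z" for x y z
    using r unfolding linear_order_on_def partial_order_on_def preorder_on_def lt_def
    by (metis antisymD transD)
  have lt_irrefl: "\<not> lt x x" for x by (simp add: lt_def)
  have lt_asym: "lt x y \<Longrightarrow> \<not> lt y x" for x y using lt_trans lt_irrefl by blast
  define step where "step z p q = (if p \<noteq> q then p else if lt (fst z) (snd z) then (fst p, mid p)
    else if lt (snd z) (fst z) then (mid p, snd p) else p)" for z :: "'a \<times> 'a" and p q
  define iv where "iv = rec_nat (\<lambda>x. (a0, b0)) (\<lambda>n g x. step (x, e n) (g x) (g (e n)))"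
  have iv0: "iv 0 x = (a0, b0)" and ivS: "iv (Suc n) x = step (x, e n) (iv n x) (iv n (e n))" for n x
    by (simp_all add: iv_def)
  have D: "D (fst (iv n x)) (snd (iv n x))" for n x
  proof (induction n)
    case (Suc n)
    then show ?case using mid[of "fst (iv n x)" "snd (iv n x)"] by (auto simp: ivS step_def)
  qed (simp add: iv0 D0)
  have m: "fst (iv n x) < mid (iv n x)" "mid (iv n x) < snd (iv n x)" for n x
    using mid[OF D[of n x]] less by auto
  have "fst (iv n x) \<le> fst (iv (Suc n) x) \<and> snd (iv (Suc n) x) \<le> snd (iv n x)" for n x
    using m[of n x] by (auto simp: ivS step_def)
  then have nest: "fst (iv n x) \<le> fst (iv k x)" "snd (iv k x) \<le> snd (iv n x)" if "n \<le> k" for n k x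
    using lift_Suc_mono_le[of "\<lambda>n. fst (iv n x)", OF _ that]
      lift_Suc_antimono_le[of "\<lambda>n. snd (iv n x)", OF _ that] by auto
  define ix where "ix x = (LEAST n. e n = x)" for x
  have ix: "e (ix x) = x" if "x \<in> A" for x
    unfolding ix_def using that e by (metis (mono_tags) LeastI rangeE)
  \<comment> \<open>The invariant of the search: until one of x and y is inserted, their intervals
    are equal or lie apart in the right order.\<close>
  have sep: "n \<le> ix x \<Longrightarrow> n \<le> ix y \<Longrightarrow> iv n x = iv n y \<or> snd (iv n x) \<le> fst (iv n y)"
    if xy: "lt x y" "x \<in> A" "y \<in> A" for n x y
  proof (induction n)
    case (Suc n)
    have ne: "e n \<noteq> x" "e n \<noteq> y" using Suc.prems Least_le[of "\<lambda>n. e n = x" n] Least_le[of "\<lambda>n. e n = y" n]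
      by (auto simp: ix_def)
    show ?case
    proof (cases "iv n x = iv n y")
      case True
      have "e n \<in> A" using e by auto
      then consider "lt (e n) x" "lt (e n) y" | "lt y (e n)" "lt x (e n)" | "lt x (e n)" "lt (e n) y"
        using lt_total[of "e n" x] lt_total[of "e n" y] xy ne lt_trans by blast
      then show ?thesis
        by cases (use True lt_asym in \<open>auto simp: ivS step_def\<close>)
    next
      case False
      then have "snd (iv n x) \<le> fst (iv n y)" using Suc by simp
      then show ?thesis using nest[of n "Suc n"] by (meson le_SucI order.refl order_trans)
    qed
  qed (simp add: iv0)
  \<comment> \<open>An element is placed at the midpoint of its interval at the time of its first
    insertion. If x and y still share an interval when the first of them is inserted, that one
    splits it at its own value.\<close>
  define f where "f x = mid (iv (ix x) x)" for x
  have mono: "f x < f y" if xy: "lt x y" "x \<in> A" "y \<in> A" for x y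
  proof -
    let ?n = "min (ix x) (ix y)"
    consider "snd (iv ?n x) \<le> fst (iv ?n y)" | "iv ?n x = iv ?n y" using sep[OF xy, of ?n] by auto
    then show ?thesis
    proof cases
      case 1
      then show ?thesis unfolding f_def
        using m(2)[of "ix x" x] m(1)[of "ix y" y] nest(2)[of ?n "ix x" x] nest(1)[of ?n "ix y" y] by simp
    next
      case 2
      have "ix x \<noteq> ix y" using ix xy lt_irrefl by metis
      then consider "ix x < ix y" | "ix y < ix x" by linarith
      then show ?thesis
      proof cases
        case 1
        then have "fst (iv (Suc (ix x)) y) = f x"
          using 2 ix xy lt_asym by (auto simp: ivS step_def f_def)
        then show ?thesis
          using nest(1)[of "Suc (ix x)" "ix y" y] 1 m(1)[of "ix y" y] by (simp add: f_def)
      next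
        case 2
        then have "snd (iv (Suc (ix y)) x) = f y"
          using \<open>iv ?n x = iv ?n y\<close> ix xy lt_asym by (auto simp: ivS step_def f_def)
        then show ?thesis
          using nest(2)[of "Suc (ix y)" "ix x" x] 2 m(2)[of "ix x" x] by (simp add: f_def)
      qed
    qed
  qed
  have refl: "(x, x) \<in> r" if "x \<in> A" for x
    using r that by (auto simp: linear_order_on_def partial_order_on_def preorder_on_def refl_on_def)
  have "(x, y) \<in> r \<longleftrightarrow> f x \<le> f y" if "x \<in> A" "y \<in> A" for x y
    using lt_total[OF that] mono[of x y] mono[of y x] that refl lt_def lt_trans lt_irrefl
    by (metis leD less_imp_le order.refl)
  moreover have "D (fst (iv (ix x) x)) (f x)" for x
    unfolding f_def using mid[OF D[of "ix x" x]] by simp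
  ultimately show ?thesis by blast
qed auto

lemma infinite_Collect_shift:
  fixes P :: "nat \<Rightarrow> bool"
  assumes "infinite {j. P j}"
  shows "infinite {j. P (N + j)}"
proof
  assume "finite {j. P (N + j)}"
  then have "finite ((\<lambda>j. N + j) ` {j. P (N + j)} \<union> {..<N})" by simp
  moreover have "{j. P j} \<subseteq> (\<lambda>j. N + j) ` {j. P (N + j)} \<union> {..<N}"
  proof
    fix j assume "j \<in> {j. P j}"
    then show "j \<in> (\<lambda>j. N + j) ` {j. P (N + j)} \<union> {..<N}"
      by (cases "j < N") (auto intro!: image_eqI[of _ _ "j - N"])
  qed
  ultimately show False using assms finite_subset by blast
qed

section \<open>Finite sums of indecomposable orders\<close>

lemma before_flip: "before (\<not> d) A B \<longleftrightarrow> before d B A"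
  unfolding before_def by auto

lemma before_Union:
  "before d (\<Union>i\<in>I. A i) (\<Union>j\<in>J. B j) \<longleftrightarrow> (\<forall>i\<in>I. \<forall>j\<in>J. before d (A i) (B j))"
  unfolding before_def by blast

definition fin_sum :: "bool \<Rightarrow> nat \<Rightarrow> 'a::linorder set \<Rightarrow> bool" where
  "fin_sum d n A \<longleftrightarrow> (\<exists>t. (\<forall>i<n. indec (t i)) \<and>
    (\<forall>i j. i < j \<longrightarrow> j < n \<longrightarrow> before d (supp (t i)) (supp (t j))) \<and> A = (\<Union>i<n. supp (t i)))"

definition decomposable :: "'a::linorder set \<Rightarrow> bool" where
  "decomposable A \<longleftrightarrow> (\<exists>n. fin_sum True n A)"

lemma fin_sum_flip:
  assumes "fin_sum d n A"
  shows "fin_sum (\<not> d) n A"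
proof -
  obtain t where t: "\<forall>i<n. indec (t i)" "\<And>i j. i < j \<Longrightarrow> j < n \<Longrightarrow> before d (supp (t i)) (supp (t j))"
    "A = (\<Union>i<n. supp (t i))" using assms unfolding fin_sum_def by blast
  have "(\<Union>i<n. supp (t i)) = (\<Union>i<n. supp (t (n - Suc i)))"
  proof -
    have "(\<lambda>i. n - Suc i) ` {..<n} = {..<n}"
    proof
      show "{..<n} \<subseteq> (\<lambda>i. n - Suc i) ` {..<n}"
        by (rule subsetI, rule_tac x = "n - Suc x" in image_eqI) auto
    qed auto
    then show ?thesis by (metis image_image)
  qed
  then show ?thesis
    unfolding fin_sum_def using t
    by (intro exI[of _ "\<lambda>i. t (n - Suc i)"]) (auto simp: before_flip)
qed

lemma decomposable_iff: "decomposable A \<longleftrightarrow> (\<exists>n. fin_sum d n A)"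
  unfolding decomposable_def using fin_sum_flip[of d _ A] fin_sum_flip[of True _ A] by (cases d) auto

lemma fin_sum_append:
  assumes "fin_sum d n A" "fin_sum d k B" "before d A B"
  shows "fin_sum d (n + k) (A \<union> B)"
proof -
  obtain t where t: "\<And>i. i < n \<Longrightarrow> indec (t i)"
    "\<And>i j. i < j \<Longrightarrow> j < n \<Longrightarrow> before d (supp (t i)) (supp (t j))"
    "A = (\<Union>i<n. supp (t i))" using assms(1) unfolding fin_sum_def by blast
  obtain u where u: "\<And>i. i < k \<Longrightarrow> indec (u i)"
    "\<And>i j. i < j \<Longrightarrow> j < k \<Longrightarrow> before d (supp (u i)) (supp (u j))"
    "B = (\<Union>i<k. supp (u i))" using assms(2) unfolding fin_sum_def by blast
  define v where "v i = (if i < n then t i else u (i - n))" for i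
  have "{..<n + k} = {..<n} \<union> (\<lambda>i. i + n) ` {..<k}"
  proof
    show "{..<n + k} \<subseteq> {..<n} \<union> (\<lambda>i. i + n) ` {..<k}"
    proof
      fix i assume "i \<in> {..<n + k}"
      then show "i \<in> {..<n} \<union> (\<lambda>i. i + n) ` {..<k}"
        by (cases "i < n") (auto intro!: image_eqI[of _ _ "i - n"])
    qed
  qed auto
  then have "(\<Union>i<n + k. supp (v i)) = (\<Union>i<n. supp (v i)) \<union> (\<Union>i<k. supp (v (i + n)))"
    by simp
  then have "A \<union> B = (\<Union>i<n + k. supp (v i))" using t(3) u(3) by (simp add: v_def)
  moreover have "indec (v i)" if "i < n + k" for i using t(1) u(1) that by (simp add: v_def)
  moreover have "before d (supp (v i)) (supp (v j))" if "i < j" "j < n + k" for i j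
  proof -
    consider "j < n" | "i < n" "n \<le> j" | "n \<le> i" using that by linarith
    then show ?thesis
    proof cases
      case 1
      then show ?thesis using t(2) that by (simp add: v_def)
    next
      case 2
      then have "supp (v i) \<subseteq> A" "supp (v j) \<subseteq> B" using t(3) u(3) that by (auto simp: v_def)
      then show ?thesis using assms(3) before_mono by blast
    next
      case 3
      then show ?thesis using u(2)[of "i - n" "j - n"] that by (simp add: v_def)
    qed
  qed
  ultimately show ?thesis unfolding fin_sum_def by blast
qed

lemma decomposable_empty: "decomposable {}"
  unfolding decomposable_def fin_sum_def by (intro exI[of _ 0]) auto

lemma decomposable_supp: "indec t \<Longrightarrow> decomposable (supp t)"
  unfolding decomposable_def fin_sum_def by (intro exI[of _ 1] exI[of _ "\<lambda>_. t"]) auto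

lemma decomposable_Un: "decomposable A \<Longrightarrow> decomposable B \<Longrightarrow> before d A B \<Longrightarrow> decomposable (A \<union> B)"
  using fin_sum_append unfolding decomposable_iff[of _ d] by blast

lemma decomposable_finite_Union:
  fixes A :: "nat \<Rightarrow> 'a::linorder set"
  assumes "\<And>i. i < n \<Longrightarrow> decomposable (A i)" "\<And>i j. i < j \<Longrightarrow> j < n \<Longrightarrow> before d (A i) (A j)"
  shows "decomposable (\<Union>i<n. A i)"
  using assms
proof (induction n)
  case (Suc n)
  have "before d (\<Union>i<n. A i) (A n)" using Suc.prems(2)[of _ n] unfolding before_def by auto
  then have "decomposable ((\<Union>i<n. A i) \<union> A n)" using Suc by (intro decomposable_Un) auto
  then show ?case by (simp add: lessThan_Suc Un_commute)
qed (simp add: decomposable_empty)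

text \<open>The pairs (i, l) with l below \<open>n i\<close> are listed lexicographically:
  \<open>p\<close> gives the block, \<open>q\<close> the place in it, and \<open>K\<close> counts
  the pairs in earlier blocks. Infinitely many nonempty blocks make the list infinite.\<close>

lemma enumerate_blocks:
  fixes n :: "nat \<Rightarrow> nat"
  assumes inf: "infinite {i. 0 < n i}"
  shows "\<exists>p q :: nat \<Rightarrow> nat. (\<forall>j. q j < n (p j)) \<and>
    (\<forall>i j. i < j \<longrightarrow> p i < p j \<or> p i = p j \<and> q i < q j) \<and>
    (\<forall>i l. l < n i \<longrightarrow> (\<exists>j. p j = i \<and> q j = l))"
proof -
  define K where "K m = (\<Sum>i<m. n i)" for m
  have K_Suc: "K (Suc m) = K m + n m" for m by (simp add: K_def)
  have K_mono: "K i \<le> K j" if "i \<le> j" for i j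
    by (rule lift_Suc_mono_le[OF _ that]) (simp add: K_Suc)
  have ex: "\<exists>i. j < K (Suc i)" for j
  proof (induction j)
    case 0
    obtain i where "0 < n i" using inf by (metis (mono_tags) ex_in_conv infinite_imp_nonempty mem_Collect_eq)
    then show ?case by (auto simp: K_Suc)
  next
    case (Suc j)
    then obtain i where i: "j < K (Suc i)" by blast
    obtain l where l: "Suc i \<le> l" "0 < n l" using inf by (auto simp: infinite_nat_iff_unbounded_le)
    have "j < K l" using i K_mono[OF l(1)] by simp
    then have "Suc j < K (Suc l)" using l(2) by (simp add: K_Suc)
    then show ?case by blast
  qed
  define ix where "ix j = (LEAST i. j < K (Suc i))" for j
  have ix: "j < K (Suc (ix j))" for j unfolding ix_def by (rule LeastI_ex[OF ex])
  have ix_le: "K (ix j) \<le> j" for j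
  proof (cases "ix j")
    case 0
    then show ?thesis by (simp add: K_def)
  next
    case (Suc i)
    then have "\<not> j < K (Suc i)" using not_less_Least[of i "\<lambda>i. j < K (Suc i)"] by (simp add: ix_def)
    then show ?thesis using Suc by simp
  qed
  have ix_eq: "ix j = i" if "K i \<le> j" "j < K (Suc i)" for i j
    using ix[of j] ix_le[of j] K_mono[of "Suc i" "ix j"] K_mono[of "Suc (ix j)" i] that by linarith
  have ix_mono: "ix i \<le> ix j" if "i \<le> j" for i j
    unfolding ix_def[of i] using ix[of j] that by (intro Least_le) simp
  show ?thesis
  proof (rule exI[of _ ix], rule exI[of _ "\<lambda>j. j - K (ix j)"], intro conjI allI impI)
    show "j - K (ix j) < n (ix j)" for j
      using ix[of j] ix_le[of j] by (simp add: K_Suc less_diff_conv2)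
    show "ix i < ix j \<or> ix i = ix j \<and> i - K (ix i) < j - K (ix j)" if "i < j" for i j
      using ix_mono[of i j] ix_le[of i] that by (auto simp: le_less diff_less_mono)
    show "\<exists>j. ix j = i \<and> j - K (ix j) = l" if "l < n i" for i l
    proof -
      have "ix (K i + l) = i" by (rule ix_eq) (use that in \<open>simp_all add: K_Suc\<close>)
      then show ?thesis by (intro exI[of _ "K i + l"]) simp
    qed
  qed
qed

text \<open>Concatenating the finite decompositions gives, unless it stops, a sequence of
  indecomposable sums. By \<open>indec_recurrent\<close> its terms from some \<open>N\<close> on
  recur, so this tail is a single indecomposable sum, preceded by finitely many terms.\<close>

lemma decomposable_sum:
  fixes A :: "nat \<Rightarrow> 'a::linorder set"
  assumes A: "\<And>i. decomposable (A i)" and bef: "\<And>i j. i < j \<Longrightarrow> before d (A i) (A j)"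
  shows "decomposable (\<Union>i. A i)"
proof -
  obtain n where "\<And>i. fin_sum d (n i) (A i)" using A unfolding decomposable_iff[of _ d] by metis
  then have "\<forall>i. \<exists>t. (\<forall>l<n i. indec (t l)) \<and>
      (\<forall>l k. l < k \<longrightarrow> k < n i \<longrightarrow> before d (supp (t l)) (supp (t k))) \<and> A i = (\<Union>l<n i. supp (t l))"
    unfolding fin_sum_def by blast
  from choice[OF this] obtain t where *: "\<forall>i. (\<forall>l<n i. indec (t i l)) \<and>
      (\<forall>l k. l < k \<longrightarrow> k < n i \<longrightarrow> before d (supp (t i l)) (supp (t i k))) \<and> A i = (\<Union>l<n i. supp (t i l))"
    by blast
  have t: "\<And>i l. l < n i \<Longrightarrow> indec (t i l)"
    "\<And>i l k. l < k \<Longrightarrow> k < n i \<Longrightarrow> before d (supp (t i l)) (supp (t i k))"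
    "\<And>i. A i = (\<Union>l<n i. supp (t i l))" using * by simp_all
  show ?thesis
  proof (cases "finite {i. 0 < n i}")
    case True
    then obtain N where N: "\<forall>i\<in>{i. 0 < n i}. i < N" using finite_nat_set_iff_bounded by blast
    have "A i \<subseteq> (\<Union>i<N. A i)" for i
    proof (cases "i < N")
      case False
      then have "n i = 0" using N by auto
      then show ?thesis using t(3)[of i] by simp
    qed auto
    then have "(\<Union>i. A i) = (\<Union>i<N. A i)" by blast
    then show ?thesis using decomposable_finite_Union[of N A d] A bef by simp
  next
    case False
    from enumerate_blocks[OF this] obtain p q :: "nat \<Rightarrow> nat" where e: "\<And>j. q j < n (p j)"
      "\<And>i j. i < j \<Longrightarrow> p i < p j \<or> p i = p j \<and> q i < q j"
      "\<And>i l. l < n i \<Longrightarrow> \<exists>j. p j = i \<and> q j = l"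
      by blast
    define u where "u j = t (p j) (q j)" for j
    have u: "indec (u j)" for j unfolding u_def by (rule t(1)[OF e(1)])
    have u_sub: "supp (u j) \<subseteq> A (p j)" for j
      unfolding u_def using t(3)[of "p j"] e(1)[of j] by blast
    have u_bef: "before d (supp (u i)) (supp (u j))" if "i < j" for i j
    proof (cases "p i < p j")
      case True
      then show ?thesis using before_mono[OF bef u_sub u_sub] by blast
    next
      case False
      then have "p i = p j" "q i < q j" using e(2)[OF that] by simp_all
      then show ?thesis unfolding u_def using t(2)[OF _ e(1)[of j]] by simp
    qed
    have Un: "(\<Union>i. A i) = (\<Union>j. supp (u j))"
    proof
      show "(\<Union>i. A i) \<subseteq> (\<Union>j. supp (u j))"
      proof clarify
        fix x i assume "x \<in> A i"
        then obtain l where l: "l < n i" "x \<in> supp (t i l)" using t(3) by blast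
        then obtain j where "p j = i" "q j = l" using e(3) by blast
        then have "x \<in> supp (u j)" using l(2) by (simp add: u_def)
        then show "x \<in> (\<Union>j. supp (u j))" by blast
      qed
    qed (use u_sub in blast)
    obtain N where N: "\<And>i. N \<le> i \<Longrightarrow> infinite {j. embeds (supp (u i)) (supp (u j))}"
      using indec_recurrent[of u] u by blast
    have "indec (Sum d (\<lambda>i. u (N + i)))"
    proof -
      have "infinite {j. embeds (supp (u (N + i))) (supp (u (N + j)))}" for i
        using N[of "N + i"] by (intro infinite_Collect_shift) simp
      then show ?thesis using u u_bef by simp
    qed
    then have "decomposable (supp (Sum d (\<lambda>i. u (N + i))))" by (rule decomposable_supp)
    then have "decomposable (\<Union>i. supp (u (N + i)))" by simp
    moreover have "decomposable (\<Union>i<N. supp (u i))"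
      using decomposable_supp u u_bef by (intro decomposable_finite_Union[where d = d]) auto
    moreover have "before d (\<Union>i<N. supp (u i)) (\<Union>i. supp (u (N + i)))"
      unfolding before_Union using u_bef by simp
    ultimately have "decomposable ((\<Union>i<N. supp (u i)) \<union> (\<Union>i. supp (u (N + i))))"
      by (intro decomposable_Un)
    also have "(\<Union>i<N. supp (u i)) \<union> (\<Union>i. supp (u (N + i))) = (\<Union>i. A i)"
    proof -
      have "\<exists>k. j = N + k" if "\<not> j < N" for j using that by (metis le_iff_add not_le)
      then have "x \<in> (\<Union>i<N. supp (u i)) \<union> (\<Union>i. supp (u (N + i)))" if "x \<in> supp (u j)" for x j
        using that by (cases "j < N") auto
      then show ?thesis unfolding Un by blast
    qed
    finally show ?thesis .
  qed
qed

text \<open>The traces on the summands of a sum are decomposable by induction on the tree, but they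
  may fail to recur; \<open>decomposable_sum\<close> regroups them.\<close>

lemma decomposable_subset:
  fixes A B :: "'a::linorder set"
  assumes "decomposable A" "B \<subseteq> A"
  shows "decomposable B"
proof -
  have supp: "decomposable C" if "indec t" "C \<subseteq> supp t" for t and C :: "'a set"
    using that
  proof (induction t arbitrary: C)
    case (Point x)
    then have "C = {} \<or> C = supp (Point x)" by auto
    then show ?case using decomposable_empty decomposable_supp[of "Point x"] by auto
  next
    case (Sum d c)
    have "decomposable (\<Union>i. C \<inter> supp (c i))"
    proof (rule decomposable_sum[where d = d])
      show "decomposable (C \<inter> supp (c i))" for i
        using Sum.IH[of "c i" "C \<inter> supp (c i)"] Sum.prems(1) by simp
      show "before d (C \<inter> supp (c i)) (C \<inter> supp (c j))" if "i < j" for i j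
        using Sum.prems(1) that before_mono[of d "supp (c i)" "supp (c j)"] by simp
    qed
    also have "(\<Union>i. C \<inter> supp (c i)) = C" using Sum.prems(2) by auto
    finally show ?case .
  qed
  obtain n :: nat and t where t: "\<And>i. i < n \<Longrightarrow> indec (t i)"
    "\<And>i j. i < j \<Longrightarrow> j < n \<Longrightarrow> before True (supp (t i)) (supp (t j))"
    "A = (\<Union>i<n. supp (t i))" using assms(1) unfolding decomposable_def fin_sum_def by blast
  have "decomposable (\<Union>i<n. B \<inter> supp (t i))"
  proof (rule decomposable_finite_Union[where d = True])
    show "decomposable (B \<inter> supp (t i))" if "i < n" for i using supp[OF t(1)[OF that]] by simp
    show "before True (B \<inter> supp (t i)) (B \<inter> supp (t j))" if "i < j" "j < n" for i j
      using t(2)[OF that] before_mono[of True "supp (t i)" "supp (t j)"] by simp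
  qed
  also have "(\<Union>i<n. B \<inter> supp (t i)) = B" using assms(2) t(3) by auto
  finally show ?thesis .
qed

text \<open>An enumeration of \<open>A\<close> cuts it into consecutive blocks: the n-th consists of
  the points dominated for the first time by the n-th element. Each block lies in one section, and
  it is empty when the n-th element is dominated by an earlier one.\<close>

lemma decomposable_sections:
  fixes A :: "'a::linorder set"
  assumes "countable A" and sec: "\<And>a. a \<in> A \<Longrightarrow> decomposable {x \<in> A. if d then x \<le> a else a \<le> x}"
  shows "decomposable A"
proof (cases "A = {}")
  case False
  define e where "e = from_nat_into A"
  have e: "range e = A" unfolding e_def by (rule range_from_nat_into[OF False assms(1)])
  define le where "le x y = (if d then x \<le> y else y \<le> x)" for x y :: 'a
  define B where "B n = {x \<in> A. le x (e n) \<and> (\<forall>i<n. \<not> le x (e i))}" for n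
  have "decomposable (\<Union>n. B n)"
  proof (rule decomposable_sum[where d = d])
    show "decomposable (B n)" for n
      by (rule decomposable_subset[OF sec[of "e n"]]) (use e in \<open>auto simp: B_def le_def\<close>)
    show "before d (B i) (B j)" if "i < j" for i j
      using that unfolding before_def B_def le_def by (auto split: if_splits)
  qed
  also have "(\<Union>n. B n) = A"
  proof
    show "A \<subseteq> (\<Union>n. B n)"
    proof
      fix x assume x: "x \<in> A"
      then obtain m where "e m = x" using e by blast
      then have ex: "\<exists>n. le x (e n)" by (intro exI[of _ m]) (simp add: le_def)
      define k where "k = (LEAST n. le x (e n))"
      have "le x (e k)" unfolding k_def by (rule LeastI_ex[OF ex])
      moreover have "\<not> le x (e i)" if "i < k" for i using that unfolding k_def by (rule not_less_Least)
      ultimately have "x \<in> B k" using x by (simp add: B_def)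
      then show "x \<in> (\<Union>n. B n)" by blast
    qed
  qed (auto simp: B_def)
  finally show ?thesis .
qed (simp add: decomposable_empty)

section \<open>From scatteredness to decomposability\<close>

text \<open>\<open>D\<close> stands for a family of intervals that can be split forever, such as the
  non-decomposable ones. Membership in \<open>A\<close> is asked of right end points because every
  value of the constructed map is the right end point of some related pair.\<close>

lemma not_scatteredI:
  fixes D :: "'a::linorder \<Rightarrow> 'a \<Rightarrow> bool"
  assumes "\<And>a b. D a b \<Longrightarrow> a < b \<and> b \<in> A" "\<And>a b. D a b \<Longrightarrow> \<exists>c. D a c \<and> D c b" "D a0 b0"
  shows "embeds (UNIV :: rat set) A"
proof -
  have "linear_order_on (UNIV :: rat set) (relation_of (\<le>) UNIV)"
    by (auto simp: linear_order_on_def partial_order_on_def preorder_on_def refl_on_def trans_def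
        antisym_def total_on_def relation_of_def)
  then obtain f :: "rat \<Rightarrow> 'a" where f: "\<forall>x\<in>UNIV. \<forall>y\<in>UNIV. (x, y) \<in> relation_of (\<le>) UNIV \<longleftrightarrow> f x \<le> f y"
    "\<forall>x\<in>UNIV. \<exists>a. D a (f x)"
    using countable_linear_order_embeds_dense[of UNIV "relation_of (\<le>) UNIV" D a0 b0] assms
      countableI_type by blast
  then show ?thesis
    unfolding embeds_def using assms(1)
    by (intro exI[of _ f]) (fastforce simp: relation_of_def strict_mono_on_def less_le_not_le)
qed

theorem scattered_decomposable:
  fixes A :: "'a::linorder set"
  assumes "countable A" and scat: "\<not> embeds (UNIV :: rat set) A"
  shows "decomposable A"
proof (rule ccontr)
  assume nd: "\<not> decomposable A"
  \<comment> \<open>The pairs that span a non-decomposable interval. One such pair exists and all of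
    them split, so the rationals embed in \<open>A\<close>.\<close>
  define D where "D a b \<longleftrightarrow> a < b \<and> a \<in> A \<and> b \<in> A \<and> \<not> decomposable (A \<inter> {a..b})" for a b
  \<comment> \<open>The points with a decomposable lower half form an initial segment
    \<open>I\<close>; all other points have a decomposable upper half. \<open>I\<close> is exhausted
    upwards and its complement downwards, each by \<open>decomposable_sections\<close>.\<close>
  have split: "decomposable B" if B: "B \<subseteq> A" and sec: "\<And>c. c \<in> B \<Longrightarrow>
      decomposable {x \<in> B. x \<le> c} \<or> decomposable {x \<in> B. c \<le> x}" for B
  proof -
    define I where "I = {c \<in> B. decomposable {x \<in> B. x \<le> c}}"
    have cnt: "countable I" "countable (B - I)"
      using assms(1) B by (auto simp: I_def intro: countable_subset)
    have "decomposable I" using cnt(1)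
    proof (rule decomposable_sections[where d = True])
      fix a assume "a \<in> I"
      then have "decomposable {x \<in> B. x \<le> a}" by (simp add: I_def)
      then show "decomposable {x \<in> I. if True then x \<le> a else a \<le> x}"
        by (rule decomposable_subset) (auto simp: I_def)
    qed
    moreover have "decomposable (B - I)" using cnt(2)
    proof (rule decomposable_sections[where d = False])
      fix a assume "a \<in> B - I"
      then have "decomposable {x \<in> B. a \<le> x}" using sec by (auto simp: I_def)
      then show "decomposable {x \<in> B - I. if False then x \<le> a else a \<le> x}"
        by (rule decomposable_subset) auto
    qed
    moreover have "before True I (B - I)"
      unfolding before_def
    proof (intro ballI, simp, rule ccontr)
      fix x y assume xy: "x \<in> I" "y \<in> B \<and> y \<notin> I" "\<not> x < y"
      then have "{z \<in> B. z \<le> y} \<subseteq> {z \<in> B. z \<le> x}" by auto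
      then have "decomposable {z \<in> B. z \<le> y}" using xy(1) decomposable_subset by (auto simp: I_def)
      then show False using xy by (simp add: I_def)
    qed
    ultimately have "decomposable (I \<union> (B - I))" by (rule decomposable_Un)
    moreover have "I \<union> (B - I) = B" by (auto simp: I_def)
    ultimately show ?thesis by simp
  qed
  \<comment> \<open>If no c leaves two non-decomposable halves, every c has a decomposable half and
    \<open>split\<close> applies to the interval. For c an end point, that half is a single
    point.\<close>
  have dense: "\<exists>c. D a c \<and> D c b" if "D a b" for a b
  proof (rule ccontr)
    assume no: "\<nexists>c. D a c \<and> D c b"
    have pt: "decomposable (A \<inter> {c..c})" for c
      using decomposable_supp[of "Point c"] by (rule decomposable_subset) auto
    have "decomposable (A \<inter> {a..b})"
    proof (rule split)
      fix c assume c: "c \<in> A \<inter> {a..b}"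
      have "{x \<in> A \<inter> {a..b}. x \<le> c} = A \<inter> {a..c}" "{x \<in> A \<inter> {a..b}. c \<le> x} = A \<inter> {c..b}"
        using c by auto
      moreover have "decomposable (A \<inter> {a..c}) \<or> decomposable (A \<inter> {c..b})"
        using no c that pt[of c] unfolding D_def by (metis IntD1 IntD2 atLeastAtMost_iff le_less)
      ultimately show "decomposable {x \<in> A \<inter> {a..b}. x \<le> c} \<or> decomposable {x \<in> A \<inter> {a..b}. c \<le> x}"
        by simp
    qed simp
    then show False using that by (simp add: D_def)
  qed
  have "\<exists>a b. D a b"
  proof (rule ccontr)
    assume no: "\<nexists>a b. D a b"
    have int: "decomposable (A \<inter> {a..b})" if "a \<in> A" "b \<in> A" for a b
    proof (cases a b rule: linorder_cases)
      case less
      then show ?thesis using no that by (auto simp: D_def)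
    next
      case equal
      then show ?thesis using decomposable_supp[of "Point b"] decomposable_subset by fastforce
    next
      case greater
      then show ?thesis by (simp add: decomposable_empty)
    qed
    have "decomposable A" using assms(1)
    proof (rule decomposable_sections[where d = True])
      fix b assume b: "b \<in> A"
      have "countable {x \<in> A. x \<le> b}" using assms(1) by (auto intro: countable_subset)
      then have "decomposable {x \<in> A. x \<le> b}"
      proof (rule decomposable_sections[where d = False])
        fix a assume "a \<in> {x \<in> A. x \<le> b}"
        then have "decomposable (A \<inter> {a..b})" using int b by auto
        then show "decomposable {x \<in> {x \<in> A. x \<le> b}. if False then x \<le> a else a \<le> x}"
          by (rule decomposable_subset) auto
      qed
      then show "decomposable {x \<in> A. if True then x \<le> b else b \<le> x}" by simp
    qed
    then show False using nd by simp
  qed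
  then obtain a0 b0 where "D a0 b0" by blast
  then have "embeds (UNIV :: rat set) A"
    using dense by (intro not_scatteredI[of D A a0 b0]) (auto simp: D_def)
  then show False using scat by simp
qed

section \<open>Embeddings between indecomposable sums\<close>

lemma before_points: "before True A B \<longleftrightarrow> (\<forall>x\<in>A. \<forall>y\<in>B. x < y)"
  by (simp add: before_def)

lemma embeds_image: "strict_mono_on X f \<Longrightarrow> A \<subseteq> X \<Longrightarrow> embeds A (f ` A)"
  unfolding embeds_def by (intro exI[of _ f]) (auto simp: strict_mono_on_def)

lemma embeds_nonempty: "embeds A B \<Longrightarrow> A \<noteq> {} \<Longrightarrow> B \<noteq> {}"
  unfolding embeds_def by auto

lemma strict_mono_on_before:
  assumes f: "strict_mono_on X f" and "A \<subseteq> X" "B \<subseteq> X"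
  shows "before d (f ` A) (f ` B) \<longleftrightarrow> before d A B"
proof -
  have "f x < f y \<longleftrightarrow> x < y" if "x \<in> X" "y \<in> X" for x y
    using f that unfolding strict_mono_on_def by (metis linorder_neqE order.asym order.irrefl)
  then show ?thesis using assms(2,3) unfolding before_def by (simp add: subset_iff)
qed

text \<open>When the cut runs in the direction of the sum, a point of \<open>Q\<close> in the
  summand m forces all later summands into \<open>Q\<close>, and by recurrence the whole sum embeds
  in these. For the opposite direction exchange \<open>P\<close> and \<open>Q\<close>.\<close>

lemma indec_split:
  assumes t: "indec t" and PQ: "supp t = P \<union> Q" "before e P Q"
  shows "embeds (supp t) P \<or> embeds (supp t) Q"
proof (cases t)
  case (Point x)
  then show ?thesis using PQ embeds_point by (metis Un_empty supp.simps(1) supp_nonempty)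
next
  case (Sum d c)
  have main: "embeds (supp t) P \<or> embeds (supp t) Q" if PQ: "supp t = P \<union> Q" "before d P Q" for P Q
  proof (cases "Q = {}")
    case True
    then show ?thesis using PQ embeds_subset by auto
  next
    case False
    then obtain y where "y \<in> Q" by blast
    moreover from this have "y \<in> (\<Union>i. supp (c i))" using PQ(1) Sum by simp
    ultimately obtain m where y: "y \<in> Q" "y \<in> supp (c m)" by blast
    have c: "before d (supp (c i)) (supp (c j))" if "i < j" for i j using t Sum that by simp
    have "supp (c (Suc m + i)) \<subseteq> Q" for i
    proof
      fix x assume x: "x \<in> supp (c (Suc m + i))"
      have "x \<notin> P"
      proof
        assume "x \<in> P"
        then have "before d {x} {y}" "before d {y} {x}"
          using before_mono[OF PQ(2), of "{x}" "{y}"] before_mono[OF c[of m "Suc m + i"], of "{y}" "{x}"] x y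
          by simp_all
        then show False unfolding before_def by (cases d) auto
      qed
      then show "x \<in> Q" using PQ(1) x Sum by auto
    qed
    moreover have "embeds (\<Union>i. supp (c i)) (\<Union>i. supp (c (Suc m + i)))"
    proof (rule embeds_sum[where d = d])
      show "infinite {j. embeds (supp (c i)) (supp (c (Suc m + j)))}" for i
        by (rule infinite_Collect_shift) (use t Sum in simp)
    qed (use c in simp_all)
    ultimately have "embeds (supp t) Q" using Sum embeds_mono by (metis UN_least order.refl supp.simps(2))
    then show ?thesis ..
  qed
  show ?thesis
  proof (cases "e = d")
    case True
    then show ?thesis using main PQ by blast
  next
    case False
    then have "before d Q P" using PQ(2) before_flip[of e Q P] by (cases d; cases e) simp_all
    then show ?thesis using main[of Q P] PQ(1) by (auto simp: Un_commute)
  qed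
qed

lemma indec_embeds_split:
  assumes t: "indec t" and emb: "embeds (supp t) (P \<union> Q)" and bef: "before e P Q"
  shows "embeds (supp t) P \<or> embeds (supp t) Q"
proof -
  obtain f where f: "strict_mono_on (supp t) f" "f ` supp t \<subseteq> P \<union> Q"
    using emb unfolding embeds_def by blast
  define P' Q' where "P' = {x \<in> supp t. f x \<in> P}" and "Q' = {x \<in> supp t. f x \<in> Q}"
  have sub: "P' \<subseteq> supp t" "Q' \<subseteq> supp t" "f ` P' \<subseteq> P" "f ` Q' \<subseteq> Q"
    by (auto simp: P'_def Q'_def)
  have "before e (f ` P') (f ` Q')" using before_mono[OF bef] sub by blast
  then have "before e P' Q'" using strict_mono_on_before[OF f(1) sub(1,2)] by simp
  moreover have "supp t = P' \<union> Q'" using f(2) by (auto simp: P'_def Q'_def)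
  ultimately have "embeds (supp t) P' \<or> embeds (supp t) Q'" using indec_split[OF t] by blast
  moreover have "embeds P' P" "embeds Q' Q"
    using embeds_image[OF f(1)] sub embeds_mono by (metis order.refl)+
  ultimately show ?thesis using embeds_trans by blast
qed

lemma indec_embeds_finite_Union:
  fixes A :: "nat \<Rightarrow> 'b::linorder set"
  assumes t: "indec t" and "embeds (supp t) (\<Union>i<n. A i)"
    and "\<And>i j. i < j \<Longrightarrow> j < n \<Longrightarrow> before e (A i) (A j)"
  shows "\<exists>i<n. embeds (supp t) (A i)"
  using assms(2,3)
proof (induction n)
  case 0
  then show ?case using embeds_nonempty supp_nonempty by fastforce
next
  case (Suc n)
  have "before e (\<Union>i<n. A i) (A n)" using Suc.prems(2)[of _ n] unfolding before_def by auto
  moreover have "embeds (supp t) ((\<Union>i<n. A i) \<union> A n)"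
    using Suc.prems(1) by (simp add: lessThan_Suc Un_commute)
  ultimately consider "embeds (supp t) (\<Union>i<n. A i)" | "embeds (supp t) (A n)"
    using indec_embeds_split[OF t] by blast
  then show ?case
  proof cases
    case 1
    then obtain i where "i < n" "embeds (supp t) (A i)" using Suc by auto
    then show ?thesis using less_SucI by blast
  qed blast
qed

text \<open>A nonempty \<open>X\<close> containing two consecutive copies of itself contains, by iteration, a copy of itself
  between the images of suitable points, and these pairs of points are densely ordered.\<close>

lemma scattered_no_double:
  assumes scat: "\<not> embeds (UNIV :: rat set) X" and "X \<noteq> {}"
    and AB: "A \<subseteq> X" "B \<subseteq> X" "before d A B"
  shows "\<not> (embeds X A \<and> embeds X B)"
proof
  assume emb: "embeds X A \<and> embeds X B"
  have main: False if AB: "A \<subseteq> X" "B \<subseteq> X" "before True A B" "embeds X A" "embeds X B" for A B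
  proof -
    obtain f where f: "strict_mono_on X f" "f ` X \<subseteq> A" using AB(4) unfolding embeds_def by blast
    have "embeds X (f ` B)"
      using AB(5) embeds_image[OF f(1) AB(2)] by (rule embeds_trans)
    \<comment> \<open>This point of the image of \<open>B\<close> under \<open>f\<close> lies in
      \<open>A\<close>, so \<open>B\<close> is to its right, while the image of \<open>A\<close>
      under \<open>f\<close> is to its left: \<open>X\<close> embeds on both sides of
      \<open>c\<close>.\<close>
    then obtain c where c: "c \<in> f ` B" using embeds_nonempty[OF _ \<open>X \<noteq> {}\<close>] by blast
    have "c \<in> A" using c f AB by blast
    then have "c \<in> X" using AB by blast
    have "embeds X (f ` A)" using AB(4) embeds_image[OF f(1) AB(1)] by (rule embeds_trans)
    moreover have "before True (f ` A) (f ` B)" using strict_mono_on_before[OF f(1) AB(1,2)] AB(3) by simp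
    then have "f ` A \<subseteq> X \<inter> {..<c}" using c f(2) AB(1) by (auto simp: before_points)
    ultimately have lo: "embeds X (X \<inter> {..<c})" using embeds_mono by blast
    have "B \<subseteq> X \<inter> {c<..}" using \<open>c \<in> A\<close> AB(2,3) by (auto simp: before_points)
    then have hi: "embeds X (X \<inter> {c<..})" using AB(5) embeds_mono by blast
    define D where "D a b \<longleftrightarrow> a < b \<and> b \<in> X \<and> embeds X (X \<inter> {a<..<b})" for a b
    have D: "D (g c) b" if g: "strict_mono_on X g" "g ` X \<subseteq> X \<inter> {a<..}" "\<forall>x\<in>X. g x < b" "b \<in> X" for g a b
    proof -
      have "g ` (X \<inter> {c<..}) \<subseteq> X \<inter> {g c<..<b}"
        using g \<open>c \<in> X\<close> by (auto simp: strict_mono_on_def)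
      then have "embeds X (X \<inter> {g c<..<b})"
        using hi embeds_image[OF g(1), of "X \<inter> {c<..}"] embeds_trans embeds_mono by (meson inf_le1 order.refl)
      then show ?thesis using g \<open>c \<in> X\<close> by (auto simp: D_def)
    qed
    have D': "D a (g c)" if g: "strict_mono_on X g" "g ` X \<subseteq> X \<inter> {a<..}" for g a
    proof -
      have "g ` (X \<inter> {..<c}) \<subseteq> X \<inter> {a<..<g c}"
        using g \<open>c \<in> X\<close> by (auto simp: strict_mono_on_def)
      then have "embeds X (X \<inter> {a<..<g c})"
        using lo embeds_image[OF g(1), of "X \<inter> {..<c}"] embeds_trans embeds_mono by (meson inf_le1 order.refl)
      then show ?thesis using g \<open>c \<in> X\<close> by (auto simp: D_def)
    qed
    \<comment> \<open>An embedding of \<open>X\<close> into the gap between a and b sends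
      \<open>c\<close> to a splitting point, since the copies of \<open>X\<close> on both sides of
      \<open>c\<close> are carried along.\<close>
    have dense: "\<exists>x. D a x \<and> D x b" if "D a b" for a b
    proof -
      have "b \<in> X" "embeds X (X \<inter> {a<..<b})" using that by (simp_all add: D_def)
      then obtain g where g: "strict_mono_on X g" "g ` X \<subseteq> X \<inter> {a<..<b}" "b \<in> X"
        unfolding embeds_def by blast
      have gX: "g ` X \<subseteq> X \<inter> {a<..}" "\<forall>x\<in>X. g x < b" using g(2) by (auto simp: subset_iff)
      have "D a (g c)" "D (g c) b" by (rule D'[OF g(1) gX(1)], rule D[OF g(1) gX g(3)])
      then show ?thesis by blast
    qed
    obtain h where h: "strict_mono_on X h" "h ` X \<subseteq> X \<inter> {c<..}" using hi unfolding embeds_def by blast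
    have "embeds (UNIV :: rat set) X"
      using dense D'[OF h] by (intro not_scatteredI[of D X c "h c"]) (auto simp: D_def)
    then show False using scat by simp
  qed
  show False
    using main[of A B] main[of B A] AB emb before_flip[of True A B] by (cases d) auto
qed

section \<open>Scattered indecomposable sums\<close>

context
  fixes d :: bool and c :: "nat \<Rightarrow> 'a::linorder decomp"
  assumes ind: "indec (Sum d c)" and scat: "\<not> embeds (UNIV :: rat set) (supp (Sum d c))"
begin

lemma sum_before: "i < j \<Longrightarrow> before d (supp (c i)) (supp (c j))"
  and sum_recurrent: "infinite {j. embeds (supp (c i)) (supp (c j))}"
  using ind by simp_all

text \<open>By indecomposability the whole sum would embed in a single summand, and hence in two
  different summands in which this one recurs; \<open>scattered_no_double\<close> forbids
  this.\<close>

lemma sum_not_embeds_initial: "\<not> embeds (supp (Sum d c)) (\<Union>i<m. supp (c i))"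
proof
  assume "embeds (supp (Sum d c)) (\<Union>i<m. supp (c i))"
  then obtain i where i: "embeds (supp (Sum d c)) (supp (c i))"
    using indec_embeds_finite_Union[OF ind, where n = m and A = "\<lambda>i. supp (c i)" and e = d] sum_before by blast
  obtain j where j: "embeds (supp (c i)) (supp (c j))"
    using sum_recurrent[of i] by (auto simp: infinite_nat_iff_unbounded_le)
  obtain k where k: "j < k" "embeds (supp (c i)) (supp (c k))"
    using sum_recurrent[of i] by (auto simp: infinite_nat_iff_unbounded)
  have "supp (c l) \<subseteq> supp (Sum d c)" for l by auto
  then show False
    using scattered_no_double[OF scat supp_nonempty _ _ sum_before[OF k(1)]] embeds_trans[OF i j]
      embeds_trans[OF i k(2)] by blast
qed

lemma sum_embeds_tail:
  assumes "embeds (supp (Sum d c)) A" "A \<subseteq> supp (Sum d c)"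
  shows "embeds (supp (Sum d c)) (A \<inter> (\<Union>i\<in>{m..}. supp (c i)))"
proof -
  define P where "P = A \<inter> (\<Union>i<m. supp (c i))"
  define Q where "Q = A \<inter> (\<Union>i\<in>{m..}. supp (c i))"
  have "x \<in> P \<union> Q" if x: "x \<in> A" for x
  proof -
    obtain i where "x \<in> supp (c i)" using assms(2) x by auto
    then show ?thesis using x by (cases "i < m") (auto simp: P_def Q_def)
  qed
  then have "A = P \<union> Q" by (auto simp: P_def Q_def)
  moreover have "before d (\<Union>i<m. supp (c i)) (\<Union>i\<in>{m..}. supp (c i))"
    unfolding before_Union using sum_before by simp
  then have "before d P Q" by (rule before_mono) (auto simp: P_def Q_def)
  ultimately have "embeds (supp (Sum d c)) P \<or> embeds (supp (Sum d c)) Q"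
    using indec_embeds_split[OF ind] assms(1) by metis
  moreover have "\<not> embeds (supp (Sum d c)) P"
    using sum_not_embeds_initial[of m] embeds_mono[of "supp (Sum d c)" P] by (auto simp: P_def)
  ultimately show ?thesis by (simp add: Q_def)
qed

text \<open>A point \<open>y\<close> of the summand after k bounds the summand k. In an embedding
  into the tail, the image of the summand k therefore goes no further than the summand that contains
  the image of \<open>y\<close>.\<close>

lemma sum_embeds_block:
  assumes "embeds (supp (Sum d c)) A" "A \<subseteq> supp (Sum d c)"
  shows "\<exists>n>m. embeds (supp (c k)) (A \<inter> (\<Union>i\<in>{m..<n}. supp (c i)))"
proof -
  obtain f where f: "strict_mono_on (supp (Sum d c)) f"
    "f ` supp (Sum d c) \<subseteq> A \<inter> (\<Union>i\<in>{m..}. supp (c i))"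
    using sum_embeds_tail[OF assms, of m] unfolding embeds_def by blast
  obtain y where y: "y \<in> supp (c (Suc k))" using supp_nonempty[of "c (Suc k)"] by blast
  have y': "y \<in> supp (Sum d c)" using y by auto
  then obtain l where l: "m \<le> l" "f y \<in> supp (c l)" using f(2) by blast
  have ksub: "supp (c k) \<subseteq> supp (Sum d c)" by auto
  have "before d (f ` supp (c k)) (f ` {y})"
    using strict_mono_on_before[OF f(1) ksub, of "{y}" d] sum_before[of k "Suc k"] y y'
    by (auto intro: before_mono)
  then have bef: "before d {f x} {f y}" if "x \<in> supp (c k)" for x
    using that by (auto simp: before_def)
  have "f ` supp (c k) \<subseteq> A \<inter> (\<Union>i\<in>{m..<Suc l}. supp (c i))"
  proof
    fix z assume "z \<in> f ` supp (c k)"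
    then obtain x where x: "x \<in> supp (c k)" "z = f x" by blast
    then obtain i where i: "m \<le> i" "z \<in> supp (c i)" "z \<in> A" using f(2) ksub by blast
    have "\<not> l < i"
    proof
      assume "l < i"
      then have "before d {f y} {z}" using sum_before[of l i] l(2) i(2) by (auto intro: before_mono)
      then show False using bef[OF x(1)] x(2) unfolding before_def by (cases d) auto
    qed
    then show "z \<in> A \<inter> (\<Union>i\<in>{m..<Suc l}. supp (c i))" using i by auto
  qed
  then have "embeds (supp (c k)) (A \<inter> (\<Union>i\<in>{m..<Suc l}. supp (c i)))"
    using embeds_image[OF f(1) ksub] embeds_mono by blast
  then show ?thesis using l(1) by (intro exI[of _ "Suc l"]) auto
qed

end

text \<open>A diagonal set: the k-th summand is placed inside the first k + 1 sets, within the k-th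
  of consecutive finite blocks of summands. Then p leaves \<open>A k\<close> only in finitely many
  summands, and a copy of the sum inside p survives their removal.\<close>

lemma indec_pseudo_intersection:
  fixes t :: "'a::linorder decomp" and A :: "nat \<Rightarrow> 'a set"
  assumes ind: "indec t" and scat: "\<not> embeds (UNIV :: rat set) (supp t)"
    and A: "\<And>k. embeds (supp t) (supp t \<inter> (\<Inter>j\<le>k. A j))"
  shows "\<exists>p \<subseteq> supp t \<inter> A 0. embeds (supp t) p \<and>
    (\<forall>k s. s \<subseteq> p \<longrightarrow> embeds (supp t) s \<longrightarrow> embeds (supp t) (s \<inter> A k))"
proof (cases t)
  case (Point x)
  have "x \<in> A k" for k using embeds_nonempty[OF A[of k] supp_nonempty] Point by auto
  then show ?thesis
    using Point embeds_nonempty[of "{x}"] by (intro exI[of _ "{x}"]) (auto intro!: embeds_point)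
next
  case (Sum d c)
  define R where "R k = supp t \<inter> (\<Inter>j\<le>k. A j)" for k
  have R_sub: "R k \<subseteq> supp (Sum d c)" for k using Sum by (auto simp: R_def)
  note scat' = scat[unfolded Sum] and ind' = ind[unfolded Sum]
  have "\<exists>m. m 0 = 0 \<and> (\<forall>k. m k < m (Suc k) \<and>
      embeds (supp (c k)) (R k \<inter> (\<Union>i\<in>{m k..<m (Suc k)}. supp (c i))))"
  proof -
    have "\<exists>m. \<forall>k. (k = 0 \<longrightarrow> m k = 0) \<and> (m k < m (Suc k) \<and>
      embeds (supp (c k)) (R k \<inter> (\<Union>i\<in>{m k..<m (Suc k)}. supp (c i))))"
    proof (rule dependent_nat_choice)
      fix x n
      have "embeds (supp (Sum d c)) (R n)" using A[of n] Sum by (simp add: R_def)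
      then obtain y where "x < y" "embeds (supp (c n)) (R n \<inter> (\<Union>i\<in>{x..<y}. supp (c i)))"
        using sum_embeds_block[OF ind' scat' _ R_sub] by blast
      then show "\<exists>y. (Suc n = 0 \<longrightarrow> y = 0) \<and> (x < y \<and> embeds (supp (c n)) (R n \<inter> (\<Union>i\<in>{x..<y}. supp (c i))))"
        by blast
    qed auto
    then show ?thesis by blast
  qed
  then obtain m where m: "\<And>k. m k < m (Suc k)"
    "\<And>k. embeds (supp (c k)) (R k \<inter> (\<Union>i\<in>{m k..<m (Suc k)}. supp (c i)))" by blast
  have m_mono: "m i \<le> m j" if "i \<le> j" for i j
    by (rule lift_Suc_mono_le[OF _ that]) (use m(1) in \<open>simp add: less_imp_le\<close>)
  define S where "S k = R k \<inter> (\<Union>i\<in>{m k..<m (Suc k)}. supp (c i))" for k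
  have S_bef: "before d (S i) (S j)" if "i < j" for i j
  proof -
    have "before d (\<Union>l\<in>{m i..<m (Suc i)}. supp (c l)) (\<Union>l\<in>{m j..<m (Suc j)}. supp (c l))"
      unfolding before_Union using sum_before[OF ind' scat'] m_mono[of "Suc i" j] that by auto
    then show ?thesis by (rule before_mono) (auto simp: S_def)
  qed
  have S_sub: "S k \<subseteq> supp t" "S k \<subseteq> A 0" for k by (auto simp: S_def R_def)
  define p where "p = (\<Union>k. S k)"
  have "embeds (\<Union>k. supp (c k)) (\<Union>k. S k)"
    by (rule embeds_UnionI[where d = d]) (use m(2) sum_before[OF ind' scat'] S_bef in \<open>auto simp: S_def\<close>)
  then have "embeds (supp t) p" using Sum by (simp add: p_def)
  moreover have "embeds (supp t) (s \<inter> A k)" if s: "s \<subseteq> p" "embeds (supp t) s" for k s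
  proof -
    have sub: "s \<subseteq> supp (Sum d c)" using s(1) S_sub Sum by (auto simp: p_def)
    have "embeds (supp (Sum d c)) (s \<inter> (\<Union>i\<in>{m k..}. supp (c i)))"
      using sum_embeds_tail[OF ind' scat' _ sub] s(2) Sum by simp
    \<comment> \<open>A point beyond \<open>m k\<close> lies in a block with number at least k, and
      such a block was filled from \<open>A k\<close>.\<close>
    moreover have "s \<inter> (\<Union>i\<in>{m k..}. supp (c i)) \<subseteq> s \<inter> A k"
    proof
      fix x assume "x \<in> s \<inter> (\<Union>i\<in>{m k..}. supp (c i))"
      then obtain i where x: "x \<in> s" "m k \<le> i" "x \<in> supp (c i)" by auto
      then obtain l where l: "x \<in> S l" using s(1) by (auto simp: p_def)
      then obtain j where j: "m l \<le> j" "j < m (Suc l)" "x \<in> supp (c j)" by (auto simp: S_def)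
      have "i = j"
        using sum_before[OF ind' scat', of i j] sum_before[OF ind' scat', of j i] before_disjoint x(3) j(3)
        by (metis IntI empty_iff linorder_neqE)
      then have "m k < m (Suc l)" using x(2) j(2) by simp
      then have "k \<le> l" using m_mono[of "Suc l" k] by (meson leD not_less_eq_eq)
      then show "x \<in> s \<inter> A k" using l x(1) by (auto simp: S_def R_def)
    qed
    ultimately show ?thesis using Sum embeds_mono by (metis order.refl)
  qed
  moreover have "p \<subseteq> supp t \<inter> A 0" using S_sub unfolding p_def by blast
  ultimately show ?thesis by blast
qed

text \<open>The summand k embeds in two reserved summands, \<open>m (2 * k)\<close> and
  \<open>m (2 * k + 1)\<close>, and \<open>Z\<close> selects one of them for every k. Different sets
  select differently somewhere, the empty set and \<open>UNIV\<close> everywhere.\<close>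

lemma sum_binary_embeddings:
  assumes ind: "indec (Sum d c)"
  shows "\<exists>h :: nat set \<Rightarrow> 'a::linorder \<Rightarrow> 'a. (\<forall>Z. strict_mono_on (supp (Sum d c)) (h Z) \<and>
      h Z ` supp (Sum d c) \<subseteq> supp (Sum d c)) \<and>
    inj (\<lambda>Z. h Z ` supp (Sum d c)) \<and> h {} ` supp (Sum d c) \<inter> h UNIV ` supp (Sum d c) = {}"
proof -
  obtain m where m: "strict_mono m" "\<And>k. m k \<in> {j. embeds (supp (c (k div 2))) (supp (c j))}"
    using strict_mono_selection[of "\<lambda>k. {j. embeds (supp (c (k div 2))) (supp (c j))}"] ind by auto
  define b where "b Z k = m (if k \<in> Z then 2 * k + 1 else 2 * k)" for Z k
  have b_mono: "b Z i < b Z j" if "i < j" for Z i j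
    using m(1) that by (auto simp: b_def strict_mono_less)
  have b_eq: "b Z i = b Y j \<longleftrightarrow> i = j \<and> (i \<in> Z \<longleftrightarrow> j \<in> Y)" for Z Y i j
    using m(1) by (auto simp: b_def strict_mono_eq) presburger+
  have bef: "before d (supp (c i)) (supp (c j))" if "i < j" for i j using ind that by simp
  have disj: "i = j" if "x \<in> supp (c i)" "x \<in> supp (c j)" for x i j
    using bef[of i j] bef[of j i] before_disjoint that by (metis IntI empty_iff linorder_neqE)
  have "\<exists>h. strict_mono_on (\<Union>k. supp (c k)) h \<and> (\<forall>k\<in>UNIV. h ` supp (c k) \<subseteq> supp (c (b Z k)))" for Z
  proof (rule embeds_Union[where d = d])
    show "embeds (supp (c k)) (supp (c (b Z k)))" for k
      using m(2)[of "2 * k"] m(2)[of "2 * k + 1"] by (simp add: b_def)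
  qed (use bef b_mono in auto)
  then obtain h where h: "\<And>Z. strict_mono_on (\<Union>k. supp (c k)) (h Z)"
    "\<And>Z k. h Z ` supp (c k) \<subseteq> supp (c (b Z k))" by (metis UNIV_I)
  have meets: "h Z ` supp (Sum d c) \<inter> supp (c (b Y k)) \<noteq> {} \<longleftrightarrow> (k \<in> Z \<longleftrightarrow> k \<in> Y)" for Z Y k
  proof
    assume "h Z ` supp (Sum d c) \<inter> supp (c (b Y k)) \<noteq> {}"
    then obtain x i where "x \<in> supp (c i)" "h Z x \<in> supp (c (b Y k))" by auto
    then have "b Z i = b Y k" using h(2) disj by blast
    then have "i = k \<and> (i \<in> Z \<longleftrightarrow> k \<in> Y)" unfolding b_eq .
    then show "k \<in> Z \<longleftrightarrow> k \<in> Y" by blast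
  next
    assume "k \<in> Z \<longleftrightarrow> k \<in> Y"
    then have "b Z k = b Y k" by (simp add: b_def)
    then have "h Z ` supp (c k) \<subseteq> supp (c (b Y k))" using h(2)[of Z k] by simp
    moreover obtain x where "x \<in> supp (c k)" using supp_nonempty[of "c k"] by blast
    moreover from this have "h Z x \<in> h Z ` supp (Sum d c)" by auto
    ultimately show "h Z ` supp (Sum d c) \<inter> supp (c (b Y k)) \<noteq> {}" by blast
  qed
  have "inj (\<lambda>Z. h Z ` supp (Sum d c))"
  proof (rule injI)
    fix Z Y assume eq: "h Z ` supp (Sum d c) = h Y ` supp (Sum d c)"
    have "k \<in> Z \<longleftrightarrow> k \<in> Y" for k using meets[of Z Y k] meets[of Y Y k] unfolding eq by simp
    then show "Z = Y" by blast
  qed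
  moreover have "h {} ` supp (Sum d c) \<inter> h UNIV ` supp (Sum d c) = {}"
  proof (rule ccontr)
    assume "\<not> ?thesis"
    then obtain y x where y: "y \<in> h {} ` supp (Sum d c)" "y = h UNIV x" "x \<in> supp (Sum d c)" by blast
    then obtain k where "x \<in> supp (c k)" by auto
    then have "y \<in> supp (c (b UNIV k))" using h(2)[of UNIV k] y(2) by blast
    then show False using meets[of "{}" UNIV k] y(1) by auto
  qed
  moreover have "h Z ` supp (Sum d c) \<subseteq> supp (Sum d c)" for Z 
    using h(2)[of Z] by (simp add: image_UN subset_iff) blast
  ultimately show ?thesis using h(1) by (intro exI[of _ h]) simp
qed

section \<open>Minimal decompositions\<close>

lemma strict_mono_endo_id:
  fixes f :: "nat \<Rightarrow> nat"
  assumes mono: "\<And>i j. i < j \<Longrightarrow> j < n \<Longrightarrow> f i < f j" and less: "\<And>i. i < n \<Longrightarrow> f i < n" and "i < n"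
  shows "f i = i"
proof -
  have step: "f i + k \<le> f (i + k)" if "i + k < n" for i k
    using that
  proof (induction k)
    case (Suc k)
    then have "f i + k \<le> f (i + k)" by simp
    also have "f (i + k) < f (i + Suc k)" using mono Suc.prems by simp
    finally show ?case by simp
  qed simp
  have "i \<le> f i" using step[of 0 i] \<open>i < n\<close> by simp
  moreover have "f i + (n - 1 - i) < n"
    using step[of i "n - 1 - i"] less[of "n - 1"] \<open>i < n\<close> by simp
  ultimately show ?thesis using \<open>i < n\<close> by simp
qed

lemma fin_sum_subfamily:
  assumes "finite S" and t: "\<And>i. i \<in> S \<Longrightarrow> indec (t i)"
    "\<And>i j :: nat. i < j \<Longrightarrow> i \<in> S \<Longrightarrow> j \<in> S \<Longrightarrow> before True (supp (t i)) (supp (t j))"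
  shows "fin_sum True (card S) (\<Union>i\<in>S. supp (t i))"
  using assms
proof (induction S rule: finite_linorder_max_induct)
  case empty
  then show ?case by (auto simp: fin_sum_def)
next
  case (insert b S)
  have "fin_sum True 1 (supp (t b))"
    unfolding fin_sum_def using insert.prems by (intro exI[of _ "\<lambda>_. t b"]) auto
  moreover have "fin_sum True (card S) (\<Union>i\<in>S. supp (t i))" using insert by simp
  moreover have "before True (\<Union>i\<in>S. supp (t i)) (\<Union>i\<in>{b}. supp (t i))"
    unfolding before_Union using insert by auto
  ultimately have "fin_sum True (card S + 1) ((\<Union>i\<in>S. supp (t i)) \<union> supp (t b))"
    by (intro fin_sum_append) simp_all
  moreover have "card (insert b S) = card S + 1" using insert by auto
  ultimately show ?case by (simp add: Un_commute)
qed

text \<open>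
  An embedding \<open>f\<close> of the sum into itself sends a copy of the \<open>i\<close>-th summand into the \<open>\<phi> i\<close>-th one with
  \<open>\<phi>\<close> monotone; if \<open>\<phi>\<close> were not the identity, the summands in its range would form a shorter sum.
\<close>

theorem minimal_decomposition:
  fixes A :: "'a::linorder set"
  assumes "decomposable A"
  shows "\<exists>(n :: nat) t. (\<forall>i<n. indec (t i)) \<and> (\<forall>i j. i < j \<longrightarrow> j < n \<longrightarrow> before True (supp (t i)) (supp (t j))) \<and>
    (\<Union>i<n. supp (t i)) \<subseteq> A \<and> embeds A (\<Union>i<n. supp (t i)) \<and>
    (\<forall>C \<subseteq> (\<Union>i<n. supp (t i)). embeds (\<Union>i<n. supp (t i)) C \<longrightarrow> (\<forall>i<n. embeds (supp (t i)) (C \<inter> supp (t i))))"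
proof -
  \<comment> \<open>The minimum is taken over all subsets of \<open>A\<close> in which
    \<open>A\<close> embeds, because the shorter sum obtained below is such a subset and may be
    smaller than \<open>A\<close>.\<close>
  define P where "P n \<longleftrightarrow> (\<exists>B\<subseteq>A. fin_sum True n B \<and> embeds A B)" for n
  have "\<exists>n. P n" using assms embeds_subset[of A A] unfolding P_def decomposable_def by blast
  then obtain n where n: "P n" "\<And>k. k < n \<Longrightarrow> \<not> P k"
    by (meson LeastI_ex not_less_Least)
  then obtain t where sub: "(\<Union>i<n. supp (t i)) \<subseteq> A" and emb: "embeds A (\<Union>i<n. supp (t i))"
    and t: "\<And>i. i < n \<Longrightarrow> indec (t i)"
    "\<And>i j. i < j \<Longrightarrow> j < n \<Longrightarrow> before True (supp (t i)) (supp (t j))"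
    unfolding P_def fin_sum_def by blast
  have "embeds (supp (t i)) (C \<inter> supp (t i))"
    if C: "C \<subseteq> (\<Union>i<n. supp (t i))" "embeds (\<Union>i<n. supp (t i)) C" and i: "i < n" for C i
  proof -
    obtain f where f: "strict_mono_on (\<Union>i<n. supp (t i)) f" "f ` (\<Union>i<n. supp (t i)) \<subseteq> C"
      using C(2) unfolding embeds_def by blast
    have t_sub: "supp (t i) \<subseteq> (\<Union>i<n. supp (t i))" if "i < n" for i using that by blast
    have "\<exists>j<n. embeds (supp (t i)) (f ` supp (t i) \<inter> supp (t j))" if i: "i < n" for i
    proof (rule indec_embeds_finite_Union[OF t(1)[OF i], where e = True])
      have "f ` supp (t i) \<subseteq> (\<Union>j<n. f ` supp (t i) \<inter> supp (t j))"
      proof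
        fix y assume y: "y \<in> f ` supp (t i)"
        then have "y \<in> (\<Union>i<n. supp (t i))" using image_mono[OF t_sub[OF i], of f] f(2) C(1) by blast
        then show "y \<in> (\<Union>j<n. f ` supp (t i) \<inter> supp (t j))" using y by simp
      qed
      then show "embeds (supp (t i)) (\<Union>j<n. f ` supp (t i) \<inter> supp (t j))"
        by (rule embeds_mono[OF embeds_image[OF f(1) t_sub[OF i]] order.refl])
      show "before True (f ` supp (t i) \<inter> supp (t j)) (f ` supp (t i) \<inter> supp (t k))"
        if "j < k" "k < n" for j k
        by (rule before_mono[OF t(2)[OF that]]) auto
    qed
    then have "\<forall>i. \<exists>j. i < n \<longrightarrow> j < n \<and> embeds (supp (t i)) (f ` supp (t i) \<inter> supp (t j))" by blast
    from choice[OF this] obtain \<phi> where \<phi>: "\<And>i. i < n \<Longrightarrow> \<phi> i < n"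
      "\<And>i. i < n \<Longrightarrow> embeds (supp (t i)) (f ` supp (t i) \<inter> supp (t (\<phi> i)))" by blast
    have f_bef: "before True (f ` supp (t i)) (f ` supp (t j))" if "i < j" "j < n" for i j
      using strict_mono_on_before[OF f(1) t_sub t_sub] t(2) that by simp
    have mono: "\<phi> i \<le> \<phi> j" if ij: "i < j" "j < n" for i j
    proof (rule ccontr)
      assume "\<not> \<phi> i \<le> \<phi> j"
      then have bef: "before True (supp (t (\<phi> j))) (supp (t (\<phi> i)))" using t(2) \<phi>(1)[of i] ij by simp
      have ne: "\<exists>x. x \<in> f ` supp (t i) \<and> x \<in> supp (t (\<phi> i))" if "i < n" for i
        using embeds_nonempty[OF \<phi>(2)[OF that] supp_nonempty] by blast
      obtain x where x: "x \<in> f ` supp (t i)" "x \<in> supp (t (\<phi> i))" using ne[of i] ij by auto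
      obtain y where y: "y \<in> f ` supp (t j)" "y \<in> supp (t (\<phi> j))" using ne[of j] ij by auto
      have "y < x" using bef x(2) y(2) unfolding before_points by blast
      moreover have "x < y" using f_bef[OF ij] x(1) y(1) unfolding before_points by blast
      ultimately show False by simp
    qed
    define S where "S = \<phi> ` {..<n}"
    have "S \<subseteq> {..<n}" using \<phi>(1) by (auto simp: S_def)
    then have "fin_sum True (card S) (\<Union>j\<in>S. supp (t j))"
      using t by (intro fin_sum_subfamily) (auto intro: finite_subset)
    moreover have "(\<Union>j\<in>S. supp (t j)) \<subseteq> A" using \<open>S \<subseteq> {..<n}\<close> sub by blast
    \<comment> \<open>Several summands may be sent into the same one; the images under
      \<open>f\<close> keep them apart and in order there.\<close>
    moreover have "embeds (\<Union>i<n. supp (t i)) (\<Union>i<n. f ` supp (t i) \<inter> supp (t (\<phi> i)))"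
      using \<phi>(2) t(2) before_mono[OF f_bef] by (intro embeds_UnionI[where d = True]) auto
    then have "embeds A (\<Union>i<n. f ` supp (t i) \<inter> supp (t (\<phi> i)))" by (rule embeds_trans[OF emb])
    then have "embeds A (\<Union>j\<in>S. supp (t j))"
      by (rule embeds_mono[OF _ order.refl]) (auto simp: S_def)
    ultimately have "P (card S)" unfolding P_def by blast
    then have "n \<le> card S" using n(2)[of "card S"] not_less by blast
    then have "card (\<phi> ` {..<n}) = card {..<n}"
      using card_image_le[of "{..<n}" \<phi>] by (simp add: S_def)
    then have "inj_on \<phi> {..<n}" by (intro eq_card_imp_inj_on) simp_all
    then have "\<phi> i < \<phi> j" if "i < j" "j < n" for i j
      using mono[OF that] inj_onD[of \<phi> "{..<n}" i j] that by fastforce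
    then have "\<phi> i = i" using strict_mono_endo_id[of n \<phi> i] \<phi>(1) i by blast
    then have "embeds (supp (t i)) (f ` supp (t i) \<inter> supp (t i))" using \<phi>(2)[OF i] by simp
    moreover have "f ` supp (t i) \<inter> supp (t i) \<subseteq> C \<inter> supp (t i)"
      using f(2) image_mono[OF t_sub[OF i], of f] by blast
    ultimately show ?thesis by (rule embeds_mono[OF _ order.refl])
  qed
  then show ?thesis using sub emb t by (intro exI[of _ n] exI[of _ t]) simp
qed

text \<open>Collects what the poset needs. By minimality an embedding of \<open>B\<close> in a
  subset restricts to every summand, and conversely embeddings of the summands into their traces
  glue to one of \<open>B\<close> (\<open>glue\<close>). Both claims thereby reduce to single
  indecomposable sums.\<close>

theorem pseudo_intersection_and_incompatible_copies:
  fixes A :: "'a::linorder set"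
  assumes dec: "decomposable A" and inf: "infinite A" and scat: "\<not> embeds (UNIV :: rat set) A"
  shows "\<exists>B\<subseteq>A. embeds A B \<and>
    (\<forall>X :: nat \<Rightarrow> 'a set. (\<forall>k. embeds B (B \<inter> (\<Inter>j\<le>k. X j))) \<longrightarrow>
      (\<exists>p \<subseteq> B \<inter> X 0. embeds B p \<and> (\<forall>k s. s \<subseteq> p \<longrightarrow> embeds B s \<longrightarrow> embeds B (s \<inter> X k)))) \<and>
    (\<exists>C\<subseteq>B. \<exists>D\<subseteq>B. embeds B C \<and> embeds B D \<and> \<not> embeds B (C \<inter> D))"
proof -
  from minimal_decomposition[OF dec] obtain n :: nat and t where *:
    "(\<forall>i<n. indec (t i)) \<and> (\<forall>i j. i < j \<longrightarrow> j < n \<longrightarrow> before True (supp (t i)) (supp (t j))) \<and>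
      (\<Union>i<n. supp (t i)) \<subseteq> A \<and> embeds A (\<Union>i<n. supp (t i)) \<and>
      (\<forall>C \<subseteq> (\<Union>i<n. supp (t i)). embeds (\<Union>i<n. supp (t i)) C \<longrightarrow> (\<forall>i<n. embeds (supp (t i)) (C \<inter> supp (t i))))"
    by (elim exE) (erule that)
  then have t: "\<And>i. i < n \<Longrightarrow> indec (t i)"
    "\<And>i j. i < j \<Longrightarrow> j < n \<Longrightarrow> before True (supp (t i)) (supp (t j))"
    and sub: "(\<Union>i<n. supp (t i)) \<subseteq> A" and emb: "embeds A (\<Union>i<n. supp (t i))"
    and min: "\<And>C i. C \<subseteq> (\<Union>i<n. supp (t i)) \<Longrightarrow> embeds (\<Union>i<n. supp (t i)) C \<Longrightarrow> i < n \<Longrightarrow>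
      embeds (supp (t i)) (C \<inter> supp (t i))"
    by simp_all
  define B where "B = (\<Union>i<n. supp (t i))"
  have t_sub: "supp (t i) \<subseteq> B" if "i < n" for i using that by (auto simp: B_def)
  have glue: "embeds B (\<Union>i<n. Y i)"
    if "\<And>i. i < n \<Longrightarrow> embeds (supp (t i)) (Y i)" "\<And>i. i < n \<Longrightarrow> Y i \<subseteq> supp (t i)" for Y
    unfolding B_def
  proof (rule embeds_UnionI[where d = True])
    show "before True (Y i) (Y j)" if "i \<in> {..<n}" "j \<in> {..<n}" "i < j" for i j
      using before_mono[OF t(2)] that \<open>\<And>i. i < n \<Longrightarrow> Y i \<subseteq> supp (t i)\<close> by simp
  qed (use that t(2) in simp_all)
  have disj: "i = j" if "x \<in> supp (t i)" "x \<in> supp (t j)" "i < n" "j < n" for x i j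
  proof (rule ccontr)
    assume "i \<noteq> j"
    then have "before True (supp (t i)) (supp (t j)) \<or> before True (supp (t j)) (supp (t i))"
      using t(2)[of i j] t(2)[of j i] that(3,4) by (meson linorder_neqE_nat)
    then show False using before_disjoint that(1,2) by (metis IntI empty_iff)
  qed
  have scat_t: "\<not> embeds (UNIV :: rat set) (supp (t i))" if "i < n" for i
    using scat embeds_mono[of "UNIV :: rat set" "supp (t i)" UNIV A] t_sub[OF that] sub
    by (auto simp: B_def)
  have "\<exists>p \<subseteq> B \<inter> X 0. embeds B p \<and> (\<forall>k s. s \<subseteq> p \<longrightarrow> embeds B s \<longrightarrow> embeds B (s \<inter> X k))"
    if X: "\<And>k. embeds B (B \<inter> (\<Inter>j\<le>k. X j))" for X :: "nat \<Rightarrow> 'a set"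
  proof -
    have "embeds (supp (t i)) (supp (t i) \<inter> (\<Inter>j\<le>k. X j))" if "i < n" for i k
    proof -
      have "embeds (supp (t i)) (B \<inter> (\<Inter>j\<le>k. X j) \<inter> supp (t i))"
        by (rule min[OF _ _ that]) (use X[of k] in \<open>auto simp: B_def\<close>)
      then show ?thesis by (rule embeds_mono[OF _ order.refl]) blast
    qed
    note restr = this
    define Q where "Q i p \<longleftrightarrow> p \<subseteq> supp (t i) \<inter> X 0 \<and> embeds (supp (t i)) p \<and>
      (\<forall>k s. s \<subseteq> p \<longrightarrow> embeds (supp (t i)) s \<longrightarrow> embeds (supp (t i)) (s \<inter> X k))" for i p
    have "\<exists>p. Q i p" if "i < n" for i
      using indec_pseudo_intersection[OF t(1)[OF that] scat_t[OF that] restr[OF that]]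
      unfolding Q_def by blast
    then obtain p where Q: "\<And>i. i < n \<Longrightarrow> Q i (p i)" by metis
    have p: "p i \<subseteq> supp (t i) \<inter> X 0" "embeds (supp (t i)) (p i)"
      "s \<subseteq> p i \<Longrightarrow> embeds (supp (t i)) s \<Longrightarrow> embeds (supp (t i)) (s \<inter> X k)" if "i < n" for i k s
      using Q[OF that] unfolding Q_def by simp_all
    have p_sub: "(\<Union>i<n. p i) \<subseteq> B \<inter> X 0" using p(1) by (fastforce simp: B_def)
    have "embeds B (s \<inter> X k)" if s: "s \<subseteq> (\<Union>i<n. p i)" "embeds B s" for s k
    proof -
      have "embeds (supp (t i)) (s \<inter> supp (t i) \<inter> X k)" if i: "i < n" for i
      proof (rule p(3)[OF i])
        show "s \<inter> supp (t i) \<subseteq> p i"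
        proof
          fix x assume x: "x \<in> s \<inter> supp (t i)"
          then obtain j where j: "j < n" "x \<in> p j" using s(1) by blast
          then have "i = j" using disj[of x i j] p(1)[OF j(1)] x i by blast
          then show "x \<in> p i" using j by simp
        qed
        show "embeds (supp (t i)) (s \<inter> supp (t i))"
          by (rule min[OF _ _ i]) (use s p_sub in \<open>auto simp: B_def\<close>)
      qed
      then have "embeds B (\<Union>i<n. s \<inter> supp (t i) \<inter> X k)" by (rule glue) auto
      then show ?thesis by (rule embeds_mono[OF _ order.refl]) blast
    qed
    moreover have "embeds B (\<Union>i<n. p i)" by (rule glue) (use p in auto)
    ultimately show ?thesis using p_sub by blast
  qed
  moreover have "\<exists>C\<subseteq>B. \<exists>D\<subseteq>B. embeds B C \<and> embeds B D \<and> \<not> embeds B (C \<inter> D)"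
  proof -
    have "infinite B"
    proof
      assume "finite B"
      obtain f where "strict_mono_on A f" "f ` A \<subseteq> B" using emb unfolding embeds_def B_def by blast
      then show False
        using \<open>finite B\<close> inf by (metis finite_imageD finite_subset strict_mono_on_imp_inj_on)
    qed
    \<comment> \<open>Points are finite, so some infinite summand is a proper sum; only this summand
      is changed, by two embeddings with disjoint images.\<close>
    then obtain i where i: "i < n" "infinite (supp (t i))" unfolding B_def by blast
    then obtain d c where dc: "t i = Sum d c" by (cases "t i") auto
    have ind: "indec (Sum d c)" using t(1)[OF i(1)] dc by simp
  from sum_binary_embeddings[OF ind] obtain h :: "nat set \<Rightarrow> 'a \<Rightarrow> 'a" where *:
    "(\<forall>Z. strict_mono_on (supp (Sum d c)) (h Z) \<and> h Z ` supp (Sum d c) \<subseteq> supp (Sum d c)) \<and>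
      inj (\<lambda>Z. h Z ` supp (Sum d c)) \<and> h {} ` supp (Sum d c) \<inter> h UNIV ` supp (Sum d c) = {}"
    by (elim exE) (erule that)
  have h: "strict_mono_on (supp (t i)) (h Z)" "h Z ` supp (t i) \<subseteq> supp (t i)"
    "h {} ` supp (t i) \<inter> h UNIV ` supp (t i) = {}" for Z
    unfolding dc using *[THEN conjunct1] *[THEN conjunct2, THEN conjunct2] by blast+
    define Y where "Y Z j = (if j = i then h Z ` supp (t i) else supp (t j))" for Z j
    have Y_sub: "Y Z j \<subseteq> supp (t j)" for Z j using h(2) by (auto simp: Y_def)
    have "embeds (supp (t j)) (Y Z j)" for Z j
      using embeds_image[OF h(1)] by (auto simp: Y_def embeds_subset)
    then have Y: "embeds B (\<Union>j<n. Y Z j)" for Z using Y_sub by (intro glue)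
    have Y_B: "(\<Union>j<n. Y Z j) \<subseteq> B" for Z using Y_sub by (fastforce simp: B_def)
    have "\<not> embeds B ((\<Union>j<n. Y {} j) \<inter> (\<Union>j<n. Y UNIV j))"
    proof
      assume "embeds B ((\<Union>j<n. Y {} j) \<inter> (\<Union>j<n. Y UNIV j))"
      then have "embeds (supp (t i)) ((\<Union>j<n. Y {} j) \<inter> (\<Union>j<n. Y UNIV j) \<inter> supp (t i))"
        using Y_B by (intro min[OF _ _ i(1)]) (auto simp: B_def)
      then obtain x where x: "x \<in> (\<Union>j<n. Y {} j)" "x \<in> (\<Union>j<n. Y UNIV j)" "x \<in> supp (t i)"
        using embeds_nonempty[OF _ supp_nonempty] by blast
      have "x \<in> Y Z i" if "x \<in> (\<Union>j<n. Y Z j)" for Z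
        using that Y_sub disj[OF _ x(3) _ i(1)] by blast
      then have "x \<in> Y {} i" "x \<in> Y UNIV i" using x(1,2) by blast+
      then show False using h(3) by (auto simp: Y_def)
    qed
    then show ?thesis using Y Y_B by blast
  qed
  ultimately show ?thesis using sub emb by (intro exI[of _ B]) (simp add: B_def)
qed

text \<open>One infinite summand is moved and all other points are fixed. This preserves the order
  because a point outside a summand lies on one side of all of it. The ranges are told apart by
  their traces on the moved summand.\<close>

lemma binary_self_embeddings:
  fixes A :: "'a::linorder set"
  assumes dec: "decomposable A" and inf: "infinite A"
  shows "\<exists>h :: nat set \<Rightarrow> 'a \<Rightarrow> 'a. (\<forall>Z. strict_mono_on A (h Z) \<and> h Z ` A \<subseteq> A) \<and> inj (\<lambda>Z. h Z ` A)"
proof -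
  obtain n :: nat and t where t: "\<And>i. i < n \<Longrightarrow> indec (t i)"
    "\<And>i j. i < j \<Longrightarrow> j < n \<Longrightarrow> before True (supp (t i)) (supp (t j))"
    and A: "A = (\<Union>i<n. supp (t i))" using dec unfolding decomposable_def fin_sum_def by blast
  obtain i where i: "i < n" "infinite (supp (t i))" using inf unfolding A by blast
  then obtain d c where dc: "t i = Sum d c" by (cases "t i") auto
  have ind: "indec (Sum d c)" using t(1)[OF i(1)] dc by simp
  define X where "X = supp (t i)"
  have XA: "X \<subseteq> A" using i(1) by (auto simp: A X_def)
  from sum_binary_embeddings[OF ind] obtain g :: "nat set \<Rightarrow> 'a \<Rightarrow> 'a" where *:
    "(\<forall>Z. strict_mono_on (supp (Sum d c)) (g Z) \<and> g Z ` supp (Sum d c) \<subseteq> supp (Sum d c)) \<and>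
      inj (\<lambda>Z. g Z ` supp (Sum d c)) \<and> g {} ` supp (Sum d c) \<inter> g UNIV ` supp (Sum d c) = {}"
    by (elim exE) (erule that)
  have g: "strict_mono_on X (g Z)" "g Z ` X \<subseteq> X" "inj (\<lambda>Z. g Z ` X)" for Z
    unfolding X_def dc using *[THEN conjunct1] *[THEN conjunct2, THEN conjunct1] by blast+
  have out: "x < y \<longleftrightarrow> x < z" "y < x \<longleftrightarrow> z < x" if xyz: "x \<in> A - X" "y \<in> X" "z \<in> X" for x y z
  proof -
    obtain j where j: "j < n" "x \<in> supp (t j)" "j \<noteq> i" using xyz(1) by (auto simp: A X_def)
    then consider "i < j" | "j < i" by linarith
    then have "before True {x} X \<or> before True X {x}"
    proof cases
      case 1
      then have "before True X {x}" using before_mono[OF t(2)[OF 1 j(1)]] j(2) by (simp add: X_def)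
      then show ?thesis ..
    next
      case 2
      then have "before True {x} X" using before_mono[OF t(2)[OF 2 i(1)]] j(2) by (simp add: X_def)
      then show ?thesis ..
    qed
    then show "x < y \<longleftrightarrow> x < z" "y < x \<longleftrightarrow> z < x"
      using xyz(2,3) by (auto simp: before_points dest: order.asym)
  qed
  define h where "h Z x = (if x \<in> X then g Z x else x)" for Z x
  have hX: "h Z x \<in> X \<longleftrightarrow> x \<in> X" for Z x using g(2)[of Z] by (auto simp: h_def)
  have "strict_mono_on A (h Z)" for Z
  proof (rule strict_mono_onI)
    fix x y assume xy: "x \<in> A" "y \<in> A" "x < y"
    show "h Z x < h Z y"
    proof (cases "x \<in> X"; cases "y \<in> X")
      assume "x \<in> X" "y \<in> X"
      then show ?thesis using g(1)[of Z] xy(3) by (auto simp: h_def strict_mono_on_def)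
    next
      assume "x \<in> X" "y \<notin> X"
      then show ?thesis using out(2)[of y x "g Z x"] g(2)[of Z] xy by (auto simp: h_def)
    next
      assume "x \<notin> X" "y \<in> X"
      then show ?thesis using out(1)[of x y "g Z y"] g(2)[of Z] xy by (auto simp: h_def)
    qed (use xy in \<open>simp add: h_def\<close>)
  qed
  moreover have "h Z ` A \<subseteq> A" for Z using g(2)[of Z] XA by (auto simp: h_def)
  moreover have "h Z ` A \<inter> X = g Z ` X" for Z
  proof
    show "h Z ` A \<inter> X \<subseteq> g Z ` X" using hX[of Z] by (auto simp: h_def)
    have "g Z x = h Z x" if "x \<in> X" for x using that by (simp add: h_def)
    then show "g Z ` X \<subseteq> h Z ` A \<inter> X" using g(2)[of Z] XA by auto
  qed
  then have "inj (\<lambda>Z. h Z ` A)" using g(3) unfolding inj_def by metis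
  ultimately show ?thesis by blast
qed

section \<open>The poset of copies\<close>

definition self_embedding :: "'a set \<Rightarrow> 'a rel \<Rightarrow> ('a \<Rightarrow> 'a) \<Rightarrow> bool" where
  "self_embedding L r f \<longleftrightarrow>
    inj_on f L \<and> f ` L \<subseteq> L \<and> (\<forall>x\<in>L. \<forall>y\<in>L. (x, y) \<in> r \<longleftrightarrow> (f x, f y) \<in> r)"

lemma copies_iff: "A \<in> copies L r \<longleftrightarrow> (\<exists>f. self_embedding L r f \<and> A = f ` L)"
proof
  assume "A \<in> copies L r"
  then obtain f where A: "A \<subseteq> L" and f: "bij_betw f A L" "\<forall>x\<in>A. \<forall>y\<in>A. (x, y) \<in> r \<longleftrightarrow> (f x, f y) \<in> r"
    unfolding copies_def order_isomorphic_def by blast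
  define g where "g = inv_into A f"
  have g: "bij_betw g L A" unfolding g_def by (rule bij_betw_inv_into[OF f(1)])
  have "(x, y) \<in> r \<longleftrightarrow> (g x, g y) \<in> r" if "x \<in> L" "y \<in> L" for x y
    using f(2) that bij_betwE[OF g] bij_betw_inv_into_right[OF f(1)] unfolding g_def by metis
  then have "self_embedding L r g" "A = g ` L"
    using g A by (auto simp: self_embedding_def bij_betw_def)
  then show "\<exists>f. self_embedding L r f \<and> A = f ` L" by blast
next
  assume "\<exists>f. self_embedding L r f \<and> A = f ` L"
  then obtain f where f: "inj_on f L" "f ` L \<subseteq> L" "\<forall>x\<in>L. \<forall>y\<in>L. (x, y) \<in> r \<longleftrightarrow> (f x, f y) \<in> r"
    and A: "A = f ` L" by (auto simp: self_embedding_def)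
  have "bij_betw (inv_into L f) A L" unfolding A using f(1) by (simp add: bij_betw_inv_into inj_on_imp_bij_betw)
  moreover have "(x, y) \<in> r \<longleftrightarrow> (inv_into L f x, inv_into L f y) \<in> r" if "x \<in> A" "y \<in> A" for x y
    using f(3) that inv_into_into[of _ f L] f_inv_into_f[of _ f L] unfolding A by metis
  ultimately show "A \<in> copies L r"
    using f(2) A unfolding copies_def order_isomorphic_def by blast
qed

lemma self_embedding_comp:
  assumes f: "self_embedding L r f" and g: "self_embedding L r g"
  shows "self_embedding L r (f \<circ> g)"
proof -
  have gL: "g x \<in> L" if "x \<in> L" for x using g that by (auto simp: self_embedding_def)
  have "inj_on f (g ` L)" using f g by (auto simp: self_embedding_def intro: inj_on_subset)
  then have "inj_on (f \<circ> g) L" using g by (simp add: self_embedding_def comp_inj_on)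
  moreover have "(f \<circ> g) ` L \<subseteq> L" using f gL by (auto simp: self_embedding_def)
  moreover have "(x, y) \<in> r \<longleftrightarrow> ((f \<circ> g) x, (f \<circ> g) y) \<in> r" if "x \<in> L" "y \<in> L" for x y
    using f g gL[OF that(1)] gL[OF that(2)] that by (simp add: self_embedding_def)
  ultimately show ?thesis by (simp add: self_embedding_def)
qed

lemma relation_of_subset_iff: "(A, B) \<in> relation_of (\<subseteq>) P \<longleftrightarrow> A \<in> P \<and> B \<in> P \<and> A \<subseteq> B"
  by (auto simp: relation_of_def)

text \<open>If p is the range of the self-embedding g, taking images under g is an isomorphism from
  the whole poset onto the part below p; a copy inside p is pulled back by composing its
  self-embedding with the inverse of g.\<close>

lemma homogeneous_copies: "homogeneous (copies L r) (relation_of (\<subseteq>) (copies L r))"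
  unfolding homogeneous_def
proof (intro conjI ballI)
  have "self_embedding L r id" by (simp add: self_embedding_def)
  then have "L \<in> copies L r" unfolding copies_iff by (intro exI[of _ id]) simp
  moreover have "A \<subseteq> L" if "A \<in> copies L r" for A using that by (simp add: copies_def)
  ultimately show "\<exists>m\<in>copies L r. \<forall>A\<in>copies L r. (A, m) \<in> relation_of (\<subseteq>) (copies L r)"
    by (auto simp: relation_of_subset_iff)
  fix p assume p: "p \<in> copies L r"
  then obtain g where g: "self_embedding L r g" "p = g ` L" unfolding copies_iff by blast
  have inj: "inj_on g L" using g(1) by (simp add: self_embedding_def)
  have into: "g ` A \<in> copies L r" if A: "A \<in> copies L r" for A
  proof -
    obtain f where "self_embedding L r f" "A = f ` L" using A unfolding copies_iff by blast
    then show ?thesis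
      unfolding copies_iff using self_embedding_comp[OF g(1)] by (intro exI[of _ "g \<circ> f"]) (simp add: image_comp)
  qed
  have onto: "\<exists>B\<in>copies L r. A = g ` B" if A: "A \<in> copies L r" "A \<subseteq> p" for A
  proof -
    obtain f where f: "self_embedding L r f" "A = f ` L" using A(1) unfolding copies_iff by blast
    define h where "h = inv_into L g \<circ> f"
    have gh: "g (h x) = f x" "h x \<in> L" if "x \<in> L" for x
      using that A(2) f(2) g(2) f_inv_into_f[of "f x" g L] inv_into_into[of "f x" g L] by (auto simp: h_def)
    have "self_embedding L r h"
      unfolding self_embedding_def
    proof (intro conjI ballI)
      show "inj_on h L"
      proof (rule inj_onI)
        fix x y assume xy: "x \<in> L" "y \<in> L" "h x = h y"
        then have "f x = f y" using gh(1)[of x] gh(1)[of y] by simp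
        then show "x = y" using f(1) xy(1,2) by (auto simp: self_embedding_def dest: inj_onD)
      qed
      show "h ` L \<subseteq> L" using gh(2) by blast
      show "(x, y) \<in> r \<longleftrightarrow> (h x, h y) \<in> r" if "x \<in> L" "y \<in> L" for x y
        using f(1) g(1) that gh[OF that(1)] gh[OF that(2)] unfolding self_embedding_def by metis
    qed
    then have "h ` L \<in> copies L r" unfolding copies_iff by blast
    moreover have "A = g ` (h ` L)" using gh f(2) by (simp add: image_image)
    ultimately show ?thesis by blast
  qed
  show "order_isomorphic (copies L r) (relation_of (\<subseteq>) (copies L r))
      {q \<in> copies L r. (q, p) \<in> relation_of (\<subseteq>) (copies L r)} (relation_of (\<subseteq>) (copies L r))"
    unfolding order_isomorphic_def
  proof (intro exI[of _ "image g"] conjI ballI)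
    have sub: "A \<subseteq> L" if "A \<in> copies L r" for A using that by (simp add: copies_def)
    show "bij_betw (image g) (copies L r) {q \<in> copies L r. (q, p) \<in> relation_of (\<subseteq>) (copies L r)}"
      unfolding bij_betw_def
    proof
      show "inj_on (image g) (copies L r)"
        using inj sub by (auto intro!: inj_onI simp: inj_on_image_eq_iff)
      show "image g ` copies L r = {q \<in> copies L r. (q, p) \<in> relation_of (\<subseteq>) (copies L r)}"
      proof
        show "image g ` copies L r \<subseteq> {q \<in> copies L r. (q, p) \<in> relation_of (\<subseteq>) (copies L r)}"
          using into p sub g(2) by (auto simp: relation_of_subset_iff)
        show "{q \<in> copies L r. (q, p) \<in> relation_of (\<subseteq>) (copies L r)} \<subseteq> image g ` copies L r"
          by (rule subsetI, simp add: relation_of_subset_iff image_iff onto)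
      qed
    qed
    show "(A, B) \<in> relation_of (\<subseteq>) (copies L r) \<longleftrightarrow> (g ` A, g ` B) \<in> relation_of (\<subseteq>) (copies L r)"
      if "A \<in> copies L r" "B \<in> copies L r" for A B
    proof -
      have "inv_into L g ` g ` A = A" "inv_into L g ` g ` B = B"
        using inv_into_image_cancel[OF inj] sub that by simp_all
      then have "g ` A \<subseteq> g ` B \<longleftrightarrow> A \<subseteq> B" by (metis image_mono)
      then show ?thesis using that into by (simp add: relation_of_subset_iff)
    qed
  qed
qed

section \<open>Transfer to a linearly ordered type\<close>

lemma strict_mono_on_le_iff:
  fixes f :: "'a::linorder \<Rightarrow> 'b::linorder"
  assumes f: "strict_mono_on X f" and xy: "x \<in> X" "y \<in> X"
  shows "f x \<le> f y \<longleftrightarrow> x \<le> y"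
proof (cases x y rule: linorder_cases)
  case less
  then have "f x < f y" using f xy by (simp add: strict_mono_on_def)
  then show ?thesis using less by (simp add: less_imp_le)
next
  case greater
  then have "f y < f x" using f xy by (simp add: strict_mono_on_def)
  then have "\<not> f x \<le> f y" "\<not> x \<le> y" using greater by (simp_all only: not_le)
  then show ?thesis by simp
qed simp

lemma embeds_image_inv:
  assumes f: "strict_mono_on X f" and "A \<subseteq> X"
  shows "embeds (f ` A) A"
proof -
  have inj: "inj_on f A" using f assms(2) by (meson inj_on_subset strict_mono_on_imp_inj_on)
  have inv: "inv_into A f (f x) = x" if "x \<in> A" for x using inj that by simp
  have "strict_mono_on (f ` A) (inv_into A f)"
  proof (rule strict_mono_onI)
    fix y z assume "y \<in> f ` A" "z \<in> f ` A" "y < z"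
    then obtain u v where uv: "u \<in> A" "v \<in> A" "y = f u" "z = f v" "f u < f v" by blast
    then have "u \<in> X" "v \<in> X" using assms(2) by auto
    moreover have "\<not> f v \<le> f u" using uv(5) by (simp only: not_le)
    ultimately have "\<not> v \<le> u" using strict_mono_on_le_iff[OF f, of v u] by simp
    then show "inv_into A f y < inv_into A f z" using uv inv by simp
  qed
  moreover have "inv_into A f ` f ` A \<subseteq> A" using inv by auto
  ultimately show ?thesis unfolding embeds_def by blast
qed

lemma rational_representation:
  fixes L :: "'a set" and r :: "'a rel"
  assumes "linear_order_on L r" "countable L"
  obtains e :: "'a \<Rightarrow> rat" where "\<And>x y. x \<in> L \<Longrightarrow> y \<in> L \<Longrightarrow> (x, y) \<in> r \<longleftrightarrow> e x \<le> e y" "inj_on e L"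
proof -
  have "\<exists>e :: 'a \<Rightarrow> rat. (\<forall>x\<in>L. \<forall>y\<in>L. (x, y) \<in> r \<longleftrightarrow> e x \<le> e y) \<and> (\<forall>x\<in>L. \<exists>a. a < e x)"
    using assms by (rule countable_linear_order_embeds_dense[where D = "(<)" and ?a0.0 = 0 and ?b0.0 = 1])
      (auto intro: dense)
  then obtain e :: "'a \<Rightarrow> rat" where e: "\<forall>x\<in>L. \<forall>y\<in>L. (x, y) \<in> r \<longleftrightarrow> e x \<le> e y" by blast
  have "antisym r" using assms(1) by (simp add: linear_order_on_def partial_order_on_def)
  then have "inj_on e L" using e by (intro inj_onI) (metis antisymD order.refl)
  then show thesis using that e by blast
qed

text \<open>\<open>B\<close> and the image of \<open>L\<close> embed in each other. An embedding of
  \<open>B\<close> in the image of \<open>A\<close> restricts to a self-embedding of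
  \<open>L\<close> with range in \<open>A\<close>; conversely, a self-embedding of \<open>L\<close>
  is preceded by the embedding of \<open>B\<close> in the image of \<open>L\<close>.\<close>

lemma copies_inside_iff:
  fixes B :: "'b::linorder set" and q :: "'a \<Rightarrow> 'b"
  assumes q: "\<And>x y. x \<in> L \<Longrightarrow> y \<in> L \<Longrightarrow> (x, y) \<in> r \<longleftrightarrow> q x \<le> q y" "inj_on q L"
    and B: "q ` L \<subseteq> B" "embeds B (q ` L)" and A: "A \<subseteq> L"
  shows "(\<exists>C\<in>copies L r. C \<subseteq> A) \<longleftrightarrow> embeds B (q ` A)"
proof
  assume "\<exists>C\<in>copies L r. C \<subseteq> A"
  then obtain C where C: "C \<in> copies L r" "C \<subseteq> A" by blast
  then obtain f where f: "self_embedding L r f" "C = f ` L" unfolding copies_iff by blast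
  define g where "g z = q (f (inv_into L q z))" for z
  have f_L: "f x \<in> L" if "x \<in> L" for x using f that by (auto simp: self_embedding_def)
  have gq: "g (q x) = q (f x)" if "x \<in> L" for x using q(2) that by (simp add: g_def)
  have "strict_mono_on (q ` L) g"
  proof (rule strict_mono_onI)
    fix y z assume "y \<in> q ` L" "z \<in> q ` L" "y < z"
    then obtain u v where uv: "u \<in> L" "v \<in> L" "y = q u" "z = q v" "q u < q v" by blast
    have "(v, u) \<notin> r" using q(1)[OF uv(2,1)] uv(5) by simp
    then have "(f v, f u) \<notin> r" using f(1) uv(1,2) by (auto simp: self_embedding_def)
    then have "q (f u) < q (f v)" using q(1)[OF f_L f_L] uv(1,2) by (meson not_le)
    then show "g y < g z" using gq uv by simp
  qed
  moreover have "g ` q ` L \<subseteq> q ` A" using gq f(2) C(2) by auto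
  ultimately have "embeds (q ` L) (q ` A)" unfolding embeds_def by blast
  then show "embeds B (q ` A)" by (rule embeds_trans[OF B(2)])
next
  assume "embeds B (q ` A)"
  then obtain h where h: "strict_mono_on B h" "h ` B \<subseteq> q ` A" unfolding embeds_def by blast
  define f where "f x = inv_into L q (h (q x))" for x
  have fx: "q (f x) = h (q x)" "f x \<in> A" if "x \<in> L" for x
  proof -
    obtain a where a: "a \<in> A" "h (q x) = q a" using h(2) B(1) \<open>x \<in> L\<close> by blast
    then have "f x = a" using A q(2) by (auto simp: f_def)
    then show "q (f x) = h (q x)" "f x \<in> A" using a by simp_all
  qed
  have iff: "(x, y) \<in> r \<longleftrightarrow> (f x, f y) \<in> r" if "x \<in> L" "y \<in> L" for x y
  proof -
    have "q x \<in> B" "q y \<in> B" using B(1) that by auto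
    then have "q x \<le> q y \<longleftrightarrow> h (q x) \<le> h (q y)"
      using strict_mono_on_le_iff[OF h(1)] by simp
    moreover have "f x \<in> L" "f y \<in> L" using fx(2) that A by auto
    ultimately show ?thesis using q(1) fx(1) that by simp
  qed
  have "inj_on f L"
  proof (rule inj_onI)
    fix x y assume xy: "x \<in> L" "y \<in> L" "f x = f y"
    then have "h (q x) = h (q y)" using fx(1) by metis
    moreover have "q x \<in> B" "q y \<in> B" using B(1) xy by auto
    ultimately have "q x = q y" using strict_mono_on_imp_inj_on[OF h(1)] by (auto dest: inj_onD)
    then show "x = y" using q(2) xy by (auto dest: inj_onD)
  qed
  then have "self_embedding L r f" using iff fx(2) A unfolding self_embedding_def by blast
  then show "\<exists>C\<in>copies L r. C \<subseteq> A"
    unfolding copies_iff using fx(2) by (intro bexI[of _ "f ` L"]) (auto simp: copies_iff)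
qed

section \<open>Atoms, size and separative quotient of the poset\<close>

context
  fixes L :: "'a set" and r :: "'a rel" and q :: "'a \<Rightarrow> 'b::linorder" and B :: "'b set"
  assumes q: "\<And>x y. x \<in> L \<Longrightarrow> y \<in> L \<Longrightarrow> (x, y) \<in> r \<longleftrightarrow> q x \<le> q y" and inj: "inj_on q L"
    and B: "q ` L \<subseteq> B" "embeds B (q ` L)"
begin

lemma embeds_copy: "C \<in> copies L r \<Longrightarrow> embeds B (q ` C)"
  using copies_inside_iff[OF q inj B, of C] by (auto simp: copies_def)

lemma copy_inside:
  assumes "embeds B p" "p \<subseteq> q ` A" "A \<subseteq> L"
  shows "\<exists>C\<in>copies L r. C \<subseteq> A \<and> q ` C \<subseteq> p"
proof -
  define A' where "A' = {x \<in> A. q x \<in> p}"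
  have "q ` A' = p" using assms(2) by (auto simp: A'_def)
  then obtain C where "C \<in> copies L r" "C \<subseteq> A'"
    using copies_inside_iff[OF q inj B, of A'] assms(1,3) by (auto simp: A'_def)
  then show ?thesis by (auto simp: A'_def)
qed

text \<open>An embedding \<open>h\<close> of \<open>B\<close> into the image of p carries the two
  incompatible sets below p. A common lower bound of the resulting copies would pull back along
  \<open>h\<close> to an embedding of \<open>B\<close> in \<open>C \<inter> D\<close>.\<close>

lemma atomless_copies:
  assumes "\<exists>C\<subseteq>B. \<exists>D\<subseteq>B. embeds B C \<and> embeds B D \<and> \<not> embeds B (C \<inter> D)"
  shows "atomless (copies L r) (relation_of (\<subseteq>) (copies L r))"
  unfolding atomless_def
proof
  assume "\<exists>p. is_atom (copies L r) (relation_of (\<subseteq>) (copies L r)) p"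
  then obtain p where p: "p \<in> copies L r"
    and comp: "\<And>u v. u \<in> copies L r \<Longrightarrow> v \<in> copies L r \<Longrightarrow> u \<subseteq> p \<Longrightarrow> v \<subseteq> p \<Longrightarrow>
      \<exists>s\<in>copies L r. s \<subseteq> u \<and> s \<subseteq> v"
    by (auto simp: is_atom_def compatible_def relation_of_subset_iff)
  have pL: "p \<subseteq> L" using p by (simp add: copies_def)
  obtain h where h: "strict_mono_on B h" "h ` B \<subseteq> q ` p"
    using embeds_copy[OF p] unfolding embeds_def by blast
  obtain C D where CD: "C \<subseteq> B" "D \<subseteq> B" "embeds B C" "embeds B D" "\<not> embeds B (C \<inter> D)"
    using assms by blast
  have "embeds B (h ` C)" "embeds B (h ` D)"
    using CD embeds_image[OF h(1)] embeds_trans by blast+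
  moreover have "h ` C \<subseteq> q ` p" "h ` D \<subseteq> q ` p" using h(2) CD(1,2) by blast+
  ultimately obtain u v where u: "u \<in> copies L r" "u \<subseteq> p" "q ` u \<subseteq> h ` C"
    and v: "v \<in> copies L r" "v \<subseteq> p" "q ` v \<subseteq> h ` D"
    using copy_inside pL by meson
  then obtain s where s: "s \<in> copies L r" "s \<subseteq> u" "s \<subseteq> v" using comp[OF u(1) v(1) u(2) v(2)] by blast
  have "q ` s \<subseteq> h ` C \<inter> h ` D" using s(2,3) u(3) v(3) by blast
  also have "\<dots> = h ` (C \<inter> D)"
    using CD(1,2) strict_mono_on_imp_inj_on[OF h(1)] by (simp add: inj_on_image_Int)
  finally have "embeds B (h ` (C \<inter> D))" using embeds_copy[OF s(1)] embeds_mono by blast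
  then have "embeds B (C \<inter> D)" using embeds_image_inv[OF h(1)] CD(1) embeds_trans by blast
  then show False using CD(5) by simp
qed

lemma preorder_on_copies: "preorder_on (copies L r) (relation_of (\<subseteq>) (copies L r))"
  unfolding preorder_on_def by (auto simp: relation_of_def refl_on_def trans_def)

text \<open>Representatives of a decreasing sequence of classes decrease only in the separative
  order, which does not give inclusions. Still any finitely many of them contain a common copy
  (\<open>below\<close>), and this supplies the premise of \<open>pi\<close>; a copy inside the
  pseudo-intersection then represents a lower bound.\<close>

lemma sigma_closed_copies:
  assumes pi: "\<And>X :: nat \<Rightarrow> 'b set. (\<And>k. embeds B (B \<inter> (\<Inter>j\<le>k. X j))) \<Longrightarrow>
      \<exists>p \<subseteq> B \<inter> X 0. embeds B p \<and> (\<forall>k s. s \<subseteq> p \<longrightarrow> embeds B s \<longrightarrow> embeds B (s \<inter> X k))"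
  shows "sigma_closed (sep_quotient (copies L r) (relation_of (\<subseteq>) (copies L r)))
    (sep_quotient_order (copies L r) (relation_of (\<subseteq>) (copies L r)))"
  unfolding sigma_closed_def
proof (intro allI impI)
  let ?P = "copies L r"
  let ?R = "relation_of (\<subseteq>) ?P"
  fix f :: "nat \<Rightarrow> 'a set set"
  assume f: "\<forall>n. f n \<in> sep_quotient ?P ?R"
    and dec: "\<forall>n. (f (Suc n), f n) \<in> sep_quotient_order ?P ?R"
  have "\<exists>A. A \<in> ?P \<and> f n = sep_equiv ?P ?R `` {A}" for n
    using f unfolding sep_quotient_def by (metis quotientE)
  then obtain A where A: "\<And>n. A n \<in> ?P" "\<And>n. f n = sep_equiv ?P ?R `` {A n}" by metis
  have AL: "A n \<subseteq> L" for n using A(1) by (simp add: copies_def)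
  have refl: "(A n, A n) \<in> sep_mod ?P ?R" for n
    using preorder_on_sep_mod[OF preorder_on_copies] A(1) by (simp add: preorder_on_def refl_on_def)
  have tr: "trans (sep_mod ?P ?R)"
    using preorder_on_sep_mod[OF preorder_on_copies] by (simp add: preorder_on_def)
  have step: "(A (Suc n), A n) \<in> sep_mod ?P ?R" for n
    using dec A sep_quotient_order_iff[OF preorder_on_copies A(1) A(1), of "Suc n" n] by simp
  have le: "(A k, A j) \<in> sep_mod ?P ?R" if "j \<le> k" for j k
    using that
  proof (induction k rule: dec_induct)
    case (step k)
    then show ?case using transD[OF tr \<open>\<And>n. (A (Suc n), A n) \<in> sep_mod ?P ?R\<close>] by blast
  qed (rule refl)
  have below: "\<exists>s\<in>?P. s \<subseteq> A k \<and> (\<forall>j<m. s \<subseteq> A j)" if "m \<le> Suc k" for m k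
    using that
  proof (induction m)
    case 0
    then show ?case using A(1) by blast
  next
    case (Suc m)
    then obtain s where s: "s \<in> ?P" "s \<subseteq> A k" "\<forall>j<m. s \<subseteq> A j" by auto
    obtain u where u: "u \<in> ?P" "u \<subseteq> s" "u \<subseteq> A m"
      using le[of m k] Suc.prems s(1,2) A(1) unfolding sep_mod_def
      by (auto simp: relation_of_subset_iff)
    have "u \<subseteq> A j" if "j < Suc m" for j
      using s(3) u(2,3) that by (cases "j = m") (auto simp: less_Suc_eq)
    then have "u \<subseteq> A k" "\<forall>j<Suc m. u \<subseteq> A j" using s(2) u(2) by auto
    then show ?case using u(1) by blast
  qed
  have "embeds B (B \<inter> (\<Inter>j\<le>k. q ` A j))" for k
  proof -
    obtain s where s: "s \<in> ?P" "\<forall>j<Suc k. s \<subseteq> A j" using below[of "Suc k" k] by blast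
    have "s \<subseteq> L" using s(1) by (simp add: copies_def)
    then have "q ` s \<subseteq> B" using B(1) by blast
    then have "q ` s \<subseteq> B \<inter> (\<Inter>j\<le>k. q ` A j)" using s(2) by (auto simp: less_Suc_eq_le)
    then show ?thesis by (rule embeds_mono[OF embeds_copy[OF s(1)] order.refl])
  qed
  then obtain p where p: "p \<subseteq> B \<inter> q ` A 0" "embeds B p"
    "\<And>k s. s \<subseteq> p \<Longrightarrow> embeds B s \<Longrightarrow> embeds B (s \<inter> q ` A k)"
    using pi[of "\<lambda>j. q ` A j"] by blast
  have "p \<subseteq> q ` A 0" using p(1) by blast
  from copy_inside[OF p(2) this AL] obtain C where C: "C \<in> ?P" "q ` C \<subseteq> p" by blast
  have "(C, A k) \<in> sep_mod ?P ?R" for k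
    unfolding sep_mod_def
  proof (clarsimp simp: C A relation_of_subset_iff)
    fix t assume t: "t \<in> ?P" "t \<subseteq> C"
    have tL: "t \<subseteq> L" using t(1) by (simp add: copies_def)
    have "embeds B (q ` t \<inter> q ` A k)"
      by (rule p(3)[OF _ embeds_copy[OF t(1)]]) (use t(2) C(2) in blast)
    also have "q ` t \<inter> q ` A k = q ` (t \<inter> A k)" using inj_on_image_Int[OF inj tL AL] by simp
    finally obtain s where "s \<in> ?P" "s \<subseteq> t \<inter> A k"
      using copy_inside[of "q ` (t \<inter> A k)" "t \<inter> A k"] tL by blast
    then show "\<exists>s\<in>?P. s \<subseteq> t \<and> s \<subseteq> A k" by blast
  qed
  then have "(sep_equiv ?P ?R `` {C}, f k) \<in> sep_quotient_order ?P ?R" for k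
    using A(2) by (auto simp: sep_quotient_order_def)
  moreover have "sep_equiv ?P ?R `` {C} \<in> sep_quotient ?P ?R"
    unfolding sep_quotient_def using C(1) by (rule quotientI)
  ultimately show "\<exists>p\<in>sep_quotient ?P ?R. \<forall>n. (p, f n) \<in> sep_quotient_order ?P ?R" by blast
qed

text \<open>The upper bound is the number of subsets of a countable set. For the lower bound the
  ranges of the binary family of self-embeddings of the image of \<open>L\<close> are pulled back to
  \<open>L\<close>.\<close>

lemma copies_eqpoll_continuum:
  assumes "countable L" "infinite L" "decomposable (q ` L)"
  shows "copies L r \<approx> (UNIV :: nat set set)"
proof (rule lepoll_antisym)
  show "copies L r \<lesssim> (UNIV :: nat set set)"
    unfolding lepoll_def
  proof (intro exI[of _ "image (to_nat_on L)"] conjI)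
    have "inj_on (image (to_nat_on L)) (Pow L)"
      using inj_on_to_nat_on[OF assms(1)] by (rule inj_on_image_Pow)
    then show "inj_on (image (to_nat_on L)) (copies L r)"
      by (rule inj_on_subset) (auto simp: copies_def)
  qed simp
  have "infinite (q ` L)" using assms(2) inj by (simp add: finite_image_iff)
  from binary_self_embeddings[OF assms(3) this] obtain h :: "nat set \<Rightarrow> 'b \<Rightarrow> 'b"
    where "(\<forall>Z. strict_mono_on (q ` L) (h Z) \<and> h Z ` q ` L \<subseteq> q ` L) \<and> inj (\<lambda>Z. h Z ` q ` L)"
    by (elim exE) (erule that)
  then have h: "strict_mono_on (q ` L) (h Z)" "h Z ` q ` L \<subseteq> q ` L" "inj (\<lambda>Z. h Z ` q ` L)" for Z
    by simp_all
  define C where "C Z = {x \<in> L. q x \<in> h Z ` q ` L}" for Z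
  have qC: "q ` C Z = h Z ` q ` L" for Z
  proof
    show "h Z ` q ` L \<subseteq> q ` C Z"
    proof
      fix y assume y: "y \<in> h Z ` q ` L"
      then obtain x where "x \<in> L" "y = q x" using h(2)[of Z] by blast
      then show "y \<in> q ` C Z" using y by (auto simp: C_def)
    qed
  qed (auto simp: C_def)
  have "C Z \<in> copies L r" for Z
  proof -
    define g where "g x = inv_into L q (h Z (q x))" for x
    have g: "q (g x) = h Z (q x)" "g x \<in> L" if "x \<in> L" for x
    proof -
      have "h Z (q x) \<in> q ` L" using h(2)[of Z] that by blast
      then show "q (g x) = h Z (q x)" "g x \<in> L"
        unfolding g_def by (simp_all add: f_inv_into_f inv_into_into)
    qed
    have le: "h Z (q x) \<le> h Z (q y) \<longleftrightarrow> q x \<le> q y" if "x \<in> L" "y \<in> L" for x y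
      using strict_mono_on_le_iff[OF h(1)[of Z]] that by simp
    have iff: "(x, y) \<in> r \<longleftrightarrow> (g x, g y) \<in> r" if "x \<in> L" "y \<in> L" for x y
      using q[of x y] q[of "g x" "g y"] g that le by simp
    have "inj_on g L"
    proof (rule inj_onI)
      fix x y assume xy: "x \<in> L" "y \<in> L" "g x = g y"
      then have "h Z (q x) = h Z (q y)" using g(1)[OF xy(1)] g(1)[OF xy(2)] by simp
      then have "q x = q y" using le[OF xy(1,2)] le[OF xy(2,1)] by simp
      then show "x = y" using inj xy(1,2) by (auto dest: inj_onD)
    qed
    then have "self_embedding L r g" using iff g(2) by (auto simp: self_embedding_def)
    moreover have "C Z = g ` L"
    proof
      show "g ` L \<subseteq> C Z" using g by (auto simp: C_def)
      show "C Z \<subseteq> g ` L"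
      proof
        fix x assume "x \<in> C Z"
        then obtain y where y: "x \<in> L" "y \<in> L" "q x = h Z (q y)" by (auto simp: C_def)
        then have "q x = q (g y)" using g(1) by simp
        then have "x = g y" using inj y(1) g(2)[OF y(2)] by (auto dest: inj_onD)
        then show "x \<in> g ` L" using y(2) by simp
      qed
    qed
    ultimately show ?thesis unfolding copies_iff by blast
  qed
  moreover have "inj C"
    using h(3) qC unfolding inj_def by metis
  ultimately show "(UNIV :: nat set set) \<lesssim> copies L r"
    unfolding lepoll_def by (intro exI[of _ C]) auto
qed

end

theorem theorem1p2:
  fixes L :: "'a set" and r :: "'a rel"
  assumes "linear_order_on L r"
    and "countable L" and "infinite L"
    and "scattered L r"
  shows "homogeneous (copies L r) (relation_of (\<subseteq>) (copies L r))
    \<and> atomless (copies L r) (relation_of (\<subseteq>) (copies L r))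
    \<and> copies L r \<approx> (UNIV :: nat set set)
    \<and> sigma_closed (sep_quotient (copies L r) (relation_of (\<subseteq>) (copies L r)))
        (sep_quotient_order (copies L r) (relation_of (\<subseteq>) (copies L r)))"
proof -
  obtain e :: "'a \<Rightarrow> rat" where e: "\<And>x y. x \<in> L \<Longrightarrow> y \<in> L \<Longrightarrow> (x, y) \<in> r \<longleftrightarrow> e x \<le> e y" "inj_on e L"
    using rational_representation[OF assms(1,2)] by blast
  have scat: "\<not> embeds (UNIV :: rat set) (e ` L)"
  proof
    assume "embeds (UNIV :: rat set) (e ` L)"
    then obtain f :: "rat \<Rightarrow> rat" where f: "strict_mono f" "range f \<subseteq> e ` L"
      unfolding embeds_def by blast
    define g where "g x = inv_into L e (f x)" for x
    have g: "e (g x) = f x" "g x \<in> L" for x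
    proof -
      have "f x \<in> e ` L" using f(2) by blast
      then show "e (g x) = f x" "g x \<in> L" unfolding g_def by (simp_all add: f_inv_into_f inv_into_into)
    qed
    have "x \<le> y \<longleftrightarrow> (g x, g y) \<in> r" for x y
      using e(1)[OF g(2) g(2)] g(1) strict_mono_less_eq[OF f(1)] by simp
    moreover have "inj g" using strict_mono_eq[OF f(1)] g(1) by (metis injI)
    ultimately have "order_embeds (UNIV :: rat set) (relation_of (\<le>) UNIV) L r"
      unfolding order_embeds_def using g(2) by (intro exI[of _ g]) (auto simp: relation_of_def)
    then show False using assms(4) by (simp add: scattered_def)
  qed
  have dec: "decomposable (e ` L)" using assms(2) scat by (intro scattered_decomposable) simp_all
  have inf: "infinite (e ` L)" using assms(3) e(2) by (simp add: finite_image_iff)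
  from pseudo_intersection_and_incompatible_copies[OF dec inf scat] obtain B where *:
    "B \<subseteq> e ` L \<and> embeds (e ` L) B \<and>
      (\<forall>X :: nat \<Rightarrow> rat set. (\<forall>k. embeds B (B \<inter> (\<Inter>j\<le>k. X j))) \<longrightarrow>
        (\<exists>p \<subseteq> B \<inter> X 0. embeds B p \<and> (\<forall>k s. s \<subseteq> p \<longrightarrow> embeds B s \<longrightarrow> embeds B (s \<inter> X k)))) \<and>
      (\<exists>C\<subseteq>B. \<exists>D\<subseteq>B. embeds B C \<and> embeds B D \<and> \<not> embeds B (C \<inter> D))"
    by (elim exE) (erule that)
  then have B: "B \<subseteq> e ` L" "embeds (e ` L) B"
    and inc: "\<exists>C\<subseteq>B. \<exists>D\<subseteq>B. embeds B C \<and> embeds B D \<and> \<not> embeds B (C \<inter> D)" by argo+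
  have pi: "\<exists>p \<subseteq> B \<inter> X 0. embeds B p \<and> (\<forall>k s. s \<subseteq> p \<longrightarrow> embeds B s \<longrightarrow> embeds B (s \<inter> X k))"
    if "\<And>k. embeds B (B \<inter> (\<Inter>j\<le>k. X j))" for X :: "nat \<Rightarrow> rat set"
    using *[THEN conjunct2, THEN conjunct2, THEN conjunct1] that by simp
  \<comment> \<open>\<open>L\<close> is moved once more, from its image under \<open>e\<close> into
    \<open>B\<close>. Then \<open>B\<close> and the new image embed in each other: \<open>B\<close>
    is contained in the old image, which \<open>g\<close> maps onto the new one.\<close>
  obtain g where g: "strict_mono_on (e ` L) g" "g ` e ` L \<subseteq> B" using B(2) unfolding embeds_def by blast
  define q where "q = g \<circ> e"
  have q: "(x, y) \<in> r \<longleftrightarrow> q x \<le> q y" if "x \<in> L" "y \<in> L" for x y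
  proof -
    have "e x \<le> e y \<longleftrightarrow> g (e x) \<le> g (e y)"
      using strict_mono_on_le_iff[OF g(1)] that by simp
    then show ?thesis using e(1)[OF that] by (simp add: q_def)
  qed
  have inj: "inj_on q L"
    unfolding q_def using e(2) strict_mono_on_imp_inj_on[OF g(1)] by (rule comp_inj_on)
  have qB: "q ` L \<subseteq> B" using g(2) by (auto simp: q_def)
  have "embeds B (g ` e ` L)"
    using embeds_mono[OF embeds_image[OF g(1) order.refl] B(1) order.refl] .
  then have emb: "embeds B (q ` L)" by (simp add: q_def image_comp)
  have decq: "decomposable (q ` L)" using decomposable_subset[OF dec] qB B(1) by blast
  have "homogeneous (copies L r) (relation_of (\<subseteq>) (copies L r))" by (rule homogeneous_copies)
  moreover have "atomless (copies L r) (relation_of (\<subseteq>) (copies L r))"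
    using q inj qB emb inc by (rule atomless_copies)
  moreover have "copies L r \<approx> (UNIV :: nat set set)"
    using q inj qB emb assms(2,3) decq by (rule copies_eqpoll_continuum)
  moreover have "sigma_closed (sep_quotient (copies L r) (relation_of (\<subseteq>) (copies L r)))
      (sep_quotient_order (copies L r) (relation_of (\<subseteq>) (copies L r)))"
    using q inj qB emb pi by (rule sigma_closed_copies)
  ultimately show ?thesis by blast
qed

end
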